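(* A closed subset $X$ of $\mathbb R^n$ is a conic singular sub-manifold of $\mathbb R^n$ if and only if $\mathrm{clos}(\sigma_n(X))$, the closure of $\sigma_n(X)$ in $\mathbb S^n$, is a conic singular sub-manifold of $\mathbb S^n$. Here $\sigma_n:\mathbb R^n\to\mathbb S^n\setminus\{(0,\ldots,0,1)\}$ is the inverse of the stereographic projection, $$\sigma_n(x)=\left(\frac{2x}{|x|^2+1},\frac{|x|^2-1}{|x|^2+1}\right).$$
   Context: Smooth means $C^\infty$. **Sub-manifolds.** Sub-manifolds are embedded (manifold topology equal to the induced topology, inclusion a smooth injective immersion); different connected components may have different dimensions. Unless a boundary is mentioned, sub-manifolds have no boundary. A subset $N$ of a smooth manifold with boundary $(P,\partial P)$ is a p-sub-manifold of $P$ if it is a smooth sub-manifold with (possibly empty) boundary $\partial N$, with $\partial N=N\cap\partial P$, and $T_xN+T_x\partial P=T_xP$ for every $x\in\partial N$. **Conic points.** For $a\in\mathbb R^n$, let $[\mathbb R^n,a]=[0,\infty)\times\mathbb S^{n-1}$ and $\mathrm{bl}_a:[\mathbb R^n,a]\to\mathbb R^n$, $(r,u)\mapsto ru+a$. The strict transform of $S\subset \mathbb R^n$ is $[S,a]=\mathrm{clos}(\mathrm{bl}_a^{-1}(S\setminus a))$. Let $X\subset\mathbb R^n$ have non-empty and closed germ at $a$. The point $a$ is a conic point of $X$ if there is $r>0$ such that the strict transform of $X\cap\{|x-a|<r\}$, taken inside $[0,r)\times\mathbb S^{n-1}$, is a closed subset and a p-sub-manifold of $[0,r)\times\mathbb S^{n-1}$.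 A subset $Z$ of a smooth $n$-manifold $M$ is conic at $z\in Z$ if there is a smooth chart $\psi:\mathcal U\to B^n_1$ of $M$ centred at $z$, onto the open unit ball of $\mathbb R^n$, such that $\psi(z)$ is a conic point of $\psi(Z\cap\mathcal U)$ (this does not depend on the chart). **Singular points.** A point of a subset $S$ of a smooth manifold is singular if the germ of $S$ at this point is not the germ of a smooth sub-manifold; $S_{\rm sing}$ is the set of singular points of $S$. **Conic singular sub-manifolds of a manifold** (used for $M=\mathbb S^n$). A subset $W$ of $M$ is a conic singular sub-manifold of $M$ if (i) it is closed in $M$; (ii) each point of $W$ is conic; (iii) $W_{\rm sing}$ is finite or empty. **Conic at infinity.** Let $\overline{\mathbf M}=[0,\infty)\times\mathbb S^{n-1}$ and let $\beta:(0,\infty)\times\mathbb S^{n-1}\to\mathbb R^n\setminus 0$, $\beta(r,u)=u/r$. The space $\overline{\mathbb R^n}$ is the compactification of $\mathbb R^n$ as a manifold with boundary obtained by identifying $\mathbb R^n\setminus 0$ with the interior of $\overline{\mathbf M}$ via $\beta$; its boundary is $0\times\mathbb S^{n-1}$. For $X\subset\mathbb R^n$, let $\overline X$ be its closure in $\overline{\mathbb R^n}$ and let $0\times X^\infty=\overline X\cap(0\times\mathbb S^{n-1})$. The set $X$ is conic at $\infty$ if either $X$ is bounded, or the germ of $\overline X$ along $0\times X^\infty$ is non-empty and is the germ of a smooth p-sub-manifold of $\overline{\mathbb R^n}$. **Conic singular sub-manifolds of $\mathbb R^n$.** A subset $X$ of $\mathbb R^n$ is a conic singular sub-manifold of $\mathbb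 R^n$ if (i) it is closed; (ii) $X_{\rm sing}$ is finite or empty; (iii) each point of $X_{\rm sing}$ is a conic point of $X$; (iv) $X$ is conic at $\infty$. *)

theory Defs
  imports "HOL-Analysis.Analysis"
begin

text \<open>
  \<open>\<real>\<^sup>n\<close> is an arbitrary Euclidean space \<open>'a\<close> with \<open>n = DIM('a)\<close>. Except for the radial
  compactification, every ambient manifold is an embedded subset of a Euclidean space:
  \<open>S\<^sup>n\<close> is \<open>sphere 0 1\<close> in \<open>'a \<times> real\<close> (the last coordinate being the real one), and
  \<open>[0,r) \<times> S\<^sup>n\<^sup>-\<^sup>1\<close> is a subset of \<open>real \<times> 'a\<close>. Since such an ambient manifold \<open>P\<close> is itself
  embedded, with the induced topology, a subset of \<open>P\<close> is a sub-manifold of \<open>P\<close> iff it is a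
  sub-manifold of the surrounding Euclidean space.
\<close>


section \<open>Smooth maps\<close>

text \<open>The next two notions are meant for open sets only.\<close>

primrec Ck_on :: "nat \<Rightarrow> 'a::real_normed_vector set \<Rightarrow> ('a \<Rightarrow> 'b::real_normed_vector) \<Rightarrow> bool" where
  "Ck_on 0 U f \<longleftrightarrow> continuous_on U f"
| "Ck_on (Suc k) U f \<longleftrightarrow>
     (\<forall>x\<in>U. f differentiable (at x)) \<and> (\<forall>v. Ck_on k U (\<lambda>x. frechet_derivative f (at x) v))"

definition Cinf_on :: "'a::real_normed_vector set \<Rightarrow> ('a \<Rightarrow> 'b::real_normed_vector) \<Rightarrow> bool" where
  "Cinf_on U f \<longleftrightarrow> (\<forall>k. Ck_on k U f)"

text \<open>On an arbitrary subset, smooth means: locally the restriction of a smooth map.\<close>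

definition smooth_on :: "'a::real_normed_vector set \<Rightarrow> ('a \<Rightarrow> 'b::real_normed_vector) \<Rightarrow> bool" where
  "smooth_on S f \<longleftrightarrow>
     (\<forall>x\<in>S. \<exists>V g. open V \<and> x \<in> V \<and> Cinf_on V g \<and> (\<forall>y\<in>S \<inter> V. f y = g y))"


section \<open>Embedded sub-manifolds with boundary\<close>

text \<open>
  For a subspace \<open>L\<close>, \<open>w \<in> L\<close>: this is a half-space of \<open>L\<close> if \<open>w \<noteq> 0\<close>, and all of \<open>L\<close> if
  \<open>w = 0\<close>.
\<close>

definition half_space :: "'a::euclidean_space set \<Rightarrow> 'a \<Rightarrow> 'a set" where
  "half_space L w = {y \<in> L. 0 \<le> y \<bullet> w}"

text \<open>
  Inverse of a local chart of \<open>N\<close>: an immersion \<open>g\<close> of the relatively open subset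
  \<open>U \<inter> half_space L w\<close> of a half-space (or vector space), which is a homeomorphism onto an open
  subset of \<open>N\<close> for the induced topology. The dimension of \<open>L\<close> depends on the point, so components
  of different dimensions are allowed. Taking \<open>L\<close> inside the surrounding space loses nothing, as
  \<open>dim N \<le> DIM('a)\<close>.
\<close>

definition local_param ::
  "'a::euclidean_space set \<Rightarrow> 'a set \<Rightarrow> 'a \<Rightarrow> 'a set \<Rightarrow> ('a \<Rightarrow> 'a) \<Rightarrow> bool" where
  "local_param N L w U g \<longleftrightarrow>
     subspace L \<and> w \<in> L \<and> open U \<and> Cinf_on U g \<and>
     (\<forall>y \<in> U \<inter> half_space L w. inj_on (frechet_derivative g (at y)) L) \<and>
     openin (top_of_set N) (g ` (U \<inter> half_space L w)) \<and>
     (\<exists>h. homeomorphism (U \<inter> half_space L w) (g ` (U \<inter> half_space L w)) g h)"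

definition bd_submanifold :: "'a::euclidean_space set \<Rightarrow> bool" where
  "bd_submanifold N \<longleftrightarrow>
     (\<forall>x\<in>N. \<exists>L w U g. local_param N L w U g \<and> x \<in> g ` (U \<inter> half_space L w))"

definition mf_boundary :: "'a::euclidean_space set \<Rightarrow> 'a set" where
  "mf_boundary N =
     {x. \<exists>L w U g y. local_param N L w U g \<and> w \<noteq> 0 \<and>
                     y \<in> U \<inter> half_space L w \<and> y \<bullet> w = 0 \<and> g y = x}"

text \<open>
  At a boundary point the tangent space is the full vector space, not a half-space. The union over
  all parametrisations is taken only to avoid a choice; they all yield the same subspace.
\<close>

definition tangent_space :: "'a::euclidean_space set \<Rightarrow> 'a \<Rightarrow> 'a set" where
  "tangent_space N x =
     {v. \<exists>L w U g y. local_param N L w U g \<and> y \<in> U \<inter> half_space L w \<and> g y = x \<and>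
                     v \<in> frechet_derivative g (at y) ` L}"

definition submanifold :: "'a::euclidean_space set \<Rightarrow> 'a set \<Rightarrow> bool" where
  "submanifold M N \<longleftrightarrow> N \<subseteq> M \<and> bd_submanifold N \<and> mf_boundary N = {}"

definition p_submanifold :: "'a::euclidean_space set \<Rightarrow> 'a set \<Rightarrow> bool" where
  "p_submanifold P N \<longleftrightarrow>
     N \<subseteq> P \<and> bd_submanifold N \<and> mf_boundary N = N \<inter> mf_boundary P \<and>
     (\<forall>x \<in> mf_boundary N.
        {u + v |u v. u \<in> tangent_space N x \<and> v \<in> tangent_space (mf_boundary P) x}
          = tangent_space P x)"

definition singular_points :: "'a::euclidean_space set \<Rightarrow> 'a set \<Rightarrow> 'a set" where
  "singular_points M S =
     {p \<in> S. \<not> (\<exists>N V. submanifold M N \<and> open V \<and> p \<in> V \<and> S \<inter> V = N \<inter> V)}"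


section \<open>Conic points\<close>

definition blowup_space :: "(real \<times> 'a::euclidean_space) set" where
  "blowup_space = {0..} \<times> sphere 0 1"

definition bl :: "'a::euclidean_space \<Rightarrow> real \<times> 'a \<Rightarrow> 'a" where
  "bl a = (\<lambda>(r, u). r *\<^sub>R u + a)"

definition strict_transform :: "'a::euclidean_space \<Rightarrow> 'a set \<Rightarrow> (real \<times> 'a) set" where
  "strict_transform a S =
     top_of_set blowup_space closure_of {p \<in> blowup_space. bl a p \<in> S - {a}}"

text \<open>The first two conditions say that the germ of \<open>X\<close> at \<open>a\<close> is non-empty and closed.\<close>

definition conic_point :: "'a::euclidean_space set \<Rightarrow> 'a \<Rightarrow> bool" where
  "conic_point X a \<longleftrightarrow>
     (\<forall>V. open V \<and> a \<in> V \<longrightarrow> X \<inter> V \<noteq> {}) \<and>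
     (\<exists>V. open V \<and> a \<in> V \<and> closedin (top_of_set V) (X \<inter> V)) \<and>
     (\<exists>r>0. let P = {0..<r} \<times> sphere 0 1; T = strict_transform a (X \<inter> ball a r) \<inter> P
            in closedin (top_of_set P) T \<and> p_submanifold P T)"

text \<open>Diffeomorphism of an open subset \<open>U\<close> of \<open>M\<close> onto an open subset \<open>B\<close> of the model space.\<close>

definition smooth_chart ::
  "'b::euclidean_space set \<Rightarrow> 'b set \<Rightarrow> 'a::euclidean_space set \<Rightarrow> ('b \<Rightarrow> 'a) \<Rightarrow> bool" where
  "smooth_chart M U B \<psi> \<longleftrightarrow>
     openin (top_of_set M) U \<and> open B \<and> bij_betw \<psi> U B \<and>
     smooth_on U \<psi> \<and> smooth_on B (inv_into U \<psi>)"

text \<open>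
  The type of \<open>M\<close> fixes the model space \<open>'a\<close> of the charts, so this is for manifolds of dimension
  \<open>DIM('a)\<close>, such as the unit sphere of \<open>'a \<times> real\<close>.
\<close>

definition conic_at :: "('a::euclidean_space \<times> real) set \<Rightarrow> ('a \<times> real) set \<Rightarrow> 'a \<times> real \<Rightarrow> bool" where
  "conic_at M Z z \<longleftrightarrow>
     z \<in> Z \<and>
     (\<exists>U (\<psi> :: 'a \<times> real \<Rightarrow> 'a). smooth_chart M U (ball 0 1) \<psi> \<and> z \<in> U \<and> \<psi> z = 0 \<and>
        conic_point (\<psi> ` (Z \<inter> U)) (\<psi> z))"

definition conic_singular_submanifold_of ::
  "('a::euclidean_space \<times> real) set \<Rightarrow> ('a \<times> real) set \<Rightarrow> bool" where
  "conic_singular_submanifold_of M W \<longleftrightarrow>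
     closedin (top_of_set M) W \<and> (\<forall>z\<in>W. conic_at M W z) \<and> finite (singular_points M W)"


section \<open>The compactification of \<open>\<real>\<^sup>n\<close> and sets conic at infinity\<close>

text \<open>
  The compactification glues \<open>\<real>\<^sup>n\<close> and \<open>[0,\<infinity>) \<times> S\<^sup>n\<^sup>-\<^sup>1\<close> along \<open>\<beta>(r,u) = u/r\<close>, \<open>r > 0\<close>. The
  point \<open>Fin x\<close> is \<open>x \<in> \<real>\<^sup>n\<close>, and \<open>Inf u\<close> (for \<open>u\<close> of norm 1) is the boundary point \<open>(0,u)\<close>.
  \<open>Fin\<close> and \<open>infinity_collar\<close> are the two gluing maps; they are diffeomorphisms onto open sets
  covering the compactification, which defines its topology and its smooth structure.
\<close>

datatype 'a compactified = Fin 'a | Inf 'a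

definition compactified_carrier :: "'a::euclidean_space compactified set" where
  "compactified_carrier = range Fin \<union> Inf ` sphere 0 1"

definition infinity_collar :: "real \<times> 'a::euclidean_space \<Rightarrow> 'a compactified" where
  "infinity_collar = (\<lambda>(r, u). if r = 0 then Inf u else Fin (u /\<^sub>R r))"

definition compactified_open :: "'a::euclidean_space compactified set \<Rightarrow> bool" where
  "compactified_open V \<longleftrightarrow>
     V \<subseteq> compactified_carrier \<and> open {x. Fin x \<in> V} \<and>
     openin (top_of_set ({0..} \<times> sphere 0 1))
       {p \<in> {0..} \<times> sphere 0 1. infinity_collar p \<in> V}"

definition compactified_top :: "'a::euclidean_space compactified topology" where
  "compactified_top = topology compactified_open"

lemma istopology_compactified_open: "istopology compactified_open"
  unfolding istopology_def
proof (intro conjI allI impI)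
  fix V W :: "'a compactified set"
  assume V: "compactified_open V" and W: "compactified_open W"
  have 1: "{x. Fin x \<in> V \<inter> W} = {x. Fin x \<in> V} \<inter> {x. Fin x \<in> W}" by auto
  have 2: "{p \<in> {0..} \<times> sphere 0 1. infinity_collar p \<in> V \<inter> W} =
      {p \<in> {0..} \<times> sphere 0 1. infinity_collar p \<in> V} \<inter>
      {p \<in> {0..} \<times> sphere 0 1. infinity_collar p \<in> W}" by auto
  show "compactified_open (V \<inter> W)"
    using V W unfolding compactified_open_def 1 2 by (auto intro: open_Int openin_Int)
next
  fix \<K> :: "'a compactified set set"
  assume K: "\<forall>V\<in>\<K>. compactified_open V"
  have 1: "{x. Fin x \<in> \<Union>\<K>} = (\<Union>V\<in>\<K>. {x. Fin x \<in> V})" by auto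
  have 2: "{p \<in> {0..} \<times> sphere 0 1. infinity_collar p \<in> \<Union>\<K>} =
      (\<Union>V\<in>\<K>. {p \<in> {0..} \<times> sphere 0 1. infinity_collar p \<in> V})" by auto
  show "compactified_open (\<Union>\<K>)"
    using K unfolding compactified_open_def 1 2 by (auto intro!: open_UN openin_Union)
qed

lemma openin_compactified_top: "openin compactified_top V \<longleftrightarrow> compactified_open V"
  unfolding compactified_top_def by (simp add: istopology_compactified_open topology_inverse')

lemma topspace_compactified_top: "topspace compactified_top = compactified_carrier"
proof -
  have "infinity_collar p \<in> compactified_carrier" if "p \<in> {0..} \<times> sphere 0 1" for p :: "real \<times> 'a"
    using that by (auto simp: infinity_collar_def compactified_carrier_def)
  then have eq: "{p \<in> {0..} \<times> sphere 0 1. infinity_collar p \<in> compactified_carrier} =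
      ({0..} \<times> sphere 0 1 :: (real \<times> 'a) set)" by blast
  have "compactified_open (compactified_carrier :: 'a compactified set)"
    unfolding compactified_open_def eq by (auto simp: compactified_carrier_def)
  then show ?thesis
    unfolding topspace_def openin_compactified_top by (auto simp: compactified_open_def)
qed

text \<open>
  Being a p-sub-manifold is a local condition, checked here in the two open pieces. In the piece
  \<open>\<real>\<^sup>n\<close>, which has no boundary, it just says sub-manifold.
\<close>

definition compactified_p_submanifold :: "'a::euclidean_space compactified set \<Rightarrow> bool" where
  "compactified_p_submanifold N \<longleftrightarrow>
     N \<subseteq> compactified_carrier \<and>
     p_submanifold UNIV {x. Fin x \<in> N} \<and>
     p_submanifold ({0..} \<times> sphere 0 1) {p \<in> {0..} \<times> sphere 0 1. infinity_collar p \<in> N}"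

definition conic_at_infinity :: "'a::euclidean_space set \<Rightarrow> bool" where
  "conic_at_infinity X \<longleftrightarrow>
     bounded X \<or>
     (let Xbar = compactified_top closure_of (Fin ` X);
          bdX = Xbar \<inter> Inf ` sphere 0 1
      in bdX \<noteq> {} \<and>
         (\<exists>N V. compactified_p_submanifold N \<and> openin compactified_top V \<and> bdX \<subseteq> V \<and>
                Xbar \<inter> V = N \<inter> V))"

definition conic_singular_submanifold :: "'a::euclidean_space set \<Rightarrow> bool" where
  "conic_singular_submanifold X \<longleftrightarrow>
     closed X \<and> finite (singular_points UNIV X) \<and>
     (\<forall>a \<in> singular_points UNIV X. conic_point X a) \<and>
     conic_at_infinity X"


section \<open>Inverse stereographic projection\<close>

definition inv_stereographic :: "'a::euclidean_space \<Rightarrow> 'a \<times> real" where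
  "inv_stereographic x = ((2 / ((norm x)\<^sup>2 + 1)) *\<^sub>R x, ((norm x)\<^sup>2 - 1) / ((norm x)\<^sup>2 + 1))"

end

theory Submission
  imports Defs
begin

text \<open>
  Conicity, at a point or at infinity, is a condition on the trace of the set in a small
  cylinder \<open>[0,r) \<times> S\<^sup>n\<^sup>-\<^sup>1\<close> of polar coordinates. Three facts carry the proof.

  \<^item> Conicity is invariant under diffeomorphisms (\<open>conic_point_diffeo\<close>). By Hadamard's lemma a
    diffeomorphism satisfies \<open>\<phi> (a + s u) = \<phi> a + s H(s,u)\<close> with \<open>H\<close> smooth and nowhere zero on the
    cylinder, so that \<open>(s,u) \<mapsto> (s |H|, H / |H|)\<close> lifts it to a diffeomorphism between cylinders which
    matches strict transforms. Hence a subset of the sphere is conic at a point iff it is in one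
    arbitrarily chosen chart (\<open>conic_at_iff_conic_point\<close>), and away from the north pole the
    stereographic projection is such a chart.
  \<^item> Regular points are conic (\<open>conic_point_regular\<close>): a sub-manifold can be straightened to a linear
    subspace \<open>L\<close>, whose strict transform is the cylinder over the great sphere of \<open>L\<close>. This bridges
    the gap between the two definitions, the one in \<open>\<real>\<^sup>n\<close> asking for conicity at the singular points
    only, the one in \<open>S\<^sup>n\<close> at all points.
  \<^item> Read in the projection from the south pole, the inverse projection \<open>x \<mapsto> \<sigma>\<^sub>n x\<close> is the inversion
    \<open>x \<mapsto> x / |x|\<^sup>2\<close>, and polar coordinates of the inverted space at 0 are exactly the collar
    \<open>(s,u) \<mapsto> u / s\<close> of the compactification. If \<open>X\<close> is bounded, the closure of its image misses
    the north pole; otherwise conicity of \<open>X\<close> at infinity is a condition on a cylinder of polar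
    coordinates (\<open>conic_at_infinity_iff\<close>), the one saying that the closure is conic at the pole.

  Away from the pole the singular points of \<open>X\<close> and of the closure of its image correspond, so
  finiteness is the same on both sides.

  The definitions of boundary, tangent space and p-sub-manifold quantify over all local
  parametrisations. To control them, the tangent cone of a set is defined from the set alone; it
  determines both the boundary points and the tangent spaces (\<open>model_at_tangent_cone\<close>). Hence these
  do not depend on the parametrisation, and all notions are transported by diffeomorphisms between
  arbitrary subsets of Euclidean spaces (\<open>p_submanifold_transfer\<close>).
\<close>

section \<open>Calculus of smooth maps\<close>

lemma Ck_on_subset: "Ck_on k U f \<Longrightarrow> V \<subseteq> U \<Longrightarrow> Ck_on k V f"
  by (induction k arbitrary: f) (auto intro: continuous_on_subset)

text \<open>
  The set has to be open: a derivative at a point sees the values on a whole neighbourhood.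
\<close>

lemma Ck_on_cong:
  assumes "open U" "\<And>x. x \<in> U \<Longrightarrow> f x = g x" "Ck_on k U f"
  shows "Ck_on k U g"
  using assms(2,3)
proof (induction k arbitrary: f g)
  case 0
  then show ?case by (metis Ck_on.simps(1) continuous_on_cong)
next
  case (Suc k)
  have der: "(g has_derivative frechet_derivative f (at x)) (at x)" if "x \<in> U" for x
    using Suc.prems that \<open>open U\<close>
    by (auto intro: has_derivative_transform_within_open[of f _ x UNIV U]
        simp: frechet_derivative_works)
  then have eq: "frechet_derivative g (at x) = frechet_derivative f (at x)" if "x \<in> U" for x
    using that frechet_derivative_at by metis
  show ?case
    using der Suc.prems(2) Suc.IH[of "\<lambda>x. frechet_derivative f (at x) v"
        "\<lambda>x. frechet_derivative g (at x) v" for v] eq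
    by (auto simp: differentiable_def)
qed

text \<open>
  Differentiability classes are verified with explicit derivatives, instead of the one chosen by \<open>frechet_derivative\<close>.
\<close>

lemma Ck_on_SucI:
  assumes "open U" "\<And>x. x \<in> U \<Longrightarrow> (f has_derivative f' x) (at x)"
    "\<And>v. Ck_on k U (\<lambda>x. f' x v)"
  shows "Ck_on (Suc k) U f"
proof -
  have "Ck_on k U (\<lambda>x. frechet_derivative f (at x) v)" for v
  proof (rule Ck_on_cong[OF assms(1) _ assms(3)])
    show "f' x v = frechet_derivative f (at x) v" if "x \<in> U" for x
      using frechet_derivative_at[OF assms(2)[OF that]] by simp
  qed
  then show ?thesis using assms(2) by (auto simp: differentiable_def)
qed

lemma Ck_on_SucD:
  assumes "Ck_on (Suc k) U f" "x \<in> U"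
  shows "(f has_derivative frechet_derivative f (at x)) (at x)"
  using assms by (auto simp: frechet_derivative_works)

lemma Ck_on_pred: "Ck_on (Suc k) U f \<Longrightarrow> Ck_on k U f"
proof (induction k arbitrary: f)
  case 0
  then show ?case
    unfolding Ck_on.simps
    by (metis continuous_at_imp_continuous_on differentiable_imp_continuous_within)
next
  case (Suc k)
  then show ?case by (metis Ck_on.simps(2))
qed

lemma Ck_on_local:
  assumes "\<And>x. x \<in> U \<Longrightarrow> \<exists>V. open V \<and> x \<in> V \<and> Ck_on k V f"
  shows "Ck_on k U f"
  using assms
proof (induction k arbitrary: f)
  case 0
  then show ?case
    unfolding Ck_on.simps by (metis continuous_at_imp_continuous_on continuous_on_eq_continuous_at)
next
  case (Suc k)
  then show ?case by (metis Ck_on.simps(2))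
qed

lemma Ck_on_const: "Ck_on k U (\<lambda>x. c)"
  by (induction k arbitrary: c) auto

lemma Ck_on_bounded_linear:
  assumes "bounded_linear l" "open U"
  shows "Ck_on k U l"
proof (cases k)
  case 0
  then show ?thesis using assms by (simp add: linear_continuous_on)
next
  case (Suc m)
  show ?thesis unfolding Suc
    by (rule Ck_on_SucI[where f' = "\<lambda>x. l"])
      (use assms in \<open>auto intro: bounded_linear_imp_has_derivative Ck_on_const\<close>)
qed

lemma Ck_on_linear_compose:
  assumes "bounded_linear l" "open U" "Ck_on k U f"
  shows "Ck_on k U (\<lambda>x. l (f x))"
  using assms(3)
proof (induction k arbitrary: f)
  case 0
  then show ?case
    using assms(1) by (auto intro: bounded_linear.continuous_on)
next
  case (Suc k)
  show ?case
    by (rule Ck_on_SucI[where f' = "\<lambda>x v. l (frechet_derivative f (at x) v)"])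
      (use Suc assms bounded_linear.has_derivative[OF assms(1) Ck_on_SucD[OF Suc.prems]] in auto)
qed

lemma Ck_on_add:
  assumes "open U" "Ck_on k U f" "Ck_on k U g"
  shows "Ck_on k U (\<lambda>x. f x + g x)"
  using assms(2,3)
proof (induction k arbitrary: f g)
  case 0
  then show ?case by (auto intro: continuous_on_add)
next
  case (Suc k)
  show ?case
    by (rule Ck_on_SucI[where f' = "\<lambda>x v. frechet_derivative f (at x) v + frechet_derivative g (at x) v"])
      (use Suc assms(1) has_derivative_add[OF Ck_on_SucD[OF Suc.prems(1)] Ck_on_SucD[OF Suc.prems(2)]]
        in auto)
qed

lemma Ck_on_bilinear:
  assumes "bounded_bilinear pr" "open U" "Ck_on k U f" "Ck_on k U g"
  shows "Ck_on k U (\<lambda>x. pr (f x) (g x))"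
  using assms(3,4)
proof (induction k arbitrary: f g)
  case 0
  then show ?case using assms(1) by (auto intro: bounded_bilinear.continuous_on)
next
  case (Suc k)
  have f: "Ck_on k U f" and g: "Ck_on k U g"
    using Suc.prems Ck_on_pred by blast+
  show ?case
    by (rule Ck_on_SucI[where f' = "\<lambda>x v. pr (f x) (frechet_derivative g (at x) v)
        + pr (frechet_derivative f (at x) v) (g x)"])
      (use assms(2) f g Suc.prems Suc.IH
        bounded_bilinear.FDERIV[OF assms(1) Ck_on_SucD[OF Suc.prems(1)] Ck_on_SucD[OF Suc.prems(2)]]
        in \<open>auto intro!: Ck_on_add\<close>)
qed

lemma Ck_on_sum:
  assumes "open U" "\<And>i. i \<in> I \<Longrightarrow> Ck_on k U (f i)"
  shows "Ck_on k U (\<lambda>x. \<Sum>i\<in>I. f i x)"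
  using assms(2)
  by (induction I rule: infinite_finite_induct) (auto intro: Ck_on_const Ck_on_add[OF assms(1)])

lemma linear_basis_expansion:
  fixes l :: "'a::euclidean_space \<Rightarrow> 'b::real_vector"
  assumes "linear l"
  shows "l v = (\<Sum>b\<in>Basis. (v \<bullet> b) *\<^sub>R l b)"
proof -
  have "l v = l (\<Sum>b\<in>Basis. (v \<bullet> b) *\<^sub>R b)" by (simp add: euclidean_representation)
  also have "\<dots> = (\<Sum>b\<in>Basis. (v \<bullet> b) *\<^sub>R l b)"
    using assms by (simp add: linear_sum linear_cmul)
  finally show ?thesis .
qed

text \<open>
  The chain rule turns the derivative of \<open>g \<circ> f\<close> in direction \<open>v\<close> into \<open>Dg (f x) (Df x v)\<close>, where
  the direction fed to \<open>Dg\<close> varies with \<open>x\<close>. Expanding it in a basis leaves only fixed directions,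
  which is what the recursive definition of \<open>Ck_on\<close> can handle.
\<close>

lemma Ck_on_compose:
  fixes f :: "'a::real_normed_vector \<Rightarrow> 'b::euclidean_space"
    and g :: "'b \<Rightarrow> 'c::real_normed_vector"
  assumes "open U" "open V" "f ` U \<subseteq> V" "Ck_on k U f" "Ck_on k V g"
  shows "Ck_on k U (\<lambda>x. g (f x))"
  using assms(4,5)
proof (induction k arbitrary: g)
  case 0
  then show ?case using assms(3) by (auto intro: continuous_on_compose2)
next
  case (Suc k)
  define f' where "f' = (\<lambda>x. frechet_derivative f (at x))"
  define g' where "g' = (\<lambda>x. frechet_derivative g (at x))"
  have fk: "Ck_on k U f" using Suc.prems Ck_on_pred by blast
  have f': "(f has_derivative f' x) (at x)" if "x \<in> U" for x
    using Ck_on_SucD[OF Suc.prems(1) that] by (simp add: f'_def)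
  have g': "(g has_derivative g' (f x)) (at (f x))" if "x \<in> U" for x
    using Ck_on_SucD[OF Suc.prems(2), of "f x"] that assms(3) by (auto simp: g'_def)
  show ?case
  proof (rule Ck_on_SucI[OF \<open>open U\<close>])
    fix x assume x: "x \<in> U"
    have "linear (g' (f x))" using g'[OF x] has_derivative_linear by blast
    then have "(\<lambda>v. \<Sum>b\<in>Basis. (f' x v \<bullet> b) *\<^sub>R g' (f x) b) = (\<lambda>v. g' (f x) (f' x v))"
      by (metis linear_basis_expansion)
    then show "((\<lambda>x. g (f x)) has_derivative (\<lambda>v. \<Sum>b\<in>Basis. (f' x v \<bullet> b) *\<^sub>R g' (f x) b)) (at x)"
      using has_derivative_compose[OF f'[OF x] g'[OF x]] by simp
  next
    fix v
    have 1: "Ck_on k U (\<lambda>x. f' x v \<bullet> b)" for b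
      using Suc.prems(1) unfolding f'_def
      by (intro Ck_on_linear_compose[OF bounded_linear_inner_left \<open>open U\<close>]) auto
    have 2: "Ck_on k U (\<lambda>x. g' (f x) b)" for b
      using Suc.IH[OF fk, of "\<lambda>y. g' y b"] Suc.prems(2) by (auto simp: g'_def)
    show "Ck_on k U (\<lambda>x. \<Sum>b\<in>Basis. (f' x v \<bullet> b) *\<^sub>R g' (f x) b)"
      by (intro Ck_on_sum \<open>open U\<close> Ck_on_bilinear[OF bounded_bilinear_scaleR] 1 2)
  qed
qed

text \<open>
  The derivative of \<open>1/x\<close> is a polynomial in \<open>1/x\<close>, so the induction feeds itself. Likewise below, the derivative of
  the square root is a multiple of its reciprocal.
\<close>

lemma Ck_on_inverse: "Ck_on k (- {0}) (inverse :: real \<Rightarrow> real)"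
proof (induction k)
  case 0
  then show ?case by (auto intro!: continuous_intros)
next
  case (Suc k)
  show ?case
  proof (rule Ck_on_SucI[where f' = "\<lambda>x v. - v *\<^sub>R (inverse x * inverse x)"])
    show "(inverse has_derivative (\<lambda>v. - v *\<^sub>R (inverse x * inverse x))) (at x)"
      if "x \<in> - {0}" for x :: real
      using that by (auto intro!: derivative_eq_intros)
    have "Ck_on k (- {0}) (\<lambda>x :: real. inverse x * inverse x)"
      by (rule Ck_on_bilinear[OF bounded_bilinear_mult _ Suc Suc]) (simp add: open_Compl)
    then show "Ck_on k (- {0}) (\<lambda>x :: real. - v *\<^sub>R (inverse x * inverse x))" for v :: real
      by (rule Ck_on_linear_compose[OF bounded_linear_scaleR_right, rotated]) (simp add: open_Compl)
  qed auto
qed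

lemma Ck_on_sqrt: "Ck_on k {0<..} sqrt"
proof (induction k)
  case 0
  then show ?case by (auto intro!: continuous_intros)
next
  case (Suc k)
  show ?case
  proof (rule Ck_on_SucI[where f' = "\<lambda>x v. (v / 2) *\<^sub>R inverse (sqrt x)"])
    show "(sqrt has_derivative (\<lambda>v. (v / 2) *\<^sub>R inverse (sqrt x))) (at x)"
      if "x \<in> {0<..}" for x :: real
      using that by (auto intro!: derivative_eq_intros simp: field_simps)
    show "Ck_on k {0<..} (\<lambda>x. (v / 2) *\<^sub>R inverse (sqrt x))" for v :: real
      by (intro Ck_on_linear_compose[OF bounded_linear_scaleR_right, where f = "\<lambda>x. inverse (sqrt x)"]
          Ck_on_compose[OF _ _ _ Suc Ck_on_inverse]) auto
  qed auto
qed

lemma Cinf_on_subset: "Cinf_on U f \<Longrightarrow> V \<subseteq> U \<Longrightarrow> Cinf_on V f"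
  by (auto simp: Cinf_on_def intro: Ck_on_subset)

lemma Cinf_on_cong: "open U \<Longrightarrow> (\<And>x. x \<in> U \<Longrightarrow> f x = g x) \<Longrightarrow> Cinf_on U f \<Longrightarrow> Cinf_on U g"
  unfolding Cinf_on_def using Ck_on_cong by blast

lemma Cinf_on_has_derivative:
  "Cinf_on U f \<Longrightarrow> x \<in> U \<Longrightarrow> (f has_derivative frechet_derivative f (at x)) (at x)"
  unfolding Cinf_on_def using Ck_on_SucD by blast

lemma Cinf_on_continuous: "Cinf_on U f \<Longrightarrow> continuous_on U f"
  unfolding Cinf_on_def using Ck_on.simps(1) by blast

lemma Cinf_on_frechet_derivative:
  "Cinf_on U f \<Longrightarrow> Cinf_on U (\<lambda>x. frechet_derivative f (at x) v)"
  unfolding Cinf_on_def by (metis Ck_on.simps(2))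

lemma Cinf_on_local:
  assumes "\<And>x. x \<in> U \<Longrightarrow> \<exists>V. open V \<and> x \<in> V \<and> Cinf_on V f"
  shows "Cinf_on U f"
  unfolding Cinf_on_def
proof
  fix k
  have "\<exists>V. open V \<and> x \<in> V \<and> Ck_on k V f" if "x \<in> U" for x
    using assms[OF that] unfolding Cinf_on_def by blast
  then show "Ck_on k U f" by (rule Ck_on_local)
qed

lemma Cinf_on_const: "Cinf_on U (\<lambda>x. c)"
  by (simp add: Cinf_on_def Ck_on_const)

lemma Cinf_on_bounded_linear: "bounded_linear l \<Longrightarrow> open U \<Longrightarrow> Cinf_on U l"
  by (simp add: Cinf_on_def Ck_on_bounded_linear)

lemma Cinf_on_linear_compose:
  "bounded_linear l \<Longrightarrow> open U \<Longrightarrow> Cinf_on U f \<Longrightarrow> Cinf_on U (\<lambda>x. l (f x))"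
  by (simp add: Cinf_on_def Ck_on_linear_compose)

lemma Cinf_on_add: "open U \<Longrightarrow> Cinf_on U f \<Longrightarrow> Cinf_on U g \<Longrightarrow> Cinf_on U (\<lambda>x. f x + g x)"
  by (simp add: Cinf_on_def Ck_on_add)

lemma Cinf_on_bilinear:
  "bounded_bilinear pr \<Longrightarrow> open U \<Longrightarrow> Cinf_on U f \<Longrightarrow> Cinf_on U g \<Longrightarrow>
    Cinf_on U (\<lambda>x. pr (f x) (g x))"
  by (simp add: Cinf_on_def Ck_on_bilinear)

lemma Cinf_on_sum:
  "open U \<Longrightarrow> (\<And>i. i \<in> I \<Longrightarrow> Cinf_on U (f i)) \<Longrightarrow> Cinf_on U (\<lambda>x. \<Sum>i\<in>I. f i x)"
  by (simp add: Cinf_on_def Ck_on_sum)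

lemma Cinf_on_compose:
  fixes f :: "'a::real_normed_vector \<Rightarrow> 'b::euclidean_space"
  assumes "open U" "open V" "f ` U \<subseteq> V" "Cinf_on U f" "Cinf_on V g"
  shows "Cinf_on U (\<lambda>x. g (f x))"
  using assms by (simp add: Cinf_on_def Ck_on_compose)

lemma Cinf_on_minus: "open U \<Longrightarrow> Cinf_on U f \<Longrightarrow> Cinf_on U (\<lambda>x. - f x)"
  by (rule Cinf_on_linear_compose[OF bounded_linear_minus]) (auto intro: bounded_linear_ident)

lemma Cinf_on_diff: "open U \<Longrightarrow> Cinf_on U f \<Longrightarrow> Cinf_on U g \<Longrightarrow> Cinf_on U (\<lambda>x. f x - g x)"
  using Cinf_on_add[of U f "\<lambda>x. - g x"] Cinf_on_minus[of U g] by simp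

lemma Cinf_on_ident: "open U \<Longrightarrow> Cinf_on U (\<lambda>x. x)"
  by (rule Cinf_on_bounded_linear) (auto intro: bounded_linear_ident)

lemma Cinf_on_fst: "open U \<Longrightarrow> Cinf_on U f \<Longrightarrow> Cinf_on U (\<lambda>x. fst (f x))"
  by (rule Cinf_on_linear_compose[OF bounded_linear_fst])

lemma Cinf_on_snd: "open U \<Longrightarrow> Cinf_on U f \<Longrightarrow> Cinf_on U (\<lambda>x. snd (f x))"
  by (rule Cinf_on_linear_compose[OF bounded_linear_snd])

lemma Cinf_on_Pair:
  assumes "open U" "Cinf_on U f" "Cinf_on U g"
  shows "Cinf_on U (\<lambda>x. (f x, g x))"
proof -
  have "Cinf_on U (\<lambda>x. (f x, 0) + (0, g x))"
    by (intro Cinf_on_add assms Cinf_on_linear_compose[of "\<lambda>y. (y, 0)"]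
        Cinf_on_linear_compose[of "\<lambda>y. (0, y)"])
      (auto intro!: bounded_linear_intros)
  then show ?thesis by simp
qed

lemma Cinf_on_scaleR:
  "open U \<Longrightarrow> Cinf_on U f \<Longrightarrow> Cinf_on U g \<Longrightarrow> Cinf_on U (\<lambda>x. f x *\<^sub>R g x)"
  by (rule Cinf_on_bilinear[OF bounded_bilinear_scaleR])

lemma Cinf_on_mult:
  fixes f g :: "_ \<Rightarrow> real"
  shows "open U \<Longrightarrow> Cinf_on U f \<Longrightarrow> Cinf_on U g \<Longrightarrow> Cinf_on U (\<lambda>x. f x * g x)"
  by (rule Cinf_on_bilinear[OF bounded_bilinear_mult])

lemma Cinf_on_inner:
  "open U \<Longrightarrow> Cinf_on U f \<Longrightarrow> Cinf_on U g \<Longrightarrow> Cinf_on U (\<lambda>x. f x \<bullet> g x)"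
  by (rule Cinf_on_bilinear[OF bounded_bilinear_inner])

lemma Cinf_on_inverse:
  fixes f :: "_ \<Rightarrow> real"
  assumes "open U" "Cinf_on U f" "\<And>x. x \<in> U \<Longrightarrow> f x \<noteq> 0"
  shows "Cinf_on U (\<lambda>x. inverse (f x))"
proof (rule Cinf_on_compose[OF assms(1) _ _ assms(2)])
  show "Cinf_on (- {0}) (inverse :: real \<Rightarrow> real)" by (simp add: Cinf_on_def Ck_on_inverse)
qed (use assms(3) in auto)

lemma Cinf_on_divide:
  fixes f g :: "_ \<Rightarrow> real"
  assumes "open U" "Cinf_on U f" "Cinf_on U g" "\<And>x. x \<in> U \<Longrightarrow> g x \<noteq> 0"
  shows "Cinf_on U (\<lambda>x. f x / g x)"
  using assms by (simp add: divide_inverse Cinf_on_mult Cinf_on_inverse)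

lemma Cinf_on_norm:
  fixes f :: "_ \<Rightarrow> 'b::real_inner"
  assumes U: "open U" and f: "Cinf_on U f" and nz: "\<And>x. x \<in> U \<Longrightarrow> f x \<noteq> 0"
  shows "Cinf_on U (\<lambda>x. norm (f x))"
proof -
  have s: "Cinf_on {0<..} sqrt" by (simp add: Cinf_on_def Ck_on_sqrt)
  have i: "(\<lambda>x. f x \<bullet> f x) ` U \<subseteq> {0<..}" using nz by auto
  show ?thesis
    unfolding norm_eq_sqrt_inner
    by (rule Cinf_on_compose[OF U _ i Cinf_on_inner[OF U f f] s]) simp
qed

lemmas Cinf_on_intros =
  Cinf_on_const Cinf_on_ident Cinf_on_add Cinf_on_diff Cinf_on_minus Cinf_on_fst Cinf_on_snd
  Cinf_on_Pair Cinf_on_scaleR Cinf_on_mult Cinf_on_inner Cinf_on_inverse Cinf_on_divide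
  Cinf_on_norm Cinf_on_sum

lemma smooth_onI:
  assumes "open V" "S \<subseteq> V" "Cinf_on V f"
  shows "smooth_on S f"
  unfolding smooth_on_def
proof
  fix x assume "x \<in> S"
  then show "\<exists>V g. open V \<and> x \<in> V \<and> Cinf_on V g \<and> (\<forall>y\<in>S \<inter> V. f y = g y)"
    using assms by (intro exI[of _ V] exI[of _ f]) auto
qed

lemma smooth_onD:
  assumes "smooth_on S f" "x \<in> S"
  shows "\<exists>V g. open V \<and> x \<in> V \<and> Cinf_on V g \<and> (\<forall>y\<in>S \<inter> V. f y = g y)"
  using assms unfolding smooth_on_def by (rule bspec)

lemma smooth_on_openD:
  assumes "open U" "smooth_on U f"
  shows "Cinf_on U f"
proof (rule Cinf_on_local)
  fix x assume x: "x \<in> U"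
  obtain V g where V: "open V" "x \<in> V" "Cinf_on V g" "\<forall>y\<in>U \<inter> V. f y = g y"
    using smooth_onD[OF assms(2) x] by (elim exE conjE) (rule that)
  have "Cinf_on (U \<inter> V) f"
  proof (rule Cinf_on_cong)
    show "Cinf_on (U \<inter> V) g" using Cinf_on_subset[OF V(3), of "U \<inter> V"] by simp
  qed (use V assms(1) in auto)
  then show "\<exists>V. open V \<and> x \<in> V \<and> Cinf_on V f"
    using V \<open>open U\<close> \<open>x \<in> U\<close> by (intro exI[of _ "U \<inter> V"]) auto
qed

lemma smooth_on_subset:
  assumes "smooth_on S f" "T \<subseteq> S"
  shows "smooth_on T f"
  unfolding smooth_on_def
proof
  fix x assume "x \<in> T"
  then have "x \<in> S" using assms(2) by blast
  obtain V g where V: "open V" "x \<in> V" "Cinf_on V g" "\<forall>y\<in>S \<inter> V. f y = g y"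
    using smooth_onD[OF assms(1) \<open>x \<in> S\<close>] by (elim exE conjE) (rule that)
  then show "\<exists>V g. open V \<and> x \<in> V \<and> Cinf_on V g \<and> (\<forall>y\<in>T \<inter> V. f y = g y)"
    using V assms(2) by (intro exI[of _ V] exI[of _ g]) auto
qed

lemma smooth_on_cong:
  assumes "\<And>x. x \<in> S \<Longrightarrow> f x = g x" "smooth_on S f"
  shows "smooth_on S g"
  unfolding smooth_on_def
proof
  fix x assume x: "x \<in> S"
  obtain V h where V: "open V" "x \<in> V" "Cinf_on V h" "\<forall>y\<in>S \<inter> V. f y = h y"
    using smooth_onD[OF assms(2) x] by (elim exE conjE) (rule that)
  then show "\<exists>V h. open V \<and> x \<in> V \<and> Cinf_on V h \<and> (\<forall>y\<in>S \<inter> V. g y = h y)"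
    using V assms(1) by (intro exI[of _ V] exI[of _ h]) auto
qed

lemma smooth_on_continuous:
  assumes "smooth_on S f"
  shows "continuous_on S f"
  unfolding continuous_on_eq_continuous_within
proof
  fix x assume x: "x \<in> S"
  obtain V g where V: "open V" "x \<in> V" "Cinf_on V g" "\<forall>y\<in>S \<inter> V. f y = g y"
    using smooth_onD[OF assms \<open>x \<in> S\<close>] by (elim exE conjE) (rule that)
  have "continuous (at x) g"
    using Cinf_on_continuous[OF V(3)] V(1,2) by (simp add: continuous_on_eq_continuous_at)
  then have "(g \<longlongrightarrow> g x) (at x within S)"
    using continuous_at_imp_continuous_at_within continuous_within by blast
  moreover have "\<forall>\<^sub>F y in at x within S. g y = f y"
    using V by (auto simp: eventually_at_topological)
  ultimately have "(f \<longlongrightarrow> g x) (at x within S)"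
    using Lim_transform_eventually by blast
  then show "continuous (at x within S) f"
    using V(2,4) x by (simp add: continuous_within)
qed

lemma smooth_on_compose:
  fixes f :: "'a::real_normed_vector \<Rightarrow> 'b::euclidean_space"
  assumes f: "smooth_on S f" and g: "smooth_on T g" and ST: "f ` S \<subseteq> T"
  shows "smooth_on S (\<lambda>x. g (f x))"
  unfolding smooth_on_def
proof
  fix x assume x: "x \<in> S"
  obtain V f' where V: "open V" "x \<in> V" "Cinf_on V f'" "\<forall>y\<in>S \<inter> V. f y = f' y"
    using smooth_onD[OF f x] by (elim exE conjE) (rule that)
  have "f x \<in> T" using ST x by blast
  obtain W g' where W: "open W" "f x \<in> W" "Cinf_on W g'" "\<forall>y\<in>T \<inter> W. g y = g' y"
    using smooth_onD[OF g \<open>f x \<in> T\<close>] by (elim exE conjE) (rule that)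
  define V' where "V' = V \<inter> f' -` W"
  have o: "open V'"
    unfolding V'_def by (rule continuous_open_preimage[OF Cinf_on_continuous[OF V(3)] V(1) W(1)])
  have "Cinf_on V' (\<lambda>x. g' (f' x))"
    by (rule Cinf_on_compose[OF o W(1) _ Cinf_on_subset[OF V(3)] W(3)]) (auto simp: V'_def)
  moreover have "g (f y) = g' (f' y)" if "y \<in> S \<inter> V'" for y
    using that V(4) W(4) ST unfolding V'_def by auto
  moreover have "x \<in> V'" using V x W(2) by (auto simp: V'_def)
  ultimately show "\<exists>V g'. open V \<and> x \<in> V \<and> Cinf_on V g' \<and> (\<forall>y\<in>S \<inter> V. g (f y) = g' y)"
    using o by (intro exI[of _ V'] exI[of _ "\<lambda>x. g' (f' x)"]) auto
qed


section \<open>Hadamard's lemma and smooth inverses\<close>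

lemma scale_mem_ball: "x \<in> ball 0 e \<Longrightarrow> t \<in> cbox 0 1 \<Longrightarrow> t *\<^sub>R x \<in> ball 0 e"
  for x :: "'a::real_normed_vector" and t :: real
  using mult_left_le_one_le[of "norm x" t] by simp

text \<open>
  Differentiating \<open>\<integral> t\<^sup>m h(t x) dt\<close> in direction \<open>v\<close> gives the same expression with \<open>m + 1\<close> instead of \<open>m\<close> and the
  directional derivative of \<open>h\<close> instead of \<open>h\<close>. The weight \<open>t\<^sup>m\<close> is there to make this family closed under
  differentiation.
\<close>

lemma Ck_on_radial_average:
  fixes h :: "'a::euclidean_space \<Rightarrow> 'b::euclidean_space"
  assumes "Ck_on k (ball 0 e) h"
  shows "Ck_on k (ball 0 e) (\<lambda>x. integral (cbox 0 1) (\<lambda>t::real. t ^ m *\<^sub>R h (t *\<^sub>R x)))"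
  using assms
proof -
  note sc = scale_mem_ball[where 'a = 'a]
  have scc: "continuous_on (ball 0 e \<times> cbox 0 1) (\<lambda>p. snd p ^ m *\<^sub>R k (snd p *\<^sub>R fst p))"
    if "continuous_on (ball 0 e) k" for k :: "'a \<Rightarrow> 'b" and m
  proof -
    have "continuous_on (ball 0 e \<times> cbox 0 1) (\<lambda>p :: 'a \<times> real. snd p *\<^sub>R fst p)"
      by (intro continuous_intros)
    then have "continuous_on (ball 0 e \<times> cbox 0 1) (\<lambda>p. k (snd p *\<^sub>R fst p))"
      by (rule continuous_on_compose2[OF that]) (use sc in auto)
    then show ?thesis by (intro continuous_on_scaleR continuous_intros)
  qed
  show ?thesis using assms
  proof (induction k arbitrary: h m)
    case (0 h m)
    then have "continuous_on (ball 0 e) h" by simp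
    from scc[OF this]
    have "continuous_on (ball 0 e \<times> cbox 0 1) (\<lambda>(x, t::real). t ^ m *\<^sub>R h (t *\<^sub>R x))"
      by (simp add: case_prod_beta)
    then show ?case by (simp only: Ck_on.simps integral_continuous_on_param)
  next
    case (Suc k h m)
    define h' where "h' = (\<lambda>x. frechet_derivative h (at x))"
    have h': "(h has_derivative h' x) (at x)" if "x \<in> ball 0 e" for x
      using Ck_on_SucD[OF Suc.prems that] by (simp add: h'_def)
    define fx where "fx = (\<lambda>x t. Blinfun (\<lambda>v. t ^ Suc m *\<^sub>R h' (t *\<^sub>R x) v))"
    have fx: "blinfun_apply (fx x t) = (\<lambda>v. t ^ Suc m *\<^sub>R h' (t *\<^sub>R x) v)"
      if "x \<in> ball 0 e" "t \<in> cbox 0 1" for x t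
    proof -
      have "bounded_linear (h' (t *\<^sub>R x))" using h'[OF sc[OF that]] has_derivative_bounded_linear by blast
      then have "bounded_linear (\<lambda>v. t ^ Suc m *\<^sub>R h' (t *\<^sub>R x) v)"
        by (rule bounded_linear_compose[OF bounded_linear_scaleR_right])
      then show ?thesis unfolding fx_def by (rule bounded_linear_Blinfun_apply)
    qed
    have hc: "continuous_on (ball 0 e) h" and h'c: "continuous_on (ball 0 e) (\<lambda>x. h' x v)" for v
    proof -
      have "Ck_on (Suc 0) (ball 0 e) h"
        using Suc.prems by (induction k) (auto dest: Ck_on_pred simp del: Ck_on.simps(2))
      then show "continuous_on (ball 0 e) h" "continuous_on (ball 0 e) (\<lambda>x. h' x v)"
        using Ck_on_pred[of 0] by (auto simp: h'_def)
    qed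
    have cont: "continuous_on (ball 0 e \<times> cbox 0 1) (\<lambda>(x, t). fx x t)"
    proof (rule continuous_on_blinfun_componentwise)
      fix i :: 'a
      have "continuous_on (ball 0 e \<times> cbox 0 1) (\<lambda>p. snd p ^ Suc m *\<^sub>R h' (snd p *\<^sub>R fst p) i)"
        by (rule scc[OF h'c])
      then show "continuous_on (ball 0 e \<times> cbox 0 1) (\<lambda>p. blinfun_apply (case p of (x, t) \<Rightarrow> fx x t) i)"
        by (rule continuous_on_eq) (auto simp: fx simp del: mem_ball)
    qed
    show ?case
    proof (rule Ck_on_SucI[where f' = "\<lambda>x v. integral (cbox 0 1) (\<lambda>t. t ^ Suc m *\<^sub>R h' (t *\<^sub>R x) v)"])
      fix x assume x: "x \<in> ball (0::'a) e"
      have "((\<lambda>x. integral (cbox 0 1) (\<lambda>t. t ^ m *\<^sub>R h (t *\<^sub>R x))) has_derivative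
          blinfun_apply (integral (cbox 0 1) (fx x))) (at x within ball 0 e)"
      proof (rule leibniz_rule[OF _ _ cont x convex_ball])
        fix y :: 'a and t :: real assume y: "y \<in> ball 0 e" and t: "t \<in> cbox 0 1"
        have "((\<lambda>y. t *\<^sub>R y) has_derivative (\<lambda>v. t *\<^sub>R v)) (at y)"
          by (auto intro!: derivative_eq_intros)
        from has_derivative_compose[OF this h'[OF sc[OF y t]]]
        have d: "((\<lambda>y. h (t *\<^sub>R y)) has_derivative (\<lambda>v. h' (t *\<^sub>R y) (t *\<^sub>R v))) (at y)" .
        have "linear (h' (t *\<^sub>R y))" using h'[OF sc[OF y t]] has_derivative_linear by blast
        then have "(\<lambda>v. t ^ m *\<^sub>R h' (t *\<^sub>R y) (t *\<^sub>R v)) = blinfun_apply (fx y t)"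
          using fx[OF y t] by (simp add: linear_cmul mult.commute)
        then show "((\<lambda>y. t ^ m *\<^sub>R h (t *\<^sub>R y)) has_derivative blinfun_apply (fx y t)) (at y within ball 0 e)"
          using has_derivative_scaleR_right[OF d, of "t ^ m"] by (simp add: has_derivative_at_withinI)
      next
        fix y :: 'a assume y: "y \<in> ball 0 e"
        have "continuous_on (cbox 0 1) (\<lambda>t::real. t ^ m *\<^sub>R h (t *\<^sub>R y))"
          using continuous_on_compose2[OF scc[OF hc, of m], of "cbox 0 1" "\<lambda>t. (y, t)"] y
          by (simp add: image_subset_iff continuous_on_Pair)
        then show "(\<lambda>t::real. t ^ m *\<^sub>R h (t *\<^sub>R y)) integrable_on cbox 0 1"
          by (rule integrable_continuous)
      qed
      moreover have "blinfun_apply (integral (cbox 0 1) (fx x)) =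
          (\<lambda>v. integral (cbox 0 1) (\<lambda>t. t ^ Suc m *\<^sub>R h' (t *\<^sub>R x) v))"
      proof
        fix v
        have "continuous_on (cbox 0 1) (fx x)"
          using continuous_on_compose2[OF cont, of "cbox 0 1" "\<lambda>t. (x, t)"] x
          by (simp add: image_subset_iff continuous_on_Pair)
        then have "fx x integrable_on cbox 0 1" by (rule integrable_continuous)
        then have "blinfun_apply (integral (cbox 0 1) (fx x)) v
            = integral (cbox 0 1) (\<lambda>t. blinfun_apply (fx x t) v)"
          by (rule blinfun_apply_integral)
        also have "\<dots> = integral (cbox 0 1) (\<lambda>t. t ^ Suc m *\<^sub>R h' (t *\<^sub>R x) v)"
          by (rule integral_cong) (simp add: fx[OF x])
        finally show "blinfun_apply (integral (cbox 0 1) (fx x)) v =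
          integral (cbox 0 1) (\<lambda>t. t ^ Suc m *\<^sub>R h' (t *\<^sub>R x) v)" .
      qed
      ultimately show "((\<lambda>x. integral (cbox 0 1) (\<lambda>t. t ^ m *\<^sub>R h (t *\<^sub>R x))) has_derivative
          (\<lambda>v. integral (cbox 0 1) (\<lambda>t. t ^ Suc m *\<^sub>R h' (t *\<^sub>R x) v))) (at x)"
        by (simp only: at_within_open[OF x open_ball])
    next
      fix v
      show "Ck_on k (ball 0 e) (\<lambda>x. integral (cbox 0 1) (\<lambda>t. t ^ Suc m *\<^sub>R h' (t *\<^sub>R x) v))"
        by (rule Suc.IH) (use Suc.prems in \<open>simp add: h'_def\<close>)
  qed simp
  qed
qed

text \<open>
  The increment \<open>\<phi> (a + x) - \<phi> a\<close> is the integral of the derivative along the segment, which is linear in \<open>x\<close>. The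
  coefficients \<open>M b\<close> are the averages of the partial derivatives over the segment.
\<close>

lemma hadamard:
  fixes \<phi> :: "'a::euclidean_space \<Rightarrow> 'b::euclidean_space"
  assumes \<phi>: "Cinf_on (ball a e) \<phi>"
  shows "\<exists>M. (\<forall>b. Cinf_on (ball 0 e) (M b)) \<and>
    (\<forall>x\<in>ball 0 e. \<phi> (a + x) = \<phi> a + (\<Sum>b\<in>Basis. (x \<bullet> b) *\<^sub>R M b x)) \<and>
    (\<forall>b. M b 0 = frechet_derivative \<phi> (at a) b)"
proof -
  define h where "h = (\<lambda>b x. frechet_derivative \<phi> (at (a + x)) b)"
  define M where "M = (\<lambda>b x. integral (cbox 0 1) (\<lambda>t::real. h b (t *\<^sub>R x)))"
  have h: "Cinf_on (ball 0 e) (h b)" for b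
    unfolding h_def
    by (rule Cinf_on_compose[of _ "ball a e" "\<lambda>x. a + x" "\<lambda>y. frechet_derivative \<phi> (at y) b"])
      (auto intro!: Cinf_on_intros Cinf_on_frechet_derivative[OF \<phi>] simp: dist_norm)
  have "Cinf_on (ball 0 e) (M b)" for b
    unfolding M_def Cinf_on_def
  proof
    fix k
    have "Ck_on k (ball 0 e) (h b)" using h[of b] by (simp add: Cinf_on_def)
    from Ck_on_radial_average[OF this, of 0]
    show "Ck_on k (ball 0 e) (\<lambda>x. integral (cbox 0 1) (\<lambda>t::real. h b (t *\<^sub>R x)))" by simp
  qed
  moreover have "M b 0 = frechet_derivative \<phi> (at a) b" for b
    by (simp add: M_def h_def)
  moreover have "\<phi> (a + x) = \<phi> a + (\<Sum>b\<in>Basis. (x \<bullet> b) *\<^sub>R M b x)" if x: "x \<in> ball 0 e" for x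
  proof -
    note tx = scale_mem_ball[OF x]
    have "((\<lambda>t. \<phi> (a + t *\<^sub>R x)) has_vector_derivative (\<Sum>b\<in>Basis. (x \<bullet> b) *\<^sub>R h b (t *\<^sub>R x)))
        (at t within {0..1})" if t: "t \<in> {0..1}" for t
    proof -
      have m: "a + t *\<^sub>R x \<in> ball a e" using tx[of t] t by (simp add: dist_norm)
      have d: "(\<phi> has_derivative frechet_derivative \<phi> (at (a + t *\<^sub>R x))) (at (a + t *\<^sub>R x))"
        by (rule Cinf_on_has_derivative[OF \<phi> m])
      have "((\<lambda>t. a + t *\<^sub>R x) has_derivative (\<lambda>s. s *\<^sub>R x)) (at t within {0..1})"
        by (auto intro!: derivative_eq_intros)
      from has_derivative_compose[OF this d]
      have "((\<lambda>t. \<phi> (a + t *\<^sub>R x)) has_derivative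
          (\<lambda>s. frechet_derivative \<phi> (at (a + t *\<^sub>R x)) (s *\<^sub>R x))) (at t within {0..1})" .
      moreover have l: "linear (frechet_derivative \<phi> (at (a + t *\<^sub>R x)))"
        using d has_derivative_linear by blast
      ultimately show ?thesis
        unfolding has_vector_derivative_def h_def
        using linear_basis_expansion[OF l, of x] by (simp add: linear_cmul)
    qed
    from fundamental_theorem_of_calculus[OF _ this]
    have 1: "((\<lambda>t. \<Sum>b\<in>Basis. (x \<bullet> b) *\<^sub>R h b (t *\<^sub>R x)) has_integral \<phi> (a + x) - \<phi> a) (cbox 0 1)"
      by simp
    have "((\<lambda>t. h b (t *\<^sub>R x)) has_integral M b x) (cbox 0 1)" for b
    proof -
      have "continuous_on (cbox 0 1) (\<lambda>t :: real. t *\<^sub>R x)" by (intro continuous_intros)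
      then have "continuous_on (cbox 0 1) (\<lambda>t. h b (t *\<^sub>R x))"
        by (rule continuous_on_compose2[OF Cinf_on_continuous[OF h]]) (use tx in auto)
      then show ?thesis unfolding M_def by (intro integrable_integral integrable_continuous)
    qed
    then have "((\<lambda>t. \<Sum>b\<in>Basis. (x \<bullet> b) *\<^sub>R h b (t *\<^sub>R x)) has_integral
        (\<Sum>b\<in>Basis. (x \<bullet> b) *\<^sub>R M b x)) (cbox 0 1)"
      by (intro has_integral_sum has_integral_cmul) auto
    from has_integral_unique[OF 1 this] show ?thesis by (simp add: algebra_simps)
  qed
  ultimately show ?thesis by (intro exI[of _ M]) simp
qed

text \<open>
  Differentiability of the inverse comes from applying the inverse function rule to the map
  \<open>(x, w) \<mapsto> (x, A x w)\<close>, whose inverse is \<open>(x, v) \<mapsto> (x, (A x)\<^sup>-\<^sup>1 v)\<close>.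
\<close>

lemma inverse_family_has_derivative:
  fixes A :: "'a::euclidean_space \<Rightarrow> 'b::euclidean_space \<Rightarrow> 'b"
  assumes U: "open U" "x \<in> U"
    and lin: "\<And>x. x \<in> U \<Longrightarrow> linear (A x)" and bij: "\<And>x. x \<in> U \<Longrightarrow> bij (A x)"
    and A: "\<And>w. Cinf_on U (\<lambda>x. A x w)"
  shows "((\<lambda>x. inv (A x) v) has_derivative (\<lambda>h. - inv (A x)
    (\<Sum>b\<in>Basis. (inv (A x) v \<bullet> b) *\<^sub>R frechet_derivative (\<lambda>x. A x b) (at x) h))) (at x)"
proof -
  define A' where "A' = (\<lambda>b. frechet_derivative (\<lambda>x. A x b) (at x))"
  define f where "f = (\<lambda>p. (fst p, \<Sum>b\<in>Basis. (snd p \<bullet> b) *\<^sub>R A (fst p) b))"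
  define g where "g = (\<lambda>q. (fst q, inv (A (fst q)) (snd q)))"
  define w where "w = inv (A x) v"
  define f' where "f' = (\<lambda>p. (fst p, \<Sum>b\<in>Basis. (w \<bullet> b) *\<^sub>R A' b (fst p) + (snd p \<bullet> b) *\<^sub>R A x b))"
  define g' where "g' = (\<lambda>q. (fst q, inv (A x) (snd q - (\<Sum>b\<in>Basis. (w \<bullet> b) *\<^sub>R A' b (fst q)))))"
  have expand: "(\<Sum>b\<in>Basis. (z \<bullet> b) *\<^sub>R A y b) = A y z" if "y \<in> U" for y z
    using linear_basis_expansion[OF lin[OF that], of z] by simp
  have A': "((\<lambda>x. A x b) has_derivative A' b) (at x)" for b
    unfolding A'_def by (rule Cinf_on_has_derivative[OF A U(2)])
  have oU: "open (U \<times> (UNIV :: 'b set))" using U by (simp add: open_Times)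
  have "Cinf_on (U \<times> (UNIV :: 'b set)) (\<lambda>p. A (fst p) b)" for b
    by (rule Cinf_on_compose[OF oU U(1) _ _ A[of b], where f = fst])
      (auto intro!: Cinf_on_bounded_linear bounded_linear_fst oU)
  then have "Cinf_on (U \<times> UNIV) f"
    unfolding f_def by (intro Cinf_on_intros oU)
  then have cont: "continuous_on (U \<times> UNIV) f" by (rule Cinf_on_continuous)
  have fst': "((\<lambda>p. A (fst p) b) has_derivative (\<lambda>p. A' b (fst p))) (at (x, w))" for b
    using has_derivative_compose[of fst fst "(x, w)" UNIV "\<lambda>x. A x b" "A' b"] A'
    by (simp add: bounded_linear_fst bounded_linear_imp_has_derivative)
  have "((\<lambda>p. (snd p \<bullet> b) *\<^sub>R A (fst p) b) has_derivative
      (\<lambda>p. (w \<bullet> b) *\<^sub>R A' b (fst p) + (snd p \<bullet> b) *\<^sub>R A x b)) (at (x, w))" for b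
    using has_derivative_scaleR[of "\<lambda>p. snd p \<bullet> b" "\<lambda>p. snd p \<bullet> b" "(x, w)" UNIV "\<lambda>p. A (fst p) b" "\<lambda>p. A' b (fst p)"]
      fst' by (simp add: bounded_linear_imp_has_derivative bounded_linear_inner_left_comp bounded_linear_snd)
  then have "((\<lambda>p. (fst p, \<Sum>b\<in>Basis. (snd p \<bullet> b) *\<^sub>R A (fst p) b)) has_derivative f') (at (x, w))"
    unfolding f'_def
    by (intro has_derivative_Pair has_derivative_sum)
      (auto simp: bounded_linear_fst bounded_linear_imp_has_derivative)
  then have f': "(f has_derivative f') (at (x, w))" by (simp add: f_def)
  have inv1: "inv (A y) (A y z) = z" and inv2: "A y (inv (A y) z) = z" if "y \<in> U" for y z
    using bij[OF that] by (simp_all add: bij_is_inj bij_is_surj surj_f_inv_f)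
  have "(g has_derivative g') (at (f (x, w)))"
  proof (rule has_derivative_inverse_strong[OF oU _ cont _ f'])
    show "(x, w) \<in> U \<times> UNIV" using U by simp
    show "g (f p) = p" if "p \<in> U \<times> UNIV" for p
      using that by (auto simp: f_def g_def expand inv1)
    show "f' \<circ> g' = id"
      by (rule ext) (simp add: f'_def g'_def sum.distrib expand[OF U(2)] inv2[OF U(2)])
  qed
  moreover have "f (x, w) = (x, v)"
    by (simp add: f_def expand[OF U(2)] w_def inv2[OF U(2)])
  ultimately have g': "(g has_derivative g') (at (x, v))" by simp
  have "((\<lambda>y. (y, v)) has_derivative (\<lambda>h. (h, 0))) (at x)"
    by (auto intro!: derivative_eq_intros)
  from has_derivative_compose[OF this g']
  have "((\<lambda>y. snd (g (y, v))) has_derivative (\<lambda>h. snd (g' (h, 0)))) (at x)"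
    by (rule has_derivative_snd)
  moreover have "linear (inv (A x))"
    using lin[OF U(2)] bij[OF U(2)] by (simp add: bij_is_inj inj_linear_imp_inv_linear)
  ultimately show ?thesis
    by (simp add: g_def g'_def w_def A'_def linear_neg)
qed

text \<open>
  The derivative \<open>- A\<^sup>-\<^sup>1 A\<^sup>\<prime> A\<^sup>-\<^sup>1 v\<close>, expanded in bases, involves \<open>A\<^sup>-\<^sup>1\<close> at fixed vectors only, so the induction
  hypothesis applies to it.
\<close>

lemma Ck_on_inverse_family:
  fixes A :: "'a::euclidean_space \<Rightarrow> 'b::euclidean_space \<Rightarrow> 'b"
  assumes U: "open U"
    and lin: "\<And>x. x \<in> U \<Longrightarrow> linear (A x)" and bij: "\<And>x. x \<in> U \<Longrightarrow> bij (A x)"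
    and A: "\<And>w. Cinf_on U (\<lambda>x. A x w)"
  shows "Ck_on k U (\<lambda>x. inv (A x) v)"
proof (induction k arbitrary: v)
  case 0
  show ?case
    using inverse_family_has_derivative[OF U _ lin bij A]
    by (auto intro!: continuous_at_imp_continuous_on has_derivative_continuous)
next
  case (Suc k)
  define A' where "A' = (\<lambda>x h b. frechet_derivative (\<lambda>x. A x b) (at x) h)"
  define s where "s = (\<lambda>x h. \<Sum>b\<in>Basis. (inv (A x) v \<bullet> b) *\<^sub>R A' x h b)"
  show ?case
  proof (rule Ck_on_SucI[where f' = "\<lambda>x h. - (\<Sum>c\<in>Basis. (s x h \<bullet> c) *\<^sub>R inv (A x) c)"])
    fix x assume x: "x \<in> U"
    have "linear (inv (A x))"
      using lin[OF x] bij[OF x] by (simp add: bij_is_inj inj_linear_imp_inv_linear)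
    then have "(\<lambda>h. - (\<Sum>c\<in>Basis. (s x h \<bullet> c) *\<^sub>R inv (A x) c)) = (\<lambda>h. - inv (A x) (s x h))"
      by (metis linear_basis_expansion)
    then show "((\<lambda>x. inv (A x) v) has_derivative
        (\<lambda>h. - (\<Sum>c\<in>Basis. (s x h \<bullet> c) *\<^sub>R inv (A x) c))) (at x)"
      using inverse_family_has_derivative[OF U x lin bij A, of v] by (simp add: s_def A'_def)
  next
    fix h
    have "Ck_on k U (\<lambda>x. A' x h b)" for b
      using Cinf_on_frechet_derivative[OF A] by (simp add: A'_def Cinf_on_def)
    then have "Ck_on k U (\<lambda>x. s x h)"
      unfolding s_def
      by (intro Ck_on_sum U Ck_on_bilinear[OF bounded_bilinear_scaleR]
          Ck_on_linear_compose[OF bounded_linear_inner_left] Suc.IH)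
    then have "Ck_on k U (\<lambda>x. \<Sum>c\<in>Basis. (s x h \<bullet> c) *\<^sub>R inv (A x) c)"
      by (intro Ck_on_sum U Ck_on_bilinear[OF bounded_bilinear_scaleR]
          Ck_on_linear_compose[OF bounded_linear_inner_left] Suc.IH)
    then show "Ck_on k U (\<lambda>x. - (\<Sum>c\<in>Basis. (s x h \<bullet> c) *\<^sub>R inv (A x) c))"
      by (rule Ck_on_linear_compose[OF bounded_linear_minus[OF bounded_linear_ident] U])
  qed (rule U)
qed

text \<open>
  Smoothness of the local inverse bootstraps: its derivative is \<open>y \<mapsto> (DF (G y))\<^sup>-\<^sup>1\<close>, which is as smooth as \<open>G\<close>.
\<close>

lemma smooth_inverse_function:
  fixes F :: "'a::euclidean_space \<Rightarrow> 'a"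
  assumes U: "open U" "x0 \<in> U" and F: "Cinf_on U F"
    and inj: "inj (frechet_derivative F (at x0))"
  obtains U' V G where "open U'" "U' \<subseteq> U" "x0 \<in> U'" "open V" "homeomorphism U' V F G"
    "Cinf_on V G"
proof -
  define A where "A = (\<lambda>x. frechet_derivative F (at x))"
  define F' where "F' = (\<lambda>x. Blinfun (A x))"
  have A: "(F has_derivative A x) (at x)" if "x \<in> U" for x
    using Cinf_on_has_derivative[OF F that] by (simp add: A_def)
  then have lin: "linear (A x)" if "x \<in> U" for x
    using that has_derivative_linear by blast
  have F': "blinfun_apply (F' x) = A x" if "x \<in> U" for x
    unfolding F'_def using A[OF that] by (intro bounded_linear_Blinfun_apply has_derivative_bounded_linear)
  have "continuous_on U (\<lambda>x. A x i)" for i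
    unfolding A_def by (rule Cinf_on_continuous[OF Cinf_on_frechet_derivative[OF F]])
  then have "continuous_on U (\<lambda>x. blinfun_apply (F' x) i)" for i
    by (rule continuous_on_eq) (simp add: F')
  then have cont: "continuous_on U F'" by (rule continuous_on_blinfun_componentwise)
  obtain B where B: "linear B" "\<And>x. B (A x0 x) = x"
    using linear_injective_isomorphism[OF lin[OF U(2)]] inj unfolding A_def by metis
  have "Blinfun B o\<^sub>L F' x0 = id_blinfun"
    by (rule blinfun_eqI)
      (simp add: bounded_linear_Blinfun_apply linear_conv_bounded_linear[THEN iffD1, OF B(1)] F'[OF U(2)] B(2))
  from inverse_function_theorem[OF U(1) _ cont U(2) this, of F] A F'
  obtain U' V G G' where U': "open U'" "U' \<subseteq> U" "x0 \<in> U'" "open V" "homeomorphism U' V F G"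
    and G: "\<And>y. y \<in> V \<Longrightarrow> (G has_derivative G' y) (at y)"
      "\<And>y. y \<in> V \<Longrightarrow> G' y = inv (blinfun_apply (F' (G y)))"
      "\<And>y. y \<in> V \<Longrightarrow> bij (blinfun_apply (F' (G y)))"
    by (metis (no_types, lifting))
  have GU: "G y \<in> U'" "F (G y) = y" if "y \<in> V" for y
    using U'(5) that by (auto simp: homeomorphism_def)
  have bij: "bij (A x)" if "x \<in> U'" for x
  proof -
    have "F x \<in> V" "G (F x) = x" using U'(5) that by (auto simp: homeomorphism_def)
    then show ?thesis using G(3)[of "F x"] F'[of x] that U'(2) by auto
  qed
  have "Ck_on k V G" for k
  proof (induction k)
    case 0
    show ?case using U'(5) by (simp add: homeomorphism_def)
  next
    case (Suc k)
    show ?case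
    proof (rule Ck_on_SucI[OF U'(4)])
      show "(G has_derivative (\<lambda>v. inv (A (G y)) v)) (at y)" if "y \<in> V" for y
        using G(1,2)[OF that] F'[of "G y"] GU[OF that] U'(2) by auto
      fix v
      have "Ck_on k U' (\<lambda>x. inv (A x) v)"
        by (rule Ck_on_inverse_family[OF U'(1)])
          (use lin bij U' Cinf_on_subset[OF Cinf_on_frechet_derivative[OF F]] in \<open>auto simp: A_def\<close>)
      then show "Ck_on k V (\<lambda>y. inv (A (G y)) v)"
        by (rule Ck_on_compose[OF U'(4,1) _ Suc, rotated]) (use GU in auto)
    qed
  qed
  then have "Cinf_on V G" by (simp add: Cinf_on_def)
  with that U' show ?thesis by blast
qed


section \<open>Local models of sub-manifolds and tangent cones\<close>

text \<open>
  What the definitions see of a local parametrisation at \<open>x\<close>: whether \<open>x\<close> is a boundary point of it (\<open>b\<close>) and the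
  tangent space that it yields (\<open>D\<close>). Sub-manifolds, boundaries and tangent spaces are read off from this predicate, so
  it suffices to follow it through restrictions and diffeomorphisms.
\<close>

definition model_at :: "'a::euclidean_space set \<Rightarrow> 'a \<Rightarrow> bool \<Rightarrow> 'a set \<Rightarrow> bool" where
  "model_at N x b D \<longleftrightarrow>
     (\<exists>L w U g y. local_param N L w U g \<and> y \<in> U \<inter> half_space L w \<and> g y = x \<and>
        (b \<longleftrightarrow> w \<noteq> 0 \<and> y \<bullet> w = 0) \<and> D = frechet_derivative g (at y) ` L)"

lemma bd_submanifold_iff_model_at: "bd_submanifold N \<longleftrightarrow> (\<forall>x\<in>N. \<exists>b D. model_at N x b D)"
proof -
  have "(\<exists>L w U g. local_param N L w U g \<and> x \<in> g ` (U \<inter> half_space L w)) \<longleftrightarrow>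
      (\<exists>b D. model_at N x b D)" for x
    unfolding model_at_def image_iff by (intro iffI; elim exE bexE conjE; blast)
  then show ?thesis by (simp add: bd_submanifold_def)
qed

lemma mf_boundary_iff_model_at: "x \<in> mf_boundary N \<longleftrightarrow> (\<exists>D. model_at N x True D)"
  unfolding mf_boundary_def model_at_def by blast

lemma tangent_space_iff_model_at: "v \<in> tangent_space N x \<longleftrightarrow> (\<exists>b D. model_at N x b D \<and> v \<in> D)"
  unfolding tangent_space_def model_at_def by blast

lemma model_at_mem: "model_at N x b D \<Longrightarrow> x \<in> N"
  unfolding model_at_def local_param_def by (auto dest!: openin_imp_subset)

lemma subspace_half_space_diff:
  assumes "subspace L" "y \<in> half_space L w" "z \<in> half_space L w"
  shows "z - y \<in> L"
  using assms by (simp add: half_space_def subspace_diff)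

lemma local_param_shrink:
  assumes P: "local_param N L w U g" and U0: "open U0" "U0 \<subseteq> U"
  shows "local_param N L w U0 g"
proof -
  let ?H = "half_space L w"
  obtain h where h: "homeomorphism (U \<inter> ?H) (g ` (U \<inter> ?H)) g h"
    using P by (auto simp: local_param_def)
  have o: "openin (top_of_set N) (g ` (U \<inter> ?H))" using P by (simp add: local_param_def)
  have "openin (top_of_set (U \<inter> ?H)) (U0 \<inter> ?H)"
    using U0 by (auto simp: openin_open)
  then have "openin (top_of_set (g ` (U \<inter> ?H))) (g ` (U0 \<inter> ?H))"
    by (rule homeomorphism_imp_open_map[OF h])
  then have o': "openin (top_of_set N) (g ` (U0 \<inter> ?H))"
    using o openin_trans by blast
  have h': "homeomorphism (U0 \<inter> ?H) (g ` (U0 \<inter> ?H)) g h"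
    by (rule homeomorphism_of_subsets[OF h]) (use U0 in auto)
  have "Cinf_on U0 g" using P U0 Cinf_on_subset[of U g U0] by (simp add: local_param_def)
  moreover have "\<exists>h. homeomorphism (U0 \<inter> ?H) (g ` (U0 \<inter> ?H)) g h" using h' by blast
  ultimately show ?thesis using P U0 o' unfolding local_param_def by blast
qed

lemma model_at_local:
  assumes V: "open V"
  shows "model_at (N \<inter> V) x b D \<longleftrightarrow> x \<in> V \<and> model_at N x b D"
proof
  assume m: "model_at (N \<inter> V) x b D"
  have NV: "openin (top_of_set N) (N \<inter> V)" using V by blast
  have "local_param N L w U g" if "local_param (N \<inter> V) L w U g" for L w U g
    using that openin_trans[OF _ NV] unfolding local_param_def by blast
  then show "x \<in> V \<and> model_at N x b D"
    using m model_at_mem[OF m] unfolding model_at_def by blast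
next
  assume "x \<in> V \<and> model_at N x b D"
  then obtain L w U g y where x: "x \<in> V" and P: "local_param N L w U g"
    and y: "y \<in> U \<inter> half_space L w" "g y = x"
    and b: "b \<longleftrightarrow> w \<noteq> 0 \<and> y \<bullet> w = 0" and D: "D = frechet_derivative g (at y) ` L"
    unfolding model_at_def by blast
  define U0 where "U0 = U \<inter> g -` V"
  have "continuous_on U g" "open U"
    using P Cinf_on_continuous[of U g] by (simp_all add: local_param_def)
  then have U0: "open U0" "U0 \<subseteq> U"
    unfolding U0_def using V by (auto intro: continuous_open_preimage)
  have P0: "local_param N L w U0 g" by (rule local_param_shrink[OF P U0])
  have "g ` (U0 \<inter> half_space L w) \<subseteq> N \<inter> V"
    using P0 openin_imp_subset[of _ N "g ` (U0 \<inter> half_space L w)"]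
    by (auto simp: local_param_def U0_def)
  then have "local_param (N \<inter> V) L w U0 g"
    using P0 openin_subset_trans[of _ "g ` (U0 \<inter> half_space L w)" "N \<inter> V"]
    unfolding local_param_def by auto
  moreover have "y \<in> U0 \<inter> half_space L w" using y x by (simp add: U0_def)
  ultimately show "model_at (N \<inter> V) x b D"
    unfolding model_at_def using y b D by blast
qed

text \<open>
  One-sided derivatives are handled with difference quotients along sequences; \<open>Y n = y\<close> is allowed.
\<close>

lemma has_derivative_sequential:
  assumes g: "(g has_derivative g') (at y)" and Y: "Y \<longlonglongrightarrow> y"
    and t: "\<And>n. 0 < t n" and z: "(\<lambda>n. (Y n - y) /\<^sub>R t n) \<longlonglongrightarrow> z"
  shows "(\<lambda>n. (g (Y n) - g y) /\<^sub>R t n) \<longlonglongrightarrow> g' z"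
proof -
  define q where "q = (\<lambda>n. (Y n - y) /\<^sub>R t n)"
  have lin: "bounded_linear g'" using g has_derivative_bounded_linear by blast
  obtain K where K: "K > 0" "\<And>n. norm (q n) \<le> K"
    using convergent_imp_Bseq[of q] z unfolding convergent_def q_def Bseq_def by auto
  have "(\<lambda>n. (g (Y n) - g y) /\<^sub>R t n - g' (q n)) \<longlonglongrightarrow> 0"
  proof (rule LIMSEQ_I)
    fix e :: real assume "e > 0"
    define e' where "e' = e / (2 * K)"
    have "e' > 0" using \<open>e > 0\<close> K by (simp add: e'_def)
    then obtain d where d: "d > 0" "\<And>u. norm (u - y) < d \<Longrightarrow> norm (g u - g y - g' (u - y)) \<le> e' * norm (u - y)"
      using g unfolding has_derivative_at_alt by blast
    obtain n0 where n0: "\<And>n. n \<ge> n0 \<Longrightarrow> norm (Y n - y) < d"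
      using LIMSEQ_D[OF Y d(1)] by blast
    have "norm ((g (Y n) - g y) /\<^sub>R t n - g' (q n) - 0) < e" if "n \<ge> n0" for n
    proof -
      have "(g (Y n) - g y) /\<^sub>R t n - g' (q n) = (g (Y n) - g y - g' (Y n - y)) /\<^sub>R t n"
        using lin by (simp add: q_def linear_simps algebra_simps)
      then have "norm ((g (Y n) - g y) /\<^sub>R t n - g' (q n)) = norm (g (Y n) - g y - g' (Y n - y)) / t n"
        using t[of n] by (simp add: divide_inverse)
      also have "\<dots> \<le> e' * norm (Y n - y) / t n"
        using d(2)[OF n0[OF that]] t[of n] by (simp add: divide_right_mono)
      also have "\<dots> = e' * norm (q n)" using t[of n] by (simp add: q_def divide_inverse)
      also have "\<dots> \<le> e' * K" using K(2)[of n] \<open>e' > 0\<close> by simp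
      also have "\<dots> < e" using \<open>e > 0\<close> K by (simp add: e'_def)
      finally show ?thesis by simp
    qed
    then show "\<exists>n0. \<forall>n\<ge>n0. norm ((g (Y n) - g y) /\<^sub>R t n - g' (q n) - 0) < e" by blast
  qed
  moreover have "(\<lambda>n. g' (q n)) \<longlonglongrightarrow> g' z"
    using bounded_linear.tendsto[OF lin] z by (simp add: q_def)
  ultimately have "(\<lambda>n. (g (Y n) - g y) /\<^sub>R t n - g' (q n) + g' (q n)) \<longlonglongrightarrow> 0 + g' z"
    by (rule tendsto_add)
  then show ?thesis by simp
qed

text \<open>
  The directions along which one can leave \<open>y\<close> inside the half-space: all of \<open>L\<close> at an inner point, the half-space
  itself at a point of its boundary.
\<close>

definition half_cone :: "'a::euclidean_space set \<Rightarrow> 'a \<Rightarrow> 'a \<Rightarrow> 'a set" where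
  "half_cone L w y = {l \<in> L. y \<bullet> w = 0 \<longrightarrow> 0 \<le> l \<bullet> w}"

lemma half_cone_sequence:
  assumes L: "subspace L" and U: "open U" and y: "y \<in> U \<inter> half_space L w"
    and l: "l \<in> half_cone L w y"
  obtains t :: "nat \<Rightarrow> real" where "\<And>n. 0 < t n"
    "\<And>n. y + t n *\<^sub>R l \<in> U \<inter> half_space L w"
    "(\<lambda>n. y + t n *\<^sub>R l) \<longlonglongrightarrow> y" "(\<lambda>n. (y + t n *\<^sub>R l - y) /\<^sub>R t n) \<longlonglongrightarrow> l"
proof -
  obtain e where e: "e > 0" "ball y e \<subseteq> U" using y U openE by blast
  \<comment> \<open>If \<open>y\<close> is off the boundary, then so is \<open>y + t l\<close> for \<open>t \<le> d\<close>, even if \<open>l\<close> points outwards.\<close>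
  define d where "d = (if y \<bullet> w = 0 then 1 else (y \<bullet> w) / (1 + \<bar>l \<bullet> w\<bar>))"
  have d: "d > 0" using y by (auto simp: d_def half_space_def)
  define c where "c = min d (e / (1 + norm l))"
  have c: "c > 0" "c \<le> d" "c \<le> e / (1 + norm l)"
    using d e by (auto simp: c_def intro!: divide_pos_pos add_pos_nonneg)
  define t where "t = (\<lambda>n. c * inverse (real (Suc n)))"
  have t: "0 < t n" "t n \<le> c" for n
    using c(1) by (auto simp: t_def field_simps)
  have "t \<longlonglongrightarrow> c * 0" unfolding t_def by (intro tendsto_intros LIMSEQ_inverse_real_of_nat)
  then have "(\<lambda>n. y + t n *\<^sub>R l) \<longlonglongrightarrow> y + 0 *\<^sub>R l" by (intro tendsto_intros) simp
  then have Y: "(\<lambda>n. y + t n *\<^sub>R l) \<longlonglongrightarrow> y" by simp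
  have "(y + t n *\<^sub>R l - y) /\<^sub>R t n = l" for n using t(1)[of n] by simp
  then have z: "(\<lambda>n. (y + t n *\<^sub>R l - y) /\<^sub>R t n) \<longlonglongrightarrow> l" by simp
  have "y + t n *\<^sub>R l \<in> U \<inter> half_space L w" for n
  proof -
    have "norm (t n *\<^sub>R l) < t n * (1 + norm l)" using t(1)[of n] by (simp add: algebra_simps)
    also have "\<dots> \<le> c * (1 + norm l)" using t(2)[of n] by (intro mult_right_mono) auto
    also have "\<dots> \<le> e" using c(3) by (simp add: pos_le_divide_eq add_pos_nonneg)
    finally have "y + t n *\<^sub>R l \<in> U" using e(2) by (auto simp: subset_iff dist_norm)
    moreover have "0 \<le> (y + t n *\<^sub>R l) \<bullet> w"
    proof (cases "y \<bullet> w = 0")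
      case True
      then show ?thesis using l t(1)[of n] by (simp add: half_cone_def inner_add_left)
    next
      case False
      have "t n * \<bar>l \<bullet> w\<bar> \<le> d * (1 + \<bar>l \<bullet> w\<bar>)"
        using t[of n] c(2) d by (intro mult_mono) auto
      also have "\<dots> = y \<bullet> w" using False by (simp add: d_def add_nonneg_eq_0_iff)
      finally have "\<bar>t n * (l \<bullet> w)\<bar> \<le> y \<bullet> w" using t(1)[of n] by (simp add: abs_mult)
      then show ?thesis by (simp add: inner_add_left abs_le_iff)
    qed
    moreover have "y + t n *\<^sub>R l \<in> L"
      using L y l by (simp add: half_space_def half_cone_def subspace_add subspace_scale)
    ultimately show ?thesis by (simp add: half_space_def)
  qed
  then show ?thesis by (rule that[OF t(1) _ Y z])
qed

text \<open>
  For \<open>l \<in> L\<close> one of \<open>l\<close> and \<open>- l\<close> points into the half-space, so derivatives along \<open>L\<close> are determined by the values on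
  the half-space, where alone a parametrisation is controlled.
\<close>

lemma derivative_eq_on_half_space:
  assumes L: "subspace L" and U: "open U" and y: "y \<in> U \<inter> half_space L w"
    and F: "(F has_derivative F') (at y)" and G: "(G has_derivative G') (at y)"
    and eq: "\<And>z. z \<in> U \<inter> half_space L w \<Longrightarrow> F z = G z" and l: "l \<in> L"
  shows "F' l = G' l"
proof -
  have cone: "F' l = G' l" if l: "l \<in> half_cone L w y" for l
  proof -
    obtain t where t: "\<And>n. 0 < t n" "\<And>n. y + t n *\<^sub>R l \<in> U \<inter> half_space L w"
      and Y: "(\<lambda>n. y + t n *\<^sub>R l) \<longlonglongrightarrow> y"
      and z: "(\<lambda>n. (y + t n *\<^sub>R l - y) /\<^sub>R t n) \<longlonglongrightarrow> l"
      by (rule half_cone_sequence[OF L U y l]) blast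
    have "(\<lambda>n. (F (y + t n *\<^sub>R l) - F y) /\<^sub>R t n) \<longlonglongrightarrow> F' l"
      by (rule has_derivative_sequential[OF F Y t(1) z])
    moreover have "(\<lambda>n. (F (y + t n *\<^sub>R l) - F y) /\<^sub>R t n) = (\<lambda>n. (G (y + t n *\<^sub>R l) - G y) /\<^sub>R t n)"
      using eq[OF t(2)] eq[OF y] by simp
    ultimately show ?thesis
      using has_derivative_sequential[OF G Y t(1) z] LIMSEQ_unique by metis
  qed
  show ?thesis
  proof (cases "l \<in> half_cone L w y")
    case False
    then have "- l \<in> half_cone L w y" using l L by (auto simp: half_cone_def subspace_neg)
    then have "F' (- l) = G' (- l)" by (rule cone)
    moreover have "linear F'" "linear G'" using F G has_derivative_linear by blast+
    ultimately show ?thesis by (simp add: linear_neg)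
  qed (rule cone)
qed

definition tangent_cone :: "'a::euclidean_space set \<Rightarrow> 'a \<Rightarrow> 'a set" where
  "tangent_cone N x = {v. \<exists>X t. (\<forall>n. X n \<in> N) \<and> (\<forall>n. 0 < t n) \<and> X \<longlonglongrightarrow> x \<and>
     (\<lambda>n::nat. (X n - x) /\<^sub>R t n) \<longlonglongrightarrow> v}"

text \<open>
  A sequence in \<open>N\<close> tending to \<open>g y\<close> comes from parameters tending to \<open>y\<close>. As the derivative of \<open>g\<close> is injective on \<open>L\<close>,
  increments of the parameters are bounded by those of the points, so that their difference quotients subconverge.
\<close>

lemma tangent_cone_local_param:
  assumes P: "local_param N L w U g" and y: "y \<in> U \<inter> half_space L w"
  shows "tangent_cone N (g y) = frechet_derivative g (at y) ` half_cone L w y"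
proof -
  define g' where "g' = frechet_derivative g (at y)"
  let ?H = "half_space L w"
  have L: "subspace L" and U: "open U" and inj: "inj_on g' L" and gc: "Cinf_on U g"
    using P y by (auto simp: local_param_def g'_def)
  obtain h where h: "homeomorphism (U \<inter> ?H) (g ` (U \<inter> ?H)) g h"
    using P by (auto simp: local_param_def)
  have g': "(g has_derivative g') (at y)"
    unfolding g'_def using Cinf_on_has_derivative[OF gc] y by blast
  then have lin: "bounded_linear g'" using has_derivative_bounded_linear by blast
  have sub: "g ` (U \<inter> ?H) \<subseteq> N"
    by (rule openin_imp_subset[where U = euclidean]) (use P in \<open>simp add: local_param_def\<close>)
  have "g' l \<in> tangent_cone N (g y)" if l: "l \<in> half_cone L w y" for l
  proof -
    obtain t where t: "\<And>n. 0 < t n" "\<And>n. y + t n *\<^sub>R l \<in> U \<inter> ?H"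
      and Y: "(\<lambda>n. y + t n *\<^sub>R l) \<longlonglongrightarrow> y"
      and z: "(\<lambda>n. (y + t n *\<^sub>R l - y) /\<^sub>R t n) \<longlonglongrightarrow> l"
      by (rule half_cone_sequence[OF L U y l]) blast
    have "(\<lambda>n. (g (y + t n *\<^sub>R l) - g y) /\<^sub>R t n) \<longlonglongrightarrow> g' l"
      by (rule has_derivative_sequential[OF g' Y t(1) z])
    moreover have "(\<lambda>n. g (y + t n *\<^sub>R l)) \<longlonglongrightarrow> g y"
      using isCont_tendsto_compose[OF has_derivative_continuous[OF g'] Y] .
    moreover have "\<forall>n. g (y + t n *\<^sub>R l) \<in> N" using t(2) sub by blast
    ultimately show ?thesis
      unfolding tangent_cone_def using t(1)
      by (intro CollectI exI[of _ "\<lambda>n. g (y + t n *\<^sub>R l)"] exI[of _ t]) simp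
  qed
  moreover have "v \<in> g' ` half_cone L w y" if v0: "v \<in> tangent_cone N (g y)" for v
  proof -
    obtain X t where X: "\<And>n. X n \<in> N" "X \<longlonglongrightarrow> g y" and t: "\<And>n. 0 < t n"
      and v: "(\<lambda>n::nat. (X n - g y) /\<^sub>R t n) \<longlonglongrightarrow> v"
      using v0 unfolding tangent_cone_def mem_Collect_eq by (elim exE conjE) (rule that, simp_all)
    have "openin (top_of_set N) (g ` (U \<inter> ?H))" using P by (simp add: local_param_def)
    then obtain V where V: "open V" "g ` (U \<inter> ?H) = N \<inter> V" by (auto simp: openin_open)
    have "g y \<in> V" using V y by blast
    then have "\<forall>\<^sub>F n in sequentially. X n \<in> V" using X(2) V(1) topological_tendstoD by blast
    then obtain n1 where n1: "\<And>n. n \<ge> n1 \<Longrightarrow> X n \<in> g ` (U \<inter> ?H)"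
      using X(1) V(2) unfolding eventually_sequentially by blast
    define Y where "Y = (\<lambda>n. h (X (n + n1)))"
    have YU: "Y n \<in> U \<inter> ?H" and gY: "g (Y n) = X (n + n1)" for n
      using n1[of "n + n1"] h by (auto simp: Y_def homeomorphism_def)
    have hy: "h (g y) = y" using h y by (auto simp: homeomorphism_def)
    have X1: "(\<lambda>n. X (n + n1)) \<longlonglongrightarrow> g y" using X(2) by (rule LIMSEQ_ignore_initial_segment)
    have "continuous_on (g ` (U \<inter> ?H)) h" using h by (simp add: homeomorphism_def)
    then have "Y \<longlonglongrightarrow> h (g y)" unfolding Y_def
      by (rule continuous_on_tendsto_compose) (use X1 n1 y in auto)
    then have Y: "Y \<longlonglongrightarrow> y" by (simp add: hy)
    define s where "s = (\<lambda>n. t (n + n1))"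
    define q where "q = (\<lambda>n. (Y n - y) /\<^sub>R s n)"
    have s: "0 < s n" for n using t by (simp add: s_def)
    have v1: "(\<lambda>n. (g (Y n) - g y) /\<^sub>R s n) \<longlonglongrightarrow> v"
      using LIMSEQ_ignore_initial_segment[OF v, of n1] by (simp add: gY s_def)
    have qL: "q n \<in> half_cone L w y" for n
    proof -
      have "Y n - y \<in> L" using subspace_half_space_diff[OF L] YU y by blast
      moreover have "y \<bullet> w = 0 \<Longrightarrow> 0 \<le> (Y n - y) \<bullet> w"
        using YU[of n] by (simp add: half_space_def inner_diff_left)
      ultimately show ?thesis
        using L s[of n] by (simp add: q_def half_cone_def subspace_scale)
    qed
    have "\<forall>x\<in>L. g' x = 0 \<longrightarrow> x = 0"
      using inj L lin by (metis inj_onD linear_simps(3) subspace_0)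
    then obtain c where c: "c > 0" "\<And>l. l \<in> L \<Longrightarrow> c * norm l \<le> norm (g' l)"
      using injective_imp_isometric[OF closed_subspace[OF L] L lin] by blast
    \<comment> \<open>Near \<open>y\<close> the error of the linear approximation is at most half of what injectivity gives.\<close>
    have "c / 2 > 0" using c by simp
    then obtain d where d: "d > 0" "\<And>u. norm (u - y) < d \<Longrightarrow> norm (g u - g y - g' (u - y)) \<le> c / 2 * norm (u - y)"
      using g' unfolding has_derivative_at_alt by blast
    obtain n2 where n2: "\<And>n. n \<ge> n2 \<Longrightarrow> norm (Y n - y) < d"
      using LIMSEQ_D[OF Y d(1)] by blast
    obtain K where K: "\<And>n. norm ((g (Y n) - g y) /\<^sub>R s n) \<le> K"
      using convergent_imp_Bseq[of "\<lambda>n. (g (Y n) - g y) /\<^sub>R s n"] v1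
      unfolding convergent_def Bseq_def by auto
    have bnd: "norm (q (n + n2)) \<le> 2 / c * K" for n
    proof -
      let ?n = "n + n2"
      have "c * norm (Y ?n - y) \<le> norm (g' (Y ?n - y))"
        using c(2) subspace_half_space_diff[OF L] YU y by blast
      also have "\<dots> \<le> norm (g (Y ?n) - g y) + norm (g (Y ?n) - g y - g' (Y ?n - y))"
        by (metis norm_minus_commute norm_triangle_sub)
      also have "\<dots> \<le> norm (g (Y ?n) - g y) + c / 2 * norm (Y ?n - y)"
        using d(2)[OF n2[of ?n]] by simp
      finally have "norm (Y ?n - y) \<le> 2 / c * norm (g (Y ?n) - g y)"
        using c(1) by (simp add: field_simps)
      then have "norm (Y ?n - y) / s ?n \<le> 2 / c * norm (g (Y ?n) - g y) / s ?n"
        by (rule divide_right_mono) (use s[of ?n] in simp)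
      then have "norm (q ?n) \<le> 2 / c * norm ((g (Y ?n) - g y) /\<^sub>R s ?n)"
        using s[of ?n] by (simp add: q_def divide_inverse mult_ac)
      also have "\<dots> \<le> 2 / c * K" using K c(1) by (intro mult_left_mono) auto
      finally show ?thesis .
    qed
    have "bounded (range (\<lambda>n. q (n + n2)))" using bnd by (auto simp: bounded_iff)
    then obtain z r where r: "strict_mono (r :: nat \<Rightarrow> nat)" and z: "((\<lambda>n. q (n + n2)) \<circ> r) \<longlonglongrightarrow> z"
      using bounded_imp_convergent_subsequence by metis
    define k where "k = (\<lambda>n. r n + n2)"
    have k: "strict_mono k" using r by (simp add: k_def strict_mono_def)
    have zk: "(\<lambda>n. (Y (k n) - y) /\<^sub>R s (k n)) \<longlonglongrightarrow> z"
      using z by (simp add: k_def q_def o_def)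
    have "(\<lambda>n. Y (k n)) \<longlonglongrightarrow> y" using LIMSEQ_subseq_LIMSEQ[OF Y k] by (simp add: o_def)
    from has_derivative_sequential[OF g' this s zk]
    have "(\<lambda>n. (g (Y (k n)) - g y) /\<^sub>R s (k n)) \<longlonglongrightarrow> g' z" .
    moreover have "(\<lambda>n. (g (Y (k n)) - g y) /\<^sub>R s (k n)) \<longlonglongrightarrow> v"
      using LIMSEQ_subseq_LIMSEQ[OF v1 k] by (simp add: o_def)
    ultimately have "v = g' z" using LIMSEQ_unique by blast
    moreover have "closed (half_cone L w y)"
    proof (cases "y \<bullet> w = 0")
      case True
      then have "half_cone L w y = L \<inter> {l. 0 \<le> l \<bullet> w}" by (auto simp: half_cone_def)
      then show ?thesis
        using closed_subspace[OF L] closed_halfspace_component_ge closed_Collect_le[of "\<lambda>_. 0" "\<lambda>l. l \<bullet> w"]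
        by (simp add: closed_Int continuous_on_inner)
    next
      case False
      then have "half_cone L w y = L" by (auto simp: half_cone_def)
      then show ?thesis using closed_subspace[OF L] by simp
    qed
    then have "z \<in> half_cone L w y"
      using closed_sequentially[of "half_cone L w y" "\<lambda>n. q (k n)" z] qL zk by (simp add: q_def)
    ultimately show ?thesis by blast
  qed
  ultimately show ?thesis unfolding g'_def by blast
qed

text \<open>
  The tangent cone is the injective linear image of \<open>L\<close> or, at a boundary point, of a half-space of \<open>L\<close>. Only in the
  second case does it fail to be symmetric, and in both cases its differences fill the image of \<open>L\<close>.
\<close>

lemma model_at_tangent_cone:
  assumes "model_at N x b D"
  shows "b \<longleftrightarrow> (\<exists>v\<in>tangent_cone N x. - v \<notin> tangent_cone N x)"
    "D = {u - v |u v. u \<in> tangent_cone N x \<and> v \<in> tangent_cone N x}"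
proof -
  obtain L w U g y where P: "local_param N L w U g"
    and y: "y \<in> U \<inter> half_space L w" "g y = x"
    and b: "b \<longleftrightarrow> w \<noteq> 0 \<and> y \<bullet> w = 0" and D: "D = frechet_derivative g (at y) ` L"
    using assms unfolding model_at_def by blast
  define g' where "g' = frechet_derivative g (at y)"
  have L: "subspace L" "w \<in> L" and inj: "inj_on g' L" and gc: "Cinf_on U g"
    using P y by (auto simp: local_param_def g'_def)
  have lin: "linear g'"
    unfolding g'_def using Cinf_on_has_derivative[OF gc, of y] y has_derivative_linear by blast
  have cone: "tangent_cone N x = g' ` half_cone L w y"
    using tangent_cone_local_param[OF P y(1)] y(2) by (simp add: g'_def)
  have sub: "half_cone L w y \<subseteq> L" by (auto simp: half_cone_def)
  show "b \<longleftrightarrow> (\<exists>v\<in>tangent_cone N x. - v \<notin> tangent_cone N x)"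
  proof (cases b)
    case True
    then have w: "w \<noteq> 0" "y \<bullet> w = 0" using b by auto
    have "w \<in> half_cone L w y" using L by (simp add: half_cone_def)
    moreover have "- g' w \<notin> g' ` half_cone L w y"
    proof
      assume "- g' w \<in> g' ` half_cone L w y"
      then obtain l where l: "l \<in> half_cone L w y" "g' (- w) = g' l"
        using lin by (auto simp: linear_neg)
      then have "- w = l" using inj_onD[OF inj, of "- w" l] L sub by (auto simp: subspace_neg)
      then have "0 \<le> - w \<bullet> w" using l(1) w by (simp add: half_cone_def)
      then show False using w(1) by (metis inner_gt_zero_iff inner_minus_left neg_0_le_iff_le not_le)
    qed
    ultimately show ?thesis using True cone by blast
  next
    case False
    then have "half_cone L w y = L" using b by (auto simp: half_cone_def)
    then have "\<forall>v\<in>tangent_cone N x. - v \<in> tangent_cone N x"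
      using cone lin L by (auto simp: linear_neg[symmetric] subspace_neg)
    then show ?thesis using False by blast
  qed
  have "g' l \<in> {u - v |u v. u \<in> tangent_cone N x \<and> v \<in> tangent_cone N x}" if "l \<in> L" for l
  proof (cases "l \<in> half_cone L w y")
    case True
    moreover have "0 \<in> half_cone L w y" using L by (simp add: half_cone_def subspace_0)
    moreover have "g' l = g' l - g' 0" using lin by (simp add: linear_0)
    ultimately show ?thesis unfolding cone by blast
  next
    case False
    then have "- l \<in> half_cone L w y" using that L by (auto simp: half_cone_def subspace_neg)
    moreover have "0 \<in> half_cone L w y" using L by (simp add: half_cone_def subspace_0)
    moreover have "g' l = g' 0 - g' (- l)" using lin by (simp add: linear_0 linear_neg)
    ultimately show ?thesis unfolding cone by blast
  qed
  moreover have "g' k - g' l \<in> g' ` L" if "k \<in> half_cone L w y" "l \<in> half_cone L w y" for k l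
  proof -
    have "k - l \<in> L" using that sub L by (auto intro: subspace_diff)
    moreover have "g' k - g' l = g' (k - l)" using lin by (simp add: linear_diff)
    ultimately show ?thesis by blast
  qed
  ultimately show "D = {u - v |u v. u \<in> tangent_cone N x \<and> v \<in> tangent_cone N x}"
    unfolding D g'_def[symmetric] cone by blast
qed

corollary model_at_unique:
  assumes "model_at N x b D" "model_at N x b' D'"
  shows "b' = b" "D' = D"
  using model_at_tangent_cone[OF assms(1)] model_at_tangent_cone[OF assms(2)] by auto

lemma model_at_tangent_space:
  assumes "model_at N x b D"
  shows "tangent_space N x = D"
proof (rule set_eqI)
  fix v
  show "v \<in> tangent_space N x \<longleftrightarrow> v \<in> D"
    unfolding tangent_space_iff_model_at using assms model_at_unique(2)[OF assms] by metis
qed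

text \<open>
  If \<open>g\<close> is a parametrisation of \<open>N\<close>, then \<open>f \<circ> g\<close> is one of \<open>f ` N\<close>: undoing \<open>f\<close> by its smooth inverse, and differentiating
  along the half-space, shows that its derivative is injective on \<open>L\<close>. For the same reason \<open>dim L\<close> is at most the dimension
  of the new surrounding space, where an isometric copy of \<open>L\<close> can then serve as domain.
\<close>

lemma model_at_transfer:
  fixes f :: "'a::euclidean_space \<Rightarrow> 'b::euclidean_space"
  assumes hom: "homeomorphism A B f h" and fs: "smooth_on A f" and hs: "smooth_on B h"
    and NA: "N \<subseteq> A" and m: "model_at N x b D"
    and V: "open V" "x \<in> V" "Cinf_on V fe" "\<forall>y\<in>A \<inter> V. f y = fe y"
  shows "model_at (f ` N) (f x) b (frechet_derivative fe (at x) ` D)"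
proof -
  obtain L w U g y where P: "local_param N L w U g"
    and y: "y \<in> U \<inter> half_space L w" "g y = x"
    and b: "b \<longleftrightarrow> w \<noteq> 0 \<and> y \<bullet> w = 0" and D: "D = frechet_derivative g (at y) ` L"
    using m unfolding model_at_def by blast
  let ?H = "half_space L w"
  have fA: "f z \<in> B" "h (f z) = z" if "z \<in> A" for z
    using hom that by (auto simp: homeomorphism_def)
  have xA: "x \<in> A" using model_at_mem[OF m] NA by blast
  obtain W he where W: "open W" "f x \<in> W" "Cinf_on W he" "\<forall>z\<in>B \<inter> W. h z = he z"
    using smooth_onD[OF hs fA(1)[OF xA]] by (elim exE conjE) (rule that)
  have U: "open U" "Cinf_on U g" and L: "subspace L" "w \<in> L"
    using P by (auto simp: local_param_def)
  define V1 where "V1 = V \<inter> fe -` W"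
  have V1: "open V1"
    unfolding V1_def by (rule continuous_open_preimage[OF Cinf_on_continuous[OF V(3)] V(1) W(1)])
  define U1 where "U1 = U \<inter> g -` V1"
  have U1: "open U1" "U1 \<subseteq> U"
    unfolding U1_def by (auto intro: continuous_open_preimage[OF Cinf_on_continuous[OF U(2)] U(1) V1])
  have P1: "local_param N L w U1 g" by (rule local_param_shrink[OF P U1])
  have y1: "y \<in> U1 \<inter> ?H" using y V(2,4) W(2) xA by (auto simp: U1_def V1_def)
  have gN: "g z \<in> N" if "z \<in> U1 \<inter> ?H" for z
    using P1 openin_imp_subset[of _ N "g ` (U1 \<inter> ?H)"] that by (auto simp: local_param_def)
  have gU: "g z \<in> V" "fe (g z) \<in> W" if "z \<in> U1" for z
    using that by (auto simp: U1_def V1_def)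
  have fe: "fe (g z) = f (g z)" if "z \<in> U1 \<inter> ?H" for z
    using V(4) gN[OF that] gU(1)[of z] that NA by auto
  have hfg: "he (fe (g z)) = g z" if "z \<in> U1 \<inter> ?H" for z
    using W(4) gN[OF that] gU(2)[of z] that NA fA[of "g z"] fe[OF that] by auto
  define G where "G = (\<lambda>z. frechet_derivative fe (at (g z)) \<circ> frechet_derivative g (at z))"
  have G: "((\<lambda>z. fe (g z)) has_derivative G z) (at z)" if "z \<in> U1" for z
    unfolding G_def o_def
    by (rule has_derivative_compose[OF Cinf_on_has_derivative[OF U(2)] Cinf_on_has_derivative[OF V(3)]])
      (use that gU U1 in auto)
  have Ginj: "inj_on (G z) L" if z: "z \<in> U1 \<inter> ?H" for z
  proof -
    have z1: "z \<in> U1" and zU: "z \<in> U" using z U1(2) by auto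
    have d: "((\<lambda>z. he (fe (g z))) has_derivative
        (\<lambda>v. frechet_derivative he (at (fe (g z))) (G z v))) (at z)"
      by (rule has_derivative_compose[OF G[OF z1] Cinf_on_has_derivative[OF W(3)]])
        (use z1 gU in auto)
    have "frechet_derivative he (at (fe (g z))) (G z l) = frechet_derivative g (at z) l" if "l \<in> L" for l
      by (rule derivative_eq_on_half_space[OF L(1) U1(1) z d Cinf_on_has_derivative[OF U(2) zU] hfg that])
    moreover have "inj_on (frechet_derivative g (at z)) L"
      using P1 z by (simp add: local_param_def)
    ultimately show ?thesis unfolding inj_on_def by metis
  qed
  have "linear (G y)" using G[of y] y1 has_derivative_linear by blast
  then have "dim (G y ` L) = dim L"
    using Ginj[OF y1] by (intro dim_image_eq) (simp_all add: span_eq_iff[THEN iffD2, OF L(1)])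
  then have "dim L \<le> dim (UNIV :: 'b set)"
    using dim_subset_UNIV[of "G y ` L"] by simp
  then obtain L' :: "'b set" where L': "subspace L'" "dim L' = dim L"
    using choose_subspace_of_subspace[of "dim L" "UNIV :: 'b set"] by metis
  \<comment> \<open>An isometry carries the half-space of \<open>L\<close> cut out by \<open>w\<close> to that of \<open>L\<^sup>\<prime>\<close> cut out by \<open>i w\<close>.\<close>
  obtain i p where ip: "linear i" "linear p" "i ` L = L'" "p ` L' = L"
    "\<And>l. l \<in> L \<Longrightarrow> norm (i l) = norm l" "\<And>l. l \<in> L' \<Longrightarrow> norm (p l) = norm l"
    "\<And>l. l \<in> L \<Longrightarrow> p (i l) = l" "\<And>l. l \<in> L' \<Longrightarrow> i (p l) = l"
    using isometries_subspaces[OF L(1) L'(1)] L'(2) by metis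
  have inner: "i k \<bullet> i l = k \<bullet> l" if "k \<in> L" "l \<in> L" for k l
    using that ip(1,5) L(1) by (simp add: dot_norm linear_add[symmetric] subspace_add)
  define w' where "w' = i w"
  define U' where "U' = p -` U1"
  define g' where "g' = (\<lambda>z. fe (g (p z)))"
  have bl: "bounded_linear p" "bounded_linear i" using ip by (auto simp: linear_conv_bounded_linear)
  have U': "open U'"
    unfolding U'_def by (rule open_vimage[OF U1(1)]) (use bl in \<open>auto intro: linear_continuous_on\<close>)
  have pH: "p z \<in> U1 \<inter> ?H" "i (p z) = z" if "z \<in> U' \<inter> half_space L' w'" for z
  proof -
    have z: "z \<in> L'" "0 \<le> z \<bullet> w'" "z \<in> U'" using that by (auto simp: half_space_def)
    then have "p z \<in> L" "i (p z) = z" using ip by auto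
    then show "p z \<in> U1 \<inter> ?H" "i (p z) = z"
      using z inner[of "p z" w] L by (auto simp: half_space_def U'_def w'_def)
  qed
  have iH: "i z \<in> U' \<inter> half_space L' w'" "p (i z) = z" if "z \<in> U1 \<inter> ?H" for z
  proof -
    have z: "z \<in> L" "0 \<le> z \<bullet> w" "z \<in> U1" using that by (auto simp: half_space_def)
    then show "p (i z) = z" using ip by auto
    then show "i z \<in> U' \<inter> half_space L' w'"
      using z inner[of z w] L ip by (auto simp: half_space_def U'_def w'_def)
  qed
  have g'd: "(g' has_derivative (\<lambda>v. G (p z) (p v))) (at z)" if "z \<in> U'" for z
    unfolding g'_def
    by (rule has_derivative_compose[OF bounded_linear_imp_has_derivative[OF bl(1)] G])
      (use that in \<open>auto simp: U'_def\<close>)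
  define S where "S = g ` (U1 \<inter> ?H)"
  have SN: "S \<subseteq> N" using gN by (auto simp: S_def)
  have homN: "homeomorphism N (f ` N) f h"
    by (rule homeomorphism_of_subsets[OF hom]) (use NA hom in \<open>auto simp: homeomorphism_def\<close>)
  have homS: "homeomorphism S (f ` S) f h"
    by (rule homeomorphism_of_subsets[OF homN]) (use SN in auto)
  obtain h1 where h1: "homeomorphism (U1 \<inter> ?H) S g h1"
    using P1 unfolding local_param_def S_def by blast
  have homp: "homeomorphism (U' \<inter> half_space L' w') (U1 \<inter> ?H) p i"
  proof (rule homeomorphismI)
    show "p ` (U' \<inter> half_space L' w') \<subseteq> U1 \<inter> ?H" using pH(1) by blast
    show "i ` (U1 \<inter> ?H) \<subseteq> U' \<inter> half_space L' w'" using iH(1) by blast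
  qed (use pH(2) iH(2) bl in \<open>simp_all add: linear_continuous_on\<close>)
  have "homeomorphism (U' \<inter> half_space L' w') (f ` S) (f \<circ> (g \<circ> p)) (i \<circ> h1 \<circ> h)"
    by (rule homeomorphism_compose[OF homeomorphism_compose[OF homp h1] homS])
  then have homg: "homeomorphism (U' \<inter> half_space L' w') (f ` S) g' (i \<circ> h1 \<circ> h)"
    by (rule homeomorphism_cong) (use pH fe in \<open>auto simp: g'_def\<close>)
  then have im: "g' ` (U' \<inter> half_space L' w') = f ` S" by (simp add: homeomorphism_def)
  have "openin (top_of_set N) S" using P1 by (simp add: local_param_def S_def)
  then have "openin (top_of_set (f ` N)) (f ` S)" by (rule homeomorphism_imp_open_map[OF homN])
  moreover have "Cinf_on U' g'"
    unfolding g'_def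
  proof (rule Cinf_on_compose[OF U' V(1) _ _ V(3)])
    show "Cinf_on U' (\<lambda>z. g (p z))"
      by (rule Cinf_on_compose[OF U' U(1) _ _ U(2)])
        (use U1 U' bl in \<open>auto simp: U'_def intro: Cinf_on_bounded_linear\<close>)
  qed (use gU in \<open>auto simp: U'_def\<close>)
  moreover have "inj_on (frechet_derivative g' (at z)) L'" if "z \<in> U' \<inter> half_space L' w'" for z
  proof -
    have "frechet_derivative g' (at z) = (\<lambda>v. G (p z) (p v))"
      using frechet_derivative_at[OF g'd[of z]] that by simp
    moreover have "inj_on p L'" using ip(8) by (metis inj_on_inverseI)
    then have "inj_on (G (p z) \<circ> p) L'"
      using Ginj[OF pH(1)[OF that]] ip(4) by (intro comp_inj_on) auto
    ultimately show ?thesis by (simp add: o_def)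
  qed
  moreover have "w' \<in> L'" using ip L by (auto simp: w'_def)
  ultimately have P': "local_param (f ` N) L' w' U' g'"
    unfolding local_param_def im using L' U' homg by blast
  have y': "i y \<in> U' \<inter> half_space L' w'" "p (i y) = y" using iH[OF y1] by auto
  have yL: "y \<in> L" using y by (simp add: half_space_def)
  have "g' (i y) = f x" using y' y fe[OF y1] by (simp add: g'_def)
  moreover have "b \<longleftrightarrow> w' \<noteq> 0 \<and> i y \<bullet> w' = 0"
    using b inner[OF yL L(2)] ip(5)[OF L(2)] by (auto simp: w'_def)
  moreover have "frechet_derivative fe (at x) ` D = frechet_derivative g' (at (i y)) ` L'"
  proof -
    have "frechet_derivative g' (at (i y)) = (\<lambda>v. G y (p v))"
      using frechet_derivative_at[OF g'd[of "i y"]] y' by simp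
    then have "frechet_derivative g' (at (i y)) ` L' = G y ` L"
      using ip(4) by (metis image_image)
    then show ?thesis using D y(2) by (simp add: G_def image_comp)
  qed
  ultimately show ?thesis unfolding model_at_def using P' y'(1) by blast
qed


section \<open>Sub-manifolds under localisation and diffeomorphisms\<close>

lemma mf_boundary_local: "open V \<Longrightarrow> mf_boundary (N \<inter> V) = mf_boundary N \<inter> V"
  by (auto simp: mf_boundary_iff_model_at model_at_local)

lemma tangent_space_local: "open V \<Longrightarrow> x \<in> V \<Longrightarrow> tangent_space (N \<inter> V) x = tangent_space N x"
  by (auto simp: tangent_space_iff_model_at model_at_local)

lemma bd_submanifold_local: "open V \<Longrightarrow> bd_submanifold N \<Longrightarrow> bd_submanifold (N \<inter> V)"
  by (auto simp: bd_submanifold_iff_model_at model_at_local)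

lemma mf_boundary_subset: "mf_boundary N \<subseteq> N"
  by (auto simp: mf_boundary_iff_model_at dest: model_at_mem)

lemma p_submanifold_restrict:
  assumes V: "open V" and p: "p_submanifold P N"
  shows "p_submanifold (P \<inter> V) (N \<inter> V)"
  unfolding p_submanifold_def
proof (intro conjI ballI)
  show "N \<inter> V \<subseteq> P \<inter> V" "bd_submanifold (N \<inter> V)"
    "mf_boundary (N \<inter> V) = N \<inter> V \<inter> mf_boundary (P \<inter> V)"
    using p V by (auto simp: p_submanifold_def bd_submanifold_local mf_boundary_local)
  fix x assume "x \<in> mf_boundary (N \<inter> V)"
  then have x: "x \<in> V" "x \<in> mf_boundary N" using V by (auto simp: mf_boundary_local)
  then show "{u + v |u v. u \<in> tangent_space (N \<inter> V) x \<and> v \<in> tangent_space (mf_boundary (P \<inter> V)) x} =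
      tangent_space (P \<inter> V) x"
    using p V by (simp add: mf_boundary_local tangent_space_local p_submanifold_def)
qed

lemma p_submanifold_open_ambient:
  assumes V: "open V" "N \<subseteq> V"
  shows "p_submanifold (P \<inter> V) N \<longleftrightarrow> p_submanifold P N"
proof -
  have "N \<subseteq> P \<inter> V \<longleftrightarrow> N \<subseteq> P" using V by blast
  moreover have "N \<inter> mf_boundary (P \<inter> V) = N \<inter> mf_boundary P"
    using V by (auto simp: mf_boundary_local)
  moreover have "tangent_space (mf_boundary (P \<inter> V)) x = tangent_space (mf_boundary P) x"
    "tangent_space (P \<inter> V) x = tangent_space P x" if "x \<in> mf_boundary N" for x
    using that V mf_boundary_subset[of N] by (auto simp: mf_boundary_local tangent_space_local subset_iff)
  ultimately show ?thesis
    unfolding p_submanifold_def by simp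
qed

text \<open>
  The sets need not be open. Smoothness is that of local extensions, so cylinders with boundary and spheres are allowed.
\<close>

definition diffeo ::
  "'a::euclidean_space set \<Rightarrow> 'b::euclidean_space set \<Rightarrow> ('a \<Rightarrow> 'b) \<Rightarrow> ('b \<Rightarrow> 'a) \<Rightarrow> bool" where
  "diffeo A B f h \<longleftrightarrow> smooth_on A f \<and> smooth_on B h \<and> f ` A = B \<and> (\<forall>x\<in>A. h (f x) = x)"

lemma diffeo_homeomorphism: "diffeo A B f h \<Longrightarrow> homeomorphism A B f h"
  by (auto simp: diffeo_def smooth_on_continuous intro!: homeomorphismI)

lemma diffeo_inv:
  assumes "diffeo A B f h" "x \<in> A"
  shows "h (f x) = x" "f x \<in> B"
  using assms by (auto simp: diffeo_def)

lemma diffeo_inj_on: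
  assumes "diffeo A B f h"
  shows "inj_on f A"
  by (rule inj_on_inverseI[where g = h]) (rule diffeo_inv(1)[OF assms])

lemma diffeo_sym: "diffeo A B f h \<Longrightarrow> diffeo B A h f"
  unfolding diffeo_def by (auto simp: image_iff intro: rev_bexI)

lemma diffeo_restrict:
  assumes "diffeo A B f h" "S \<subseteq> A"
  shows "diffeo S (f ` S) f h"
  using assms smooth_on_subset[of A f S] smooth_on_subset[of B h "f ` S"]
  by (auto simp: diffeo_def subset_iff)

lemma image_inverse: "(\<And>x. x \<in> B \<Longrightarrow> g (f x) = x) \<Longrightarrow> g ` f ` B = B"
  by (simp add: image_image cong: image_cong)

lemma diffeo_image_inverse:
  assumes "diffeo A B f h" "S \<subseteq> A"
  shows "h ` f ` S = S"
  by (rule image_inverse) (use assms in \<open>auto simp: diffeo_def\<close>)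

lemma diffeo_model_at:
  assumes f: "diffeo A B f h" and N: "N \<subseteq> A" and m: "model_at N x b D"
  shows "\<exists>D'. model_at (f ` N) (f x) b D'"
proof -
  have fs: "smooth_on A f" and hs: "smooth_on B h" using f by (auto simp: diffeo_def)
  have "x \<in> A" using model_at_mem[OF m] N by blast
  then obtain V fe where "open V" "x \<in> V" "Cinf_on V fe" "\<forall>y\<in>A \<inter> V. f y = fe y"
    using smooth_onD[OF fs \<open>x \<in> A\<close>] by (elim exE conjE) (rule that)
  from model_at_transfer[OF diffeo_homeomorphism[OF f] fs hs N m this] show ?thesis by blast
qed

lemma bd_submanifold_transfer:
  assumes "diffeo A B f h" "N \<subseteq> A" "bd_submanifold N"
  shows "bd_submanifold (f ` N)"
  using diffeo_model_at[OF assms(1,2)] assms(3)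
  unfolding bd_submanifold_iff_model_at by blast

lemma mf_boundary_transfer:
  assumes f: "diffeo A B f h" and N: "N \<subseteq> A"
  shows "mf_boundary (f ` N) = f ` mf_boundary N"
proof
  show "f ` mf_boundary N \<subseteq> mf_boundary (f ` N)"
    using diffeo_model_at[OF f N] by (auto simp: mf_boundary_iff_model_at)
  show "mf_boundary (f ` N) \<subseteq> f ` mf_boundary N"
  proof
    fix z assume z: "z \<in> mf_boundary (f ` N)"
    then obtain D where D: "model_at (f ` N) z True D" by (auto simp: mf_boundary_iff_model_at)
    have "f ` N \<subseteq> B" using f N by (auto simp: diffeo_def)
    then obtain D' where "model_at (h ` f ` N) (h z) True D'"
      using diffeo_model_at[OF diffeo_sym[OF f] _ D] by blast
    then have "h z \<in> mf_boundary N"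
      unfolding diffeo_image_inverse[OF f N] by (auto simp: mf_boundary_iff_model_at)
    moreover obtain x where "x \<in> N" "z = f x" using model_at_mem[OF D] by blast
    then have "z = f (h z)" using diffeo_inv(1)[OF f] N by auto
    ultimately show "z \<in> f ` mf_boundary N" by blast
  qed
qed

text \<open>
  Parametrisations of \<open>N\<close> are pushed forward. Conversely those of \<open>f ` N\<close> are pulled back and pushed forward again, which
  gives the same tangent space by uniqueness.
\<close>

lemma tangent_space_transfer:
  assumes f: "diffeo A B f h" and N: "N \<subseteq> A" and x: "x \<in> A"
    and V: "open V" "x \<in> V" "Cinf_on V fe" "\<forall>y\<in>A \<inter> V. f y = fe y"
  shows "tangent_space (f ` N) (f x) = frechet_derivative fe (at x) ` tangent_space N x"
proof -
  have fs: "smooth_on A f" and hs: "smooth_on B h" using f by (auto simp: diffeo_def)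
  note push = model_at_transfer[OF diffeo_homeomorphism[OF f] fs hs N _ V]
  have fN: "f ` N \<subseteq> B" using f N by (auto simp: diffeo_def)
  have back': "\<exists>b D'. model_at N x b D' \<and> D = frechet_derivative fe (at x) ` D'"
    if m: "model_at (f ` N) (f x) b D" for b D
  proof -
    obtain D' where "model_at (h ` f ` N) (h (f x)) b D'"
      using diffeo_model_at[OF diffeo_sym[OF f] fN m] by blast
    then have m': "model_at N x b D'"
      using diffeo_inv(1)[OF f x] diffeo_image_inverse[OF f N] by simp
    then show ?thesis using model_at_unique(2)[OF push[OF m'] m] by blast
  qed
  show ?thesis
  proof (intro set_eqI iffI)
    fix v assume "v \<in> tangent_space (f ` N) (f x)"
    then obtain b D where m: "model_at (f ` N) (f x) b D" "v \<in> D"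
      unfolding tangent_space_iff_model_at by blast
    obtain b' D' where "model_at N x b' D'" "D = frechet_derivative fe (at x) ` D'"
      using back'[OF m(1)] by blast
    then show "v \<in> frechet_derivative fe (at x) ` tangent_space N x"
      using m(2) model_at_tangent_space by blast
  next
    fix v assume "v \<in> frechet_derivative fe (at x) ` tangent_space N x"
    then obtain b D where "model_at N x b D" "v \<in> frechet_derivative fe (at x) ` D"
      by (auto simp: tangent_space_iff_model_at)
    then show "v \<in> tangent_space (f ` N) (f x)"
      unfolding tangent_space_iff_model_at using push by blast
  qed
qed

lemma p_submanifold_transfer:
  assumes f: "diffeo P P' f h" and p: "p_submanifold P N"
  shows "p_submanifold P' (f ` N)"
proof -
  have N: "N \<subseteq> P" and fP: "f ` P = P'" and fs: "smooth_on P f"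
    and bN: "mf_boundary N = N \<inter> mf_boundary P"
    using p f by (auto simp: p_submanifold_def diffeo_def)
  have inj: "inj_on f P" by (rule diffeo_inj_on[OF f])
  have bP: "mf_boundary P \<subseteq> P" by (rule mf_boundary_subset)
  have bP': "mf_boundary P' = f ` mf_boundary P"
    using mf_boundary_transfer[OF f order_refl] fP by simp
  have bfN: "mf_boundary (f ` N) = f ` mf_boundary N" by (rule mf_boundary_transfer[OF f N])
  show ?thesis
    unfolding p_submanifold_def
  proof (intro conjI ballI)
    show "f ` N \<subseteq> P'" using N fP by blast
    show "bd_submanifold (f ` N)"
      by (rule bd_submanifold_transfer[OF f N]) (use p in \<open>simp add: p_submanifold_def\<close>)
    show "mf_boundary (f ` N) = f ` N \<inter> mf_boundary P'"
      unfolding bfN bN bP' by (rule inj_on_image_Int[OF inj N bP])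
    fix z assume "z \<in> mf_boundary (f ` N)"
    then obtain x where x: "x \<in> mf_boundary N" "z = f x" unfolding bfN by blast
    have xP: "x \<in> P" using x bN N by blast
    obtain V fe where V: "open V" "x \<in> V" "Cinf_on V fe" "\<forall>y\<in>P \<inter> V. f y = fe y"
      using smooth_onD[OF fs xP] by (elim exE conjE) (rule that)
    define d where "d = frechet_derivative fe (at x)"
    have "linear d" unfolding d_def using Cinf_on_has_derivative[OF V(3,2)] has_derivative_linear by blast
    then have sum: "{u + v |u v. u \<in> d ` S \<and> v \<in> d ` T} = d ` {u + v |u v. u \<in> S \<and> v \<in> T}" for S T
      by (auto simp: image_iff linear_add) (metis linear_add)+
    have "tangent_space (f ` N) z = d ` tangent_space N x"
      "tangent_space (mf_boundary P') z = d ` tangent_space (mf_boundary P) x"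
      "tangent_space P' z = d ` tangent_space P x"
      using tangent_space_transfer[OF f N xP V] tangent_space_transfer[OF f bP xP V]
        tangent_space_transfer[OF f order_refl xP V]
      by (simp_all add: x(2) d_def bP' fP)
    then show "{u + v |u v. u \<in> tangent_space (f ` N) z \<and> v \<in> tangent_space (mf_boundary P') z} =
        tangent_space P' z"
      using p x(1) by (simp add: sum p_submanifold_def)
  qed
qed

lemma homeomorphism_closure_image_subset:
  fixes f :: "'c::metric_space \<Rightarrow> 'd::metric_space"
  assumes h: "homeomorphism S T f g" and B: "B \<subseteq> S"
  shows "f ` (S \<inter> closure B) \<subseteq> T \<inter> closure (f ` B)"
proof
  fix z assume "z \<in> f ` (S \<inter> closure B)"
  then obtain x where x: "x \<in> S" "x \<in> closure B" "z = f x" by blast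
  obtain X where X: "\<And>n. X n \<in> B" "X \<longlonglongrightarrow> x"
    using x(2) unfolding closure_sequential by blast
  have "continuous_on S f" using h by (simp add: homeomorphism_def)
  then have "(\<lambda>n. f (X n)) \<longlonglongrightarrow> f x"
    by (rule continuous_on_tendsto_compose) (use X x B in \<open>auto simp: subset_iff\<close>)
  moreover have "\<forall>n. f (X n) \<in> f ` B" using X(1) by blast
  ultimately have "f x \<in> closure (f ` B)"
    unfolding closure_sequential by (intro exI[of _ "\<lambda>n. f (X n)"]) simp
  then show "z \<in> T \<inter> closure (f ` B)"
    using x h by (auto simp: homeomorphism_def)
qed

lemma homeomorphism_closure_image:
  fixes f :: "'c::metric_space \<Rightarrow> 'd::metric_space"
  assumes hom: "homeomorphism S T f g" and B: "B \<subseteq> S"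
  shows "f ` (S \<inter> closure B) = T \<inter> closure (f ` B)"
proof -
  have gf: "\<And>x. x \<in> S \<Longrightarrow> g (f x) = x" and fg: "\<And>y. y \<in> T \<Longrightarrow> f (g y) = y" and fS: "f ` S = T"
    using hom by (auto simp: homeomorphism_def)
  have gB: "g ` f ` B = B" by (rule image_inverse) (use gf B in auto)
  have "f ` B \<subseteq> T" using B fS by blast
  then have "g ` (T \<inter> closure (f ` B)) \<subseteq> S \<inter> closure B"
    using homeomorphism_closure_image_subset[OF homeomorphism_sym[THEN iffD1, OF hom], of "f ` B"] by (simp add: gB)
  then have "f ` g ` (T \<inter> closure (f ` B)) \<subseteq> f ` (S \<inter> closure B)" by (rule image_mono)
  moreover have "f ` g ` (T \<inter> closure (f ` B)) = T \<inter> closure (f ` B)"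
    by (rule image_inverse) (use fg in auto)
  ultimately show ?thesis using homeomorphism_closure_image_subset[OF hom B] by simp
qed


section \<open>Diffeomorphism invariance of conic points\<close>

definition polar_cyl :: "real \<Rightarrow> (real \<times> 'a::euclidean_space) set" where
  "polar_cyl r = {0..<r} \<times> sphere 0 1"

text \<open>
  The part of the strict transform lying over points other than \<open>a\<close>.
\<close>

definition polar_trace :: "'a::euclidean_space \<Rightarrow> 'a set \<Rightarrow> real \<Rightarrow> (real \<times> 'a) set" where
  "polar_trace a X r = {p \<in> polar_cyl r. 0 < fst p \<and> bl a p \<in> X}"

definition locally_closed_at :: "'a::topological_space set \<Rightarrow> 'a \<Rightarrow> bool" where
  "locally_closed_at X a \<longleftrightarrow> (\<exists>V. open V \<and> a \<in> V \<and> closedin (top_of_set V) (X \<inter> V))"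

lemma bl_inject_pos:
  assumes "norm (snd p) = 1" "norm (snd q) = 1" "0 < fst p" "0 < fst q" "bl a p = bl a q"
  shows "p = q"
proof -
  have eq: "fst p *\<^sub>R snd p = fst q *\<^sub>R snd q" using assms(5) by (simp add: bl_def case_prod_beta)
  then have "norm (fst p *\<^sub>R snd p) = norm (fst q *\<^sub>R snd q)" by simp
  then have "fst p = fst q" using assms by simp
  then show ?thesis using eq assms by (simp add: prod_eq_iff)
qed

lemma strict_transform_polar:
  "strict_transform a (X \<inter> ball a r) \<inter> polar_cyl r = polar_cyl r \<inter> closure (polar_trace a X r)"
proof -
  have eq: "{p \<in> blowup_space. bl a p \<in> X \<inter> ball a r - {a}} = polar_trace a X r"
    by (auto simp: polar_trace_def polar_cyl_def blowup_space_def bl_def dist_norm)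
  have sub: "polar_trace a X r \<subseteq> blowup_space" "polar_cyl r \<subseteq> (blowup_space :: (real \<times> 'a) set)"
    by (auto simp: polar_trace_def polar_cyl_def blowup_space_def)
  have "strict_transform a (X \<inter> ball a r) = blowup_space \<inter> closure (polar_trace a X r)"
    unfolding strict_transform_def eq closure_of_subtopology
    using sub(1) by (simp add: euclidean_closure_of Int_absorb1)
  then show ?thesis using sub(2) by blast
qed

lemma conic_point_iff:
  "conic_point X a \<longleftrightarrow> a \<in> closure X \<and> locally_closed_at X a \<and>
     (\<exists>r>0. p_submanifold (polar_cyl r) (polar_cyl r \<inter> closure (polar_trace a X r)))"
proof -
  have "(\<forall>V. open V \<and> a \<in> V \<longrightarrow> X \<inter> V \<noteq> {}) \<longleftrightarrow> a \<in> closure X"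
    unfolding closure_iff_nhds_not_empty by (metis Int_commute subset_refl subset_iff Int_iff ex_in_conv)
  moreover have "closedin (top_of_set (polar_cyl r)) (polar_cyl r \<inter> closure S)"
    for r and S :: "(real \<times> 'a) set"
    by (simp add: closedin_closed_Int)
  ultimately show ?thesis
    unfolding conic_point_def Let_def locally_closed_at_def polar_cyl_def[symmetric] strict_transform_polar
    by simp
qed

text \<open>
  With \<open>\<phi> (a + s u) = \<phi> a + s H(s,u)\<close> from Hadamard's lemma, the lift is \<open>(s,u) \<mapsto> (s |H|, H / |H|)\<close>. Here \<open>H\<close> has no zero:
  for \<open>s > 0\<close> because \<open>\<phi>\<close> is injective, for \<open>s = 0\<close> because \<open>H(0,u)\<close> is the derivative of \<open>\<phi>\<close> at \<open>a\<close> applied to \<open>u\<close>.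
\<close>

lemma polar_lift:
  fixes \<phi> :: "'a::euclidean_space \<Rightarrow> 'a"
  assumes \<phi>: "Cinf_on (ball a e) \<phi>" and e: "e > 0" and inj: "inj_on \<phi> (ball a e)"
    and dinj: "inj (frechet_derivative \<phi> (at a))"
  obtains \<Phi> where "smooth_on (polar_cyl e) \<Phi>"
    "\<And>p. p \<in> polar_cyl e \<Longrightarrow> norm (snd (\<Phi> p)) = 1"
    "\<And>p. p \<in> polar_cyl e \<Longrightarrow> fst (\<Phi> p) = norm (\<phi> (bl a p) - \<phi> a)"
    "\<And>p. p \<in> polar_cyl e \<Longrightarrow> bl (\<phi> a) (\<Phi> p) = \<phi> (bl a p)"
proof -
  obtain M where M: "\<forall>b. Cinf_on (ball 0 e) (M b)"
    "\<forall>x\<in>ball 0 e. \<phi> (a + x) = \<phi> a + (\<Sum>b\<in>Basis. (x \<bullet> b) *\<^sub>R M b x)"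
    "\<forall>b. M b 0 = frechet_derivative \<phi> (at a) b"
    using hadamard[OF \<phi>] by (elim exE conjE) (rule that)
  define O1 where "O1 = {p :: real \<times> 'a. norm (fst p *\<^sub>R snd p) < e}"
  define H where "H = (\<lambda>p. \<Sum>b\<in>Basis. (snd p \<bullet> b) *\<^sub>R M b (fst p *\<^sub>R snd p))"
  define \<Phi> where "\<Phi> = (\<lambda>p. (fst p * norm (H p), H p /\<^sub>R norm (H p)))"
  have O1: "open O1"
    unfolding O1_def by (intro open_Collect_less continuous_intros)
  have "Cinf_on O1 (\<lambda>p. M b (fst p *\<^sub>R snd p))" for b
    by (rule Cinf_on_compose[OF O1 open_ball _ _ M(1)[rule_format]])
      (auto simp: O1_def[symmetric] intro!: Cinf_on_intros O1, auto simp: O1_def)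
  then have H: "Cinf_on O1 H"
    unfolding H_def by (intro Cinf_on_intros O1)
  define O2 where "O2 = O1 \<inter> H -` (- {0})"
  have O2: "open O2"
    unfolding O2_def
    by (rule continuous_open_preimage[OF Cinf_on_continuous[OF H] O1]) (simp add: open_Compl)
  have Hnz: "H p \<noteq> 0" if "p \<in> O2" for p using that by (simp add: O2_def)
  have HO2: "Cinf_on O2 H" by (rule Cinf_on_subset[OF H]) (auto simp: O2_def)
  have "Cinf_on O2 \<Phi>"
    unfolding \<Phi>_def by (intro Cinf_on_intros O2 HO2) (simp_all add: Hnz)
  have sub: "polar_cyl e \<subseteq> O1" by (auto simp: polar_cyl_def O1_def)
  have lift: "fst p *\<^sub>R H p = \<phi> (bl a p) - \<phi> a" if p: "p \<in> polar_cyl e" for p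
  proof -
    have "fst p *\<^sub>R snd p \<in> ball 0 e" using p by (auto simp: polar_cyl_def)
    from M(2)[rule_format, OF this] show ?thesis
      by (simp add: H_def scaleR_sum_right bl_def case_prod_beta add.commute mult.assoc)
  qed
  have lin: "linear (frechet_derivative \<phi> (at a))"
    using Cinf_on_has_derivative[OF \<phi>, of a] e has_derivative_linear by auto
  have nz: "H p \<noteq> 0" if p: "p \<in> polar_cyl e" for p
  proof (cases "fst p = 0")
    case True
    have "H p = frechet_derivative \<phi> (at a) (snd p)"
      unfolding H_def True using M(3) linear_basis_expansion[OF lin, of "snd p"] by simp
    moreover have "snd p \<noteq> 0" using p by (auto simp: polar_cyl_def)
    ultimately show ?thesis
      using dinj linear_0[OF lin] by (metis injD)
  next
    case False
    have "bl a p \<in> ball a e" "bl a p \<noteq> a"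
      using p False by (auto simp: polar_cyl_def bl_def dist_norm)
    then have "\<phi> (bl a p) \<noteq> \<phi> a" using inj_onD[OF inj, of "bl a p" a] e by auto
    then show ?thesis using lift[OF p] by auto
  qed
  show ?thesis
  proof
    show "smooth_on (polar_cyl e) \<Phi>"
      by (rule smooth_onI[OF O2 _ \<open>Cinf_on O2 \<Phi>\<close>]) (use sub nz in \<open>auto simp: O2_def\<close>)
    fix p :: "real \<times> 'a" assume p: "p \<in> polar_cyl e"
    have p0: "0 \<le> fst p" using p by (auto simp: polar_cyl_def)
    show "norm (snd (\<Phi> p)) = 1" using nz[OF p] by (simp add: \<Phi>_def)
    show "fst (\<Phi> p) = norm (\<phi> (bl a p) - \<phi> a)"
      using p0 by (simp add: \<Phi>_def lift[OF p, symmetric])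
    have "bl (\<phi> a) (\<Phi> p) = fst p *\<^sub>R H p + \<phi> a"
      using nz[OF p] by (simp add: bl_def \<Phi>_def)
    then show "bl (\<phi> a) (\<Phi> p) = \<phi> (bl a p)" using lift[OF p] by simp
  qed
qed

text \<open>
  Where the radius is positive, polar coordinates are injective and the claim is that \<open>\<psi> \<circ> \<phi>\<close> is the identity. The end
  of the cylinder is reached by continuity.
\<close>

lemma polar_lift_inverse:
  fixes \<phi> \<psi> :: "'a::euclidean_space \<Rightarrow> 'a"
  assumes \<Phi>: "continuous_on (polar_cyl e) \<Phi>" "\<And>p. p \<in> polar_cyl e \<Longrightarrow> norm (snd (\<Phi> p)) = 1"
    "\<And>p. p \<in> polar_cyl e \<Longrightarrow> fst (\<Phi> p) = norm (\<phi> (bl a p) - \<phi> a)"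
    "\<And>p. p \<in> polar_cyl e \<Longrightarrow> bl (\<phi> a) (\<Phi> p) = \<phi> (bl a p)"
    and \<Psi>: "continuous_on (polar_cyl e') \<Psi>" "\<And>p. p \<in> polar_cyl e' \<Longrightarrow> norm (snd (\<Psi> p)) = 1"
    "\<And>p. p \<in> polar_cyl e' \<Longrightarrow> fst (\<Psi> p) = norm (\<psi> (bl (\<phi> a) p) - \<psi> (\<phi> a))"
    "\<And>p. p \<in> polar_cyl e' \<Longrightarrow> bl (\<psi> (\<phi> a)) (\<Psi> p) = \<psi> (bl (\<phi> a) p)"
    and inv: "\<And>x. x \<in> ball a e \<Longrightarrow> \<psi> (\<phi> x) = x"
    and p: "p \<in> polar_cyl e" "\<Phi> p \<in> polar_cyl e'"
  shows "\<Psi> (\<Phi> p) = p"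
proof -
  have bl: "bl a q \<in> ball a e" if "q \<in> polar_cyl e" for q
    using that by (auto simp: polar_cyl_def bl_def dist_norm)
  have "e > 0" using p(1) by (auto simp: polar_cyl_def)
  then have \<psi>a: "\<psi> (\<phi> a) = a" using inv by simp
  have pos: "\<Psi> (\<Phi> q) = q" if q: "q \<in> polar_cyl e" "\<Phi> q \<in> polar_cyl e'" "0 < fst q" for q
  proof -
    have b: "bl a (\<Psi> (\<Phi> q)) = bl a q"
      using \<Psi>(4)[OF q(2)] \<Phi>(4)[OF q(1)] inv[OF bl[OF q(1)]] \<psi>a by simp
    have n: "norm (snd q) = 1" using q by (auto simp: polar_cyl_def)
    have "bl a q \<noteq> a" using q(3) n by (auto simp: bl_def case_prod_beta)
    moreover have "fst (\<Psi> (\<Phi> q)) = norm (bl a q - a)"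
      using \<Psi>(3)[OF q(2)] \<Phi>(4)[OF q(1)] inv[OF bl[OF q(1)]] \<psi>a by simp
    ultimately have "0 < fst (\<Psi> (\<Phi> q))" by simp
    then show ?thesis by (rule bl_inject_pos[OF \<Psi>(2)[OF q(2)] n _ q(3) b])
  qed
  show ?thesis
  proof (cases "fst p = 0")
    case False
    then show ?thesis using pos[OF p] p(1) by (auto simp: polar_cyl_def)
  next
    case True
    \<comment> \<open>Approach \<open>p\<close> along its own ray, where the first case applies.\<close>
    define P where "P = (\<lambda>n. (e / 2 * inverse (real (Suc n)), snd p))"
    have "inverse (real (Suc n)) \<le> 1" for n by (simp add: field_simps)
    then have "e / 2 * inverse (real (Suc n)) < e" for n
      using \<open>e > 0\<close> mult_left_mono[of "inverse (real (Suc n))" 1 "e / 2"] by fastforce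
    then have P: "P n \<in> polar_cyl e" "0 < fst (P n)" for n
      using p(1) \<open>e > 0\<close> by (auto simp: P_def polar_cyl_def)
    have "P \<longlonglongrightarrow> (e / 2 * 0, snd p)"
      unfolding P_def by (intro tendsto_intros LIMSEQ_inverse_real_of_nat)
    moreover have "(e / 2 * 0, snd p) = p" using True by (simp add: prod_eq_iff)
    ultimately have Plim: "P \<longlonglongrightarrow> p" by simp
    have lim: "(\<lambda>n. \<Phi> (P n)) \<longlonglongrightarrow> \<Phi> p"
      by (rule continuous_on_tendsto_compose[OF \<Phi>(1) Plim p(1)]) (use P in simp)
    have "fst (\<Phi> p) < e'" using p(2) by (auto simp: polar_cyl_def)
    then have "\<forall>\<^sub>F n in sequentially. fst (\<Phi> (P n)) < e'"
      using order_tendstoD(2)[OF tendsto_fst[OF lim]] by blast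
    then have ev: "\<forall>\<^sub>F n in sequentially. \<Phi> (P n) \<in> polar_cyl e'"
    proof (rule eventually_mono)
      fix n assume "fst (\<Phi> (P n)) < e'"
      then show "\<Phi> (P n) \<in> polar_cyl e'"
        using \<Phi>(2,3)[OF P(1)] by (auto simp: polar_cyl_def mem_Times_iff)
    qed
    have "(\<lambda>n. \<Psi> (\<Phi> (P n))) \<longlonglongrightarrow> \<Psi> (\<Phi> p)"
      by (rule continuous_on_tendsto_compose[OF \<Psi>(1) lim p(2) ev])
    moreover have "\<forall>\<^sub>F n in sequentially. \<Psi> (\<Phi> (P n)) = P n"
      using ev by (rule eventually_mono) (rule pos[OF P(1) _ P(2)])
    ultimately have "P \<longlonglongrightarrow> \<Psi> (\<Phi> p)" by (rule Lim_transform_eventually)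
    then show ?thesis using Plim LIMSEQ_unique by blast
  qed
qed

lemma diffeo_open_Cinf:
  assumes "diffeo A B \<phi> \<psi>" "open A" "open B"
  shows "Cinf_on A \<phi>" "Cinf_on B \<psi>"
  using assms smooth_on_openD by (auto simp: diffeo_def)

lemma diffeo_open_derivative_inj:
  fixes \<phi> :: "'a::euclidean_space \<Rightarrow> 'b::euclidean_space"
  assumes d: "diffeo A B \<phi> \<psi>" and A: "open A" "open B" and a: "a \<in> A"
  shows "inj (frechet_derivative \<phi> (at a))"
proof -
  have f: "(\<phi> has_derivative frechet_derivative \<phi> (at a)) (at a)"
    by (rule Cinf_on_has_derivative[OF diffeo_open_Cinf(1)[OF d A] a])
  have g: "(\<psi> has_derivative frechet_derivative \<psi> (at (\<phi> a))) (at (\<phi> a))"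
    by (rule Cinf_on_has_derivative[OF diffeo_open_Cinf(2)[OF d A] diffeo_inv(2)[OF d a]])
  have "((\<lambda>x. \<psi> (\<phi> x)) has_derivative
      (\<lambda>v. frechet_derivative \<psi> (at (\<phi> a)) (frechet_derivative \<phi> (at a) v))) (at a)"
    by (rule has_derivative_compose[OF f g])
  moreover have "((\<lambda>x. \<psi> (\<phi> x)) has_derivative (\<lambda>v. v)) (at a)"
    by (rule has_derivative_transform_within_open[OF has_derivative_ident A(1) a])
      (use diffeo_inv(1)[OF d] in simp)
  ultimately have "(\<lambda>v. frechet_derivative \<psi> (at (\<phi> a)) (frechet_derivative \<phi> (at a) v)) = (\<lambda>v. v)"
    by (rule has_derivative_unique)
  then show ?thesis by (metis injI)
qed

lemma polar_lift_diffeo: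
  fixes \<phi> :: "'a::euclidean_space \<Rightarrow> 'a"
  assumes d: "diffeo A B \<phi> \<psi>" and A: "open A" "open B" and e: "e > 0" "ball a e \<subseteq> A"
  obtains \<Phi> where "smooth_on (polar_cyl e) \<Phi>"
    "\<And>p. p \<in> polar_cyl e \<Longrightarrow> norm (snd (\<Phi> p)) = 1"
    "\<And>p. p \<in> polar_cyl e \<Longrightarrow> fst (\<Phi> p) = norm (\<phi> (bl a p) - \<phi> a)"
    "\<And>p. p \<in> polar_cyl e \<Longrightarrow> bl (\<phi> a) (\<Phi> p) = \<phi> (bl a p)"
proof (rule polar_lift[of a e \<phi>])
  have a: "a \<in> A" using e by auto
  show "Cinf_on (ball a e) \<phi>" by (rule Cinf_on_subset[OF diffeo_open_Cinf(1)[OF d A] e(2)])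
  show "inj_on \<phi> (ball a e)"
    by (rule inj_on_subset[OF diffeo_inj_on[OF d] e(2)])
  show "inj (frechet_derivative \<phi> (at a))" by (rule diffeo_open_derivative_inj[OF d A a])
qed (use e that in auto)

lemma mem_closure_Int_open:
  assumes "open C" "x \<in> C"
  shows "x \<in> closure S \<longleftrightarrow> x \<in> closure (S \<inter> C)"
  using assms open_Int_closure_subset[of C S] closure_mono[of "S \<inter> C" S]
  by (auto simp: Int_commute)

lemma locally_closed_at_diffeo:
  assumes d: "diffeo A B \<phi> \<psi>" and A: "open A" "open B" and a: "a \<in> A"
    and XY: "Y \<inter> B = \<phi> ` (X \<inter> A)"
  shows "a \<in> closure X \<longleftrightarrow> \<phi> a \<in> closure Y"
    "locally_closed_at Y (\<phi> a) \<Longrightarrow> locally_closed_at X a"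
proof -
  have hom: "homeomorphism A B \<phi> \<psi>" by (rule diffeo_homeomorphism[OF d])
  note loc = mem_closure_Int_open
  have inj: "inj_on \<phi> A" by (rule diffeo_inj_on[OF d])
  have "a \<in> closure X \<longleftrightarrow> a \<in> A \<inter> closure (X \<inter> A)" using loc[OF A(1) a, of X] a by blast
  also have "\<dots> \<longleftrightarrow> \<phi> a \<in> \<phi> ` (A \<inter> closure (X \<inter> A))"
    using inj_on_image_mem_iff[OF inj, of a] a by blast
  also have "\<dots> \<longleftrightarrow> \<phi> a \<in> B \<inter> closure (Y \<inter> B)"
    using homeomorphism_closure_image[OF hom, of "X \<inter> A"] by (simp add: XY)
  also have "\<dots> \<longleftrightarrow> \<phi> a \<in> closure Y" using loc[OF A(2) diffeo_inv(2)[OF d a], of Y] diffeo_inv(2)[OF d a] by blast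
  finally show "a \<in> closure X \<longleftrightarrow> \<phi> a \<in> closure Y" .
  assume "locally_closed_at Y (\<phi> a)"
  then obtain V where V: "open V" "\<phi> a \<in> V" "closedin (top_of_set V) (Y \<inter> V)"
    unfolding locally_closed_at_def by blast
  obtain C where C: "closed C" "Y \<inter> V = V \<inter> C" using V(3) by (auto simp: closedin_closed)
  have cont: "continuous_on A \<phi>" using hom by (simp add: homeomorphism_def)
  define W where "W = A \<inter> \<phi> -` V"
  have W: "open W" unfolding W_def by (rule continuous_open_preimage[OF cont A(1) V(1)])
  have "x \<in> X \<longleftrightarrow> \<phi> x \<in> C" if x: "x \<in> W" for x
  proof -
    have "\<phi> x \<in> B" "\<phi> x \<in> V" "x \<in> A" using x diffeo_inv(2)[OF d] by (auto simp: W_def)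
    moreover have "\<phi> x \<in> \<phi> ` (X \<inter> A) \<longleftrightarrow> x \<in> X"
      using inj_on_image_mem_iff[OF inj \<open>x \<in> A\<close>, of "X \<inter> A"] \<open>x \<in> A\<close> by blast
    ultimately show ?thesis using XY C(2) by blast
  qed
  then have "X \<inter> W = W \<inter> \<phi> -` C" by blast
  moreover have "closedin (top_of_set W) (W \<inter> \<phi> -` C)"
    using continuous_closedin_preimage[OF continuous_on_subset[OF cont] C(1), of W] by (auto simp: W_def)
  ultimately show "locally_closed_at X a"
    unfolding locally_closed_at_def using W a V(2) by (intro exI[of _ W]) (simp add: W_def)
qed

text \<open>
  A cylinder of small radius \<open>r\<close> at \<open>a\<close> is diffeomorphic, by the lift, to a set \<open>Q\<close> that is open in a cylinder at \<open>\<phi> a\<close> and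
  contains its end. The diffeomorphism matches the points lying over \<open>X\<close> and \<open>Y\<close>, hence also their closures.
\<close>

proposition conic_point_diffeo:
  fixes \<phi> :: "'a::euclidean_space \<Rightarrow> 'a"
  assumes d: "diffeo A B \<phi> \<psi>" and A: "open A" "open B" and a: "a \<in> A"
    and XY: "Y \<inter> B = \<phi> ` (X \<inter> A)" and conic: "conic_point Y (\<phi> a)"
  shows "conic_point X a"
proof -
  define b where "b = \<phi> a"
  have b: "b \<in> B" "\<psi> b = a" using diffeo_inv[OF d a] by (auto simp: b_def)
  have inj: "inj_on \<phi> A" by (rule diffeo_inj_on[OF d])
  have d': "diffeo B A \<psi> \<phi>" by (rule diffeo_sym[OF d])
  obtain e where e: "e > 0" "ball a e \<subseteq> A" using A(1) a openE by blast
  obtain e' where e': "e' > 0" "ball b e' \<subseteq> B" using A(2) b openE by blast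
  obtain \<Phi> where \<Phi>: "smooth_on (polar_cyl e) \<Phi>"
    "\<And>p. p \<in> polar_cyl e \<Longrightarrow> norm (snd (\<Phi> p)) = 1"
    "\<And>p. p \<in> polar_cyl e \<Longrightarrow> fst (\<Phi> p) = norm (\<phi> (bl a p) - \<phi> a)"
    "\<And>p. p \<in> polar_cyl e \<Longrightarrow> bl (\<phi> a) (\<Phi> p) = \<phi> (bl a p)"
    using polar_lift_diffeo[OF d A e] by blast
  obtain \<Psi> where \<Psi>: "smooth_on (polar_cyl e') \<Psi>"
    "\<And>p. p \<in> polar_cyl e' \<Longrightarrow> norm (snd (\<Psi> p)) = 1"
    "\<And>p. p \<in> polar_cyl e' \<Longrightarrow> fst (\<Psi> p) = norm (\<psi> (bl b p) - \<psi> b)"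
    "\<And>p. p \<in> polar_cyl e' \<Longrightarrow> bl (\<psi> b) (\<Psi> p) = \<psi> (bl b p)"
    using polar_lift_diffeo[OF d' A(2,1) e'] by blast
  have \<Psi>\<Phi>: "\<Psi> (\<Phi> p) = p" if "p \<in> polar_cyl e" "\<Phi> p \<in> polar_cyl e'" for p
    by (rule polar_lift_inverse[OF smooth_on_continuous[OF \<Phi>(1)] \<Phi>(2-4)
          smooth_on_continuous[OF \<Psi>(1)] \<Psi>(2-4)[unfolded b_def] _ that])
      (use e(2) diffeo_inv(1)[OF d] in auto)
  have \<Phi>\<Psi>: "\<Phi> (\<Psi> p) = p" if "p \<in> polar_cyl e'" "\<Psi> p \<in> polar_cyl e" for p
    by (rule polar_lift_inverse[OF smooth_on_continuous[OF \<Psi>(1)] \<Psi>(2-4)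
          smooth_on_continuous[OF \<Phi>(1)] \<Phi>(2-4)[folded b(2)] _ that])
      (use e'(2) diffeo_inv(1)[OF d'] in auto)
  obtain r' where r': "r' > 0"
    "p_submanifold (polar_cyl r') (polar_cyl r' \<inter> closure (polar_trace b Y r'))"
    using conic unfolding conic_point_iff b_def by blast
  define r'' where "r'' = min r' e'"
  have r'': "r'' > 0" using r' e' by (simp add: r''_def)
  have "continuous_on (ball a e) \<phi>"
    using Cinf_on_continuous[OF Cinf_on_subset[OF diffeo_open_Cinf(1)[OF d A] e(2)]] .
  then have "isCont \<phi> a" using e(1) by (simp add: continuous_on_eq_continuous_at)
  then obtain r0 where r0: "r0 > 0" "\<And>x. dist x a < r0 \<Longrightarrow> dist (\<phi> x) b < r''"
    using r'' unfolding continuous_at_eps_delta b_def by blast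
  define r where "r = min r0 e"
  have r: "r > 0" "r \<le> e" using r0 e by (auto simp: r_def)
  have blr: "dist (bl a p) a < r" if "p \<in> polar_cyl r" for p
    using that by (auto simp: polar_cyl_def bl_def dist_norm)
  have re: "p \<in> polar_cyl e" if "p \<in> polar_cyl r" for p
    using that r by (auto simp: polar_cyl_def)
  define Q where "Q = {q \<in> polar_cyl r''. fst (\<Psi> q) < r}"
  have Q: "q \<in> polar_cyl e'" "q \<in> polar_cyl r'" "\<Psi> q \<in> polar_cyl r" "\<Phi> (\<Psi> q) = q" if "q \<in> Q" for q
  proof -
    show q: "q \<in> polar_cyl e'" "q \<in> polar_cyl r'" using that by (auto simp: Q_def polar_cyl_def r''_def)
    show "\<Psi> q \<in> polar_cyl r"
      using \<Psi>(2,3)[OF q(1)] that by (auto simp: Q_def polar_cyl_def mem_Times_iff)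
    then show "\<Phi> (\<Psi> q) = q" using \<Phi>\<Psi>[OF q(1)] re by blast
  qed
  have P: "\<Phi> p \<in> Q" "\<Psi> (\<Phi> p) = p" if p: "p \<in> polar_cyl r" for p
  proof -
    have "norm (\<phi> (bl a p) - \<phi> a) < r''"
      using r0(2)[of "bl a p"] blr[OF p] by (simp add: r_def dist_norm b_def)
    then have 1: "\<Phi> p \<in> polar_cyl r''"
      using \<Phi>(2,3)[OF re[OF p]] by (simp add: polar_cyl_def mem_Times_iff)
    then have "\<Phi> p \<in> polar_cyl e'" by (auto simp: polar_cyl_def r''_def)
    then show 2: "\<Psi> (\<Phi> p) = p" using \<Psi>\<Phi>[OF re[OF p]] by blast
    show "\<Phi> p \<in> Q" using 1 2 p by (auto simp: Q_def polar_cyl_def)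
  qed
  have Qim: "\<Psi> ` Q = polar_cyl r"
  proof
    show "\<Psi> ` Q \<subseteq> polar_cyl r" using Q(3) by blast
    show "polar_cyl r \<subseteq> \<Psi> ` Q"
    proof
      fix p :: "real \<times> 'a" assume "p \<in> polar_cyl r"
      then show "p \<in> \<Psi> ` Q" using P[of p] by (metis imageI)
    qed
  qed
  have dQ: "diffeo Q (polar_cyl r) \<Psi> \<Phi>"
    unfolding diffeo_def
    using Qim Q smooth_on_subset[OF \<Psi>(1), of Q] smooth_on_subset[OF \<Phi>(1), of "polar_cyl r"] re
    by blast
  obtain V where V: "open V" "Q = polar_cyl r' \<inter> V"
  proof -
    have "polar_cyl r'' \<subseteq> (polar_cyl e' :: (real \<times> 'a) set)" by (auto simp: polar_cyl_def r''_def)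
    then have "continuous_on (polar_cyl r'') (\<lambda>q. fst (\<Psi> q))"
      using continuous_on_subset[OF smooth_on_continuous[OF \<Psi>(1)]] by (intro continuous_on_fst) blast
    then have "openin (top_of_set (polar_cyl r'')) (polar_cyl r'' \<inter> (\<lambda>q. fst (\<Psi> q)) -` {..<r})"
      by (rule continuous_openin_preimage_gen) simp
    then obtain V' where V': "open V'" "polar_cyl r'' \<inter> (\<lambda>q. fst (\<Psi> q)) -` {..<r} = polar_cyl r'' \<inter> V'"
      by (auto simp: openin_open)
    have "polar_cyl r'' = polar_cyl r' \<inter> ({..<r''} \<times> (UNIV :: 'a set))"
      by (auto simp: polar_cyl_def r''_def)
    then have "Q = polar_cyl r' \<inter> (({..<r''} \<times> UNIV) \<inter> V')"
      using V'(2) by (auto simp: Q_def)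
    then show ?thesis by (rule that[rotated]) (simp add: V'(1) open_Int open_Times)
  qed
  define T where "T = polar_trace b Y r'"
  have TQ: "Q \<inter> closure T = Q \<inter> closure (T \<inter> Q)"
  proof -
    have "T \<inter> Q = V \<inter> T" using V(2) by (auto simp: T_def polar_trace_def)
    then have "V \<inter> closure T \<subseteq> closure (T \<inter> Q)" using open_Int_closure_subset[OF V(1), of T] by simp
    moreover have "closure (T \<inter> Q) \<subseteq> closure T" by (rule closure_mono) blast
    ultimately show ?thesis using V(2) by blast
  qed
  have "\<Psi> ` (T \<inter> Q) = polar_trace a X r"
  proof -
    have "\<Psi> q \<in> polar_trace a X r \<longleftrightarrow> q \<in> T" if q: "q \<in> Q" for q
    proof -
      let ?p = "\<Psi> q"
      have p: "?p \<in> polar_cyl r" "?p \<in> polar_cyl e" using Q(3)[OF q] re[OF Q(3)[OF q]] by simp_all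
      have n: "norm (snd ?p) = 1" "norm (snd q) = 1" using p Q(1)[OF q] by (auto simp: polar_cyl_def)
      have blA: "bl a ?p \<in> A" using blr[OF p(1)] r e by (auto simp: subset_iff dist_commute)
      have \<phi>b: "\<phi> (bl a ?p) = bl b q"
        using \<Phi>(4)[OF p(2)] Q(4)[OF q] by (simp add: b_def)
      have pos: "0 < fst ?p \<longleftrightarrow> bl a ?p \<noteq> a" and posq: "0 < fst q \<longleftrightarrow> bl b q \<noteq> b"
        using p(1) Q(1)[OF q] by (auto simp: polar_cyl_def bl_def case_prod_beta)
      have "bl b q \<noteq> b \<longleftrightarrow> bl a ?p \<noteq> a"
        using \<phi>b diffeo_inv(1)[OF d blA] diffeo_inv(1)[OF d a] by (metis b_def)
      moreover have "bl b q \<in> Y \<longleftrightarrow> bl a ?p \<in> X"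
      proof -
        have "bl b q \<in> Y \<longleftrightarrow> \<phi> (bl a ?p) \<in> \<phi> ` (X \<inter> A)"
          using XY \<phi>b diffeo_inv(2)[OF d blA] by auto
        also have "\<dots> \<longleftrightarrow> bl a ?p \<in> X"
          using inj_on_image_mem_iff[OF inj blA, of "X \<inter> A"] blA by blast
        finally show ?thesis .
      qed
      ultimately show ?thesis
        using p(1) Q(2)[OF q] pos posq by (simp add: T_def polar_trace_def)
    qed
    moreover have "polar_trace a X r \<subseteq> \<Psi> ` Q" unfolding Qim by (auto simp: polar_trace_def)
    ultimately show ?thesis by blast
  qed
  then have im: "\<Psi> ` (Q \<inter> closure T) = polar_cyl r \<inter> closure (polar_trace a X r)"
    unfolding TQ using homeomorphism_closure_image[OF diffeo_homeomorphism[OF dQ], of "T \<inter> Q"] by simp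
  have "p_submanifold (polar_cyl r' \<inter> V) (polar_cyl r' \<inter> closure T \<inter> V)"
    using p_submanifold_restrict[OF V(1) r'(2)] by (simp add: T_def)
  moreover have "polar_cyl r' \<inter> closure T \<inter> V = Q \<inter> closure T" using V(2) by blast
  ultimately have "p_submanifold Q (Q \<inter> closure T)" using V(2) by simp
  from p_submanifold_transfer[OF dQ this]
  have "p_submanifold (polar_cyl r) (polar_cyl r \<inter> closure (polar_trace a X r))" by (simp add: im)
  moreover have "a \<in> closure X" "locally_closed_at X a"
    using locally_closed_at_diffeo[OF d A a XY] conic by (auto simp: conic_point_iff)
  ultimately show ?thesis unfolding conic_point_iff using r(1) by blast
qed


section \<open>Regular points are conic\<close>

text \<open>
  The tangent space at \<open>v\<close> of the unit sphere of \<open>L\<close>.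
\<close>

definition perp_in :: "'a::euclidean_space set \<Rightarrow> 'a \<Rightarrow> 'a set" where
  "perp_in L v = {x \<in> L. x \<bullet> v = 0}"

lemma image_eq_inverse:
  assumes "\<And>x. x \<in> A \<Longrightarrow> f x \<in> B" "\<And>y. y \<in> B \<Longrightarrow> g y \<in> A" "\<And>y. y \<in> B \<Longrightarrow> f (g y) = y"
  shows "f ` A = B"
proof
  show "B \<subseteq> f ` A"
  proof
    fix y assume "y \<in> B"
    then show "y \<in> f ` A" using imageI[OF assms(2), of y f] assms(3) by simp
  qed
qed (use assms(1) in blast)

lemma model_at_mf_boundary_iff:
  assumes "model_at N x b D"
  shows "x \<in> mf_boundary N \<longleftrightarrow> b"
proof
  assume "x \<in> mf_boundary N"
  then obtain D' where "model_at N x True D'" by (auto simp: mf_boundary_iff_model_at)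
  from model_at_unique(1)[OF assms this] show b by simp
next
  assume b
  then show "x \<in> mf_boundary N" unfolding mf_boundary_iff_model_at using assms by auto
qed

text \<open>
  Near \<open>v\<close> the unit sphere of \<open>L\<close> is parametrised by central projection \<open>y \<mapsto> (v + y) / |v + y|\<close> from its tangent space. Taking
  \<open>A = UNIV\<close>, \<open>\<omega> = 1\<close> gives the half-open cylinder, and \<open>A = {0}\<close>, \<open>\<omega> = 0\<close> gives its end.
\<close>

lemma model_at_cylinder:
  fixes v :: "'a::euclidean_space" and A :: "real set"
  assumes A: "subspace A" "\<omega> \<in> A" and L: "subspace L" and v: "v \<in> L" "norm v = 1"
    and s: "s \<in> A" "0 \<le> s * \<omega>" "s < r"
  shows "model_at ({a \<in> A. 0 \<le> a * \<omega> \<and> a < r} \<times> (sphere 0 1 \<inter> L)) (s, v)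
    (\<omega> \<noteq> 0 \<and> s = 0) (A \<times> perp_in L v)"
proof -
  define N where "N = {a \<in> A. 0 \<le> a * \<omega> \<and> a < r} \<times> (sphere 0 1 \<inter> L)"
  define L' where "L' = A \<times> perp_in L v"
  define w :: "real \<times> 'a" where "w = (\<omega>, 0)"
  define U :: "(real \<times> 'a) set" where "U = {..<r} \<times> {y. - 1 < y \<bullet> v}"
  define g where "g = (\<lambda>p :: real \<times> 'a. (fst p, (v + snd p) /\<^sub>R norm (v + snd p)))"
  define h where "h = (\<lambda>p :: real \<times> 'a. (fst p, snd p /\<^sub>R (snd p \<bullet> v) - v))"
  define V where "V = (UNIV :: real set) \<times> {z. 0 < z \<bullet> v}"
  have vv: "v \<bullet> v = 1" using v(2) by (simp add: norm_eq_1)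
  have "subspace (perp_in L v)"
    using L by (auto simp: perp_in_def subspace_def inner_add_left)
  then have L': "subspace L'" unfolding L'_def using A(1) by (simp add: subspace_Times)
  have w: "w \<in> L'" using A L by (simp add: w_def L'_def perp_in_def subspace_0)
  have U: "open U"
    unfolding U_def by (intro open_Times open_Collect_less continuous_intros open_lessThan)
  have V: "open V"
    unfolding V_def by (intro open_Times open_Collect_less continuous_intros open_UNIV)
  have nz: "v + snd p \<noteq> 0" if "p \<in> U" for p
  proof
    assume "v + snd p = 0"
    then have "(v + snd p) \<bullet> v = 0" by simp
    then show False using that vv by (auto simp: U_def inner_add_left)
  qed
  have g: "Cinf_on U g"
    unfolding g_def by (intro Cinf_on_intros U) (simp_all add: nz)
  have h: "Cinf_on V h"
    unfolding h_def by (intro Cinf_on_intros V) (auto simp: V_def)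
  have H: "U \<inter> half_space L' w = {a \<in> A. 0 \<le> a * \<omega> \<and> a < r} \<times> perp_in L v"
    by (auto simp: U_def half_space_def L'_def w_def perp_in_def)
  have gN: "g p \<in> N \<inter> V" and hg: "h (g p) = p" if p: "p \<in> U \<inter> half_space L' w" for p
  proof -
    have pU: "p \<in> U" using p by blast
    have y: "snd p \<in> L" "snd p \<bullet> v = 0" and a: "fst p \<in> A" "0 \<le> fst p * \<omega>" "fst p < r"
      using p unfolding H by (auto simp: perp_in_def)
    have i: "((v + snd p) /\<^sub>R norm (v + snd p)) \<bullet> v = inverse (norm (v + snd p))"
      using vv y(2) by (simp add: inner_add_left)
    have n: "norm (v + snd p) > 0" using nz[OF pU] by simp
    show "g p \<in> N \<inter> V"
      using a y v L nz[OF pU] i n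
      by (auto simp: g_def N_def V_def intro: subspace_scale subspace_add)
    show "h (g p) = p"
      using i n by (simp add: h_def g_def)
  qed
  have hU: "h q \<in> U \<inter> half_space L' w" and gh: "g (h q) = q" if q: "q \<in> N \<inter> V" for q
  proof -
    have z: "norm (snd q) = 1" "snd q \<in> L" "0 < snd q \<bullet> v" and a: "fst q \<in> A" "0 \<le> fst q * \<omega>" "fst q < r"
      using q by (auto simp: N_def V_def)
    show "h q \<in> U \<inter> half_space L' w"
      unfolding H using a z L v vv
      by (auto simp: h_def perp_in_def inner_diff_left intro: subspace_scale subspace_diff)
    show "g (h q) = q"
      using z by (simp add: g_def h_def)
  qed
  have im: "g ` (U \<inter> half_space L' w) = N \<inter> V"
    by (rule image_eq_inverse[where g = h]) (use gN hU gh in blast)+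
  have hom: "homeomorphism (U \<inter> half_space L' w) (g ` (U \<inter> half_space L' w)) g h"
  proof (rule homeomorphismI)
    show "continuous_on (U \<inter> half_space L' w) g"
      by (rule continuous_on_subset[OF Cinf_on_continuous[OF g]]) blast
    show "continuous_on (g ` (U \<inter> half_space L' w)) h"
      unfolding im by (rule continuous_on_subset[OF Cinf_on_continuous[OF h]]) blast
  qed (use hg hU gh im in auto)
  have inj: "inj_on (frechet_derivative g (at p)) L'" if p: "p \<in> U \<inter> half_space L' w" for p
  proof -
    have pU: "p \<in> U" and gV: "g p \<in> V" using p gN[OF p] by blast+
    have d: "((\<lambda>p. h (g p)) has_derivative
        (\<lambda>u. frechet_derivative h (at (g p)) (frechet_derivative g (at p) u))) (at p)"
      by (rule has_derivative_compose[OF Cinf_on_has_derivative[OF g pU] Cinf_on_has_derivative[OF h gV]])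
    have "frechet_derivative h (at (g p)) (frechet_derivative g (at p) l) = l" if "l \<in> L'" for l
      by (rule derivative_eq_on_half_space[OF L' U p d has_derivative_ident hg that])
    then show ?thesis by (rule inj_on_inverseI)
  qed
  have "openin (top_of_set N) (N \<inter> V)" using V by blast
  then have P: "local_param N L' w U g"
    unfolding local_param_def using L' w U g inj hom im by auto
  have y: "(s, 0) \<in> U \<inter> half_space L' w"
    unfolding H using s L by (simp add: perp_in_def subspace_0)
  have "((\<lambda>p. v + snd p) has_derivative snd) (at (s, 0))"
    by (auto intro!: derivative_eq_intros)
  moreover have "(norm has_derivative (\<lambda>h. h \<bullet> v)) (at (v + snd (s, 0)))"
    using has_derivative_norm[of v] v(2) by (force simp: sgn_div_norm)
  ultimately have "((\<lambda>p. norm (v + snd p)) has_derivative (\<lambda>u. snd u \<bullet> v)) (at (s, 0))"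
    by (rule has_derivative_compose)
  then have "(g has_derivative (\<lambda>u. (fst u, snd u - (v \<bullet> snd u) *\<^sub>R v))) (at (s, 0))"
    unfolding g_def using v vv
    by (auto intro!: derivative_eq_intros simp: inner_commute)
  then have "frechet_derivative g (at (s, 0)) = (\<lambda>u. (fst u, snd u - (v \<bullet> snd u) *\<^sub>R v))"
    by (rule frechet_derivative_at[symmetric])
  then have "frechet_derivative g (at (s, 0)) ` L' = (\<lambda>u. u) ` L'"
    by (intro image_cong) (auto simp: L'_def perp_in_def inner_commute)
  then have "L' = frechet_derivative g (at (s, 0)) ` L'" by simp
  moreover have "g (s, 0) = (s, v)" using v by (simp add: g_def)
  moreover have "(\<omega> \<noteq> 0 \<and> s = 0) \<longleftrightarrow> w \<noteq> 0 \<and> (s, 0) \<bullet> w = 0" by (auto simp: w_def zero_prod_def)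
  ultimately show ?thesis
    unfolding model_at_def N_def[symmetric] L'_def[symmetric] using P y by blast
qed

lemma model_at_polar_cyl:
  fixes v :: "'a::euclidean_space" and s r :: real
  assumes L: "subspace L" and v: "v \<in> L" "norm v = 1" and s: "0 \<le> s" "s < r"
  shows "model_at ({0..<r} \<times> (sphere 0 1 \<inter> L)) (s, v) (s = 0) (UNIV \<times> perp_in L v)"
proof -
  have "{a \<in> UNIV. 0 \<le> a * 1 \<and> a < r} = {0..<r}" by auto
  then show ?thesis
    using model_at_cylinder[OF subspace_UNIV UNIV_I L v UNIV_I, of s 1 r] s by simp
qed

text \<open>
  Transversality at the end: the cylinder over the sphere of \<open>L\<close> contributes the radial direction, the end of the large
  cylinder all directions tangent to the sphere.
\<close>

lemma p_submanifold_linear_cylinder: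
  assumes L: "subspace (L :: 'a::euclidean_space set)" and r: "r > 0"
  shows "p_submanifold (polar_cyl r) ({0..<r} \<times> (sphere 0 1 \<inter> L))"
proof -
  define T where "T = {0..<r} \<times> (sphere 0 1 \<inter> L)"
  have T: "model_at T p (fst p = 0) (UNIV \<times> perp_in L (snd p))" if "p \<in> T" for p
    using model_at_polar_cyl[OF L, of "snd p" "fst p" r] that by (auto simp: T_def)
  have P: "model_at (polar_cyl r) p (fst p = 0) (UNIV \<times> perp_in UNIV (snd p))"
    if "p \<in> polar_cyl r" for p :: "real \<times> 'a"
    using model_at_polar_cyl[OF subspace_UNIV, of "snd p" "fst p" r] that by (auto simp: polar_cyl_def)
  have bT: "mf_boundary T = {p \<in> T. fst p = 0}"
    using model_at_mf_boundary_iff[OF T] mf_boundary_subset[of T] by blast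
  have bP: "mf_boundary (polar_cyl r) = {p :: real \<times> 'a. p \<in> polar_cyl r \<and> fst p = 0}"
    using model_at_mf_boundary_iff[OF P] mf_boundary_subset[of "polar_cyl r"] by blast
  have TP: "T \<subseteq> polar_cyl r" by (auto simp: T_def polar_cyl_def)
  have bP': "mf_boundary (polar_cyl r) = {0} \<times> (sphere 0 1 :: 'a set)"
    unfolding bP using r by (auto simp: polar_cyl_def)
  have dP: "model_at (mf_boundary (polar_cyl r)) (0, v) False ({0} \<times> perp_in UNIV v)"
    if "norm v = 1" for v :: 'a
  proof -
    have "{a \<in> {0}. 0 \<le> a * 0 \<and> a < r} = {0 :: real}" using r by auto
    then show ?thesis
      using model_at_cylinder[OF subspace_single_0, of 0 UNIV v 0 r] that r by (simp add: bP')
  qed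
  have "p_submanifold (polar_cyl r) T"
    unfolding p_submanifold_def
  proof (intro conjI ballI)
    show "T \<subseteq> polar_cyl r" by (rule TP)
    show "bd_submanifold T" using T by (auto simp: bd_submanifold_iff_model_at)
    show "mf_boundary T = T \<inter> mf_boundary (polar_cyl r)" using TP by (auto simp: bT bP)
    fix p assume "p \<in> mf_boundary T"
    then have "p \<in> T" "fst p = 0" unfolding bT by blast+
    then have p: "p \<in> T" "p = (0, snd p)" "norm (snd p) = 1" "p \<in> polar_cyl r"
      using TP by (auto simp: T_def prod_eq_iff)
    have 1: "tangent_space T p = UNIV \<times> perp_in L (snd p)"
      by (rule model_at_tangent_space[OF T[OF p(1)]])
    have 2: "tangent_space (polar_cyl r) p = UNIV \<times> perp_in UNIV (snd p)"
      by (rule model_at_tangent_space[OF P[OF p(4)]])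
    have 3: "tangent_space (mf_boundary (polar_cyl r)) p = {0} \<times> perp_in UNIV (snd p)"
      using model_at_tangent_space[OF dP[OF p(3)]] p(2) by simp
    show "{u + v |u v. u \<in> tangent_space T p \<and> v \<in> tangent_space (mf_boundary (polar_cyl r)) p} =
        tangent_space (polar_cyl r) p"
      unfolding 1 2 3
    proof (intro set_eqI iffI)
      fix x :: "real \<times> 'a" assume x: "x \<in> UNIV \<times> perp_in UNIV (snd p)"
      have "x = (fst x, 0) + (0, snd x)" by simp
      moreover have "(fst x, 0) \<in> UNIV \<times> perp_in L (snd p)"
        using L by (simp add: perp_in_def subspace_0)
      moreover have "(0, snd x) \<in> {0} \<times> perp_in UNIV (snd p)" using x by auto
      ultimately show "x \<in> {u + v |u v. u \<in> UNIV \<times> perp_in L (snd p) \<and> v \<in> {0} \<times> perp_in UNIV (snd p)}"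
        by blast
    qed (auto simp: perp_in_def inner_add_left)
  qed
  then show ?thesis by (simp add: T_def)
qed

lemma conic_point_subspace:
  assumes L: "subspace (L :: 'a::euclidean_space set)"
  shows "conic_point (L \<inter> ball 0 1) 0"
proof -
  have tr: "polar_trace 0 (L \<inter> ball 0 1) 1 = {0<..<1} \<times> (sphere 0 1 \<inter> L)"
  proof -
    have "s *\<^sub>R u \<in> L \<longleftrightarrow> u \<in> L" if "s > 0" for s and u :: 'a
    proof
      assume "s *\<^sub>R u \<in> L"
      then have "inverse s *\<^sub>R s *\<^sub>R u \<in> L" by (rule subspace_scale[OF L])
      then show "u \<in> L" using that by simp
    qed (rule subspace_scale[OF L])
    then show ?thesis
      by (auto simp: polar_trace_def polar_cyl_def bl_def)
  qed
  have "polar_cyl 1 \<inter> closure (polar_trace 0 (L \<inter> ball 0 1) 1) = {0..<1} \<times> (sphere 0 1 \<inter> L)"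
    unfolding tr closure_Times
    using closed_subspace[OF L] by (auto simp: polar_cyl_def closure_closed closed_Int)
  then have "p_submanifold (polar_cyl 1) (polar_cyl 1 \<inter> closure (polar_trace 0 (L \<inter> ball 0 1) 1))"
    using p_submanifold_linear_cylinder[OF L, of 1] by simp
  moreover have "0 \<in> closure (L \<inter> ball 0 1)"
    using subspace_0[OF L] closure_subset[of "L \<inter> ball 0 1"] by auto
  moreover have "locally_closed_at (L \<inter> ball 0 1) 0"
    unfolding locally_closed_at_def
    by (intro exI[of _ "ball 0 1"]) (use closed_subspace[OF L] in \<open>auto simp: closedin_closed\<close>)
  ultimately show ?thesis unfolding conic_point_iff by (intro conjI exI[of _ 1]) auto
qed

text \<open>
  The space is the direct sum of the kernel of \<open>E\<close> and of \<open>D ` L\<close>.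
\<close>

lemma dim_kernel_left_inverse:
  fixes D :: "'a::euclidean_space \<Rightarrow> 'b::euclidean_space"
  assumes D: "linear D" and E: "linear E" and L: "subspace L" and ED: "\<And>l. l \<in> L \<Longrightarrow> E (D l) = l"
    and range: "range E \<subseteq> L"
  shows "dim {x. E x = 0} + dim L = DIM('b)"
proof -
  let ?K = "{x. E x = 0}"
  have "subspace ?K" using E by (auto simp: subspace_def linear_add linear_cmul linear_0)
  moreover have "subspace (D ` L)" by (rule linear_subspace_image[OF D L])
  ultimately have "dim {x + y |x y. x \<in> ?K \<and> y \<in> D ` L} + dim (?K \<inter> D ` L) = dim ?K + dim (D ` L)"
    by (rule dim_sums_Int)
  moreover have "{x + y |x y. x \<in> ?K \<and> y \<in> D ` L} = UNIV"
  proof -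
    have "\<exists>x y. z = x + y \<and> x \<in> ?K \<and> y \<in> D ` L" for z
    proof -
      have "E z \<in> L" using range by blast
      then show ?thesis
        using E ED by (intro exI[of _ "z - D (E z)"] exI[of _ "D (E z)"]) (simp add: linear_diff)
    qed
    then show ?thesis by blast
  qed
  moreover have "?K \<inter> D ` L \<subseteq> {0}" using ED linear_0[OF D] by force
  then have "dim (?K \<inter> D ` L) = 0" by (simp only: dim_eq_0)
  moreover have "inj_on D L" using ED by (metis inj_on_inverseI)
  then have "dim (D ` L) = dim L"
    using D by (intro dim_image_eq) (simp_all add: span_eq_iff[THEN iffD2, OF L])
  ultimately show ?thesis by simp
qed

text \<open>
  The map \<open>F x = g (\<pi> x) + q (x - \<pi> x)\<close> extends \<open>g\<close> from \<open>L\<close>, where \<open>\<pi>\<close> projects onto \<open>L\<close> and \<open>q\<close> maps the kernel of \<open>\<pi>\<close>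
  isometrically onto a complement of the image of \<open>L\<close> under the derivative of \<open>g\<close>. Its derivative at \<open>y\<close> is therefore
  injective, and the inverse function theorem applies.
\<close>

lemma immersion_straightening:
  fixes g :: "'a::euclidean_space \<Rightarrow> 'a"
  assumes L: "subspace L" and U: "open U" "y \<in> U \<inter> L" and g: "Cinf_on U g"
    and inj: "inj_on (frechet_derivative g (at y)) L"
  obtains W Z F G where "open W" "open Z" "y \<in> W" "W \<inter> L \<subseteq> U" "diffeo W Z F G"
    "\<And>x. x \<in> L \<Longrightarrow> F x = g x"
proof -
  define D where "D = frechet_derivative g (at y)"
  have gd: "(g has_derivative D) (at y)"
    unfolding D_def by (rule Cinf_on_has_derivative[OF g]) (use U in blast)
  then have D: "linear D" by (rule has_derivative_linear)
  obtain E where E: "range E \<subseteq> L" "linear E" "\<And>l. l \<in> L \<Longrightarrow> E (D l) = l"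
    using linear_exists_left_inverse_on[OF D L] inj unfolding D_def by metis
  obtain \<pi> where \<pi>: "range \<pi> \<subseteq> L" "linear \<pi>" "\<And>l. l \<in> L \<Longrightarrow> \<pi> l = l"
    using linear_exists_left_inverse_on[OF linear_ident L] by auto
  define K where "K = {x. \<pi> x = 0}"
  define K' where "K' = {x. E x = 0}"
  have K: "subspace K" "subspace K'"
    using E(2) \<pi>(2) by (auto simp: K_def K'_def subspace_def linear_add linear_cmul linear_0)
  have "dim K = dim K'"
    using dim_kernel_left_inverse[OF D E(2) L E(3) E(1)] dim_kernel_left_inverse[OF linear_ident \<pi>(2) L \<pi>(3) \<pi>(1)]
    by (simp add: K_def K'_def)
  then obtain q where q: "linear q" "q ` K = K'" "\<And>x. x \<in> K \<Longrightarrow> norm (q x) = norm x"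
    using isometries_subspaces[OF K] by metis
  define F where "F = (\<lambda>x. g (\<pi> x) + q (x - \<pi> x))"
  have bl: "bounded_linear \<pi>" "bounded_linear q" using \<pi> q by (auto simp: linear_conv_bounded_linear)
  define U' where "U' = \<pi> -` U"
  have U': "open U'"
    unfolding U'_def by (rule open_vimage[OF U(1)]) (use bl in \<open>auto intro: linear_continuous_on\<close>)
  have "Cinf_on U' (\<lambda>x. g (\<pi> x))"
    by (rule Cinf_on_compose[OF U' U(1) _ Cinf_on_bounded_linear[OF bl(1) U'] g]) (auto simp: U'_def)
  moreover have "Cinf_on U' (\<lambda>x. q (x - \<pi> x))"
    by (intro Cinf_on_linear_compose[OF bl(2) U'] Cinf_on_intros Cinf_on_bounded_linear bl U')
  ultimately have F: "Cinf_on U' F" unfolding F_def by (rule Cinf_on_add[OF U'])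
  have y: "\<pi> y = y" "y \<in> U'" using U \<pi>(3) by (auto simp: U'_def)
  have "((\<lambda>x. g (\<pi> x)) has_derivative (\<lambda>v. D (\<pi> v))) (at y)"
    by (rule has_derivative_compose[OF bounded_linear_imp_has_derivative[OF bl(1)]]) (use gd y in simp)
  moreover have "((\<lambda>x. q (x - \<pi> x)) has_derivative (\<lambda>v. q (v - \<pi> v))) (at y)"
    by (intro bounded_linear.has_derivative[OF bl(2)] has_derivative_diff has_derivative_ident
        bounded_linear_imp_has_derivative bl)
  ultimately have "(F has_derivative (\<lambda>v. D (\<pi> v) + q (v - \<pi> v))) (at y)"
    unfolding F_def by (rule has_derivative_add)
  then have F': "frechet_derivative F (at y) = (\<lambda>v. D (\<pi> v) + q (v - \<pi> v))"
    by (rule frechet_derivative_at[symmetric])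
  have ker: "v = 0" if v: "D (\<pi> v) + q (v - \<pi> v) = 0" for v
  proof -
    have \<pi>v: "\<pi> v \<in> L" using \<pi>(1) by blast
    have k: "v - \<pi> v \<in> K" using \<pi>(2,3) \<pi>v by (simp add: K_def linear_diff)
    then have "E (q (v - \<pi> v)) = 0" using q(2) by (auto simp: K'_def)
    then have "E (D (\<pi> v) + q (v - \<pi> v)) = \<pi> v" using E(2,3) \<pi>v by (simp add: linear_add)
    then have "\<pi> v = 0" using v E(2) by (simp add: linear_0)
    then show "v = 0" using v q(3)[OF k] linear_0[OF D] by simp
  qed
  have "linear (frechet_derivative F (at y))"
    using Cinf_on_has_derivative[OF F y(2)] has_derivative_linear by blast
  then have "inj (frechet_derivative F (at y)) \<longleftrightarrow> (\<forall>v. frechet_derivative F (at y) v = 0 \<longrightarrow> v = 0)"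
    by (rule linear_injective_0)
  then have inj: "inj (frechet_derivative F (at y))"
    unfolding F' using ker by blast
  obtain W Z G where W: "open W" "W \<subseteq> U'" "y \<in> W" "open Z" "homeomorphism W Z F G" "Cinf_on Z G"
    by (rule smooth_inverse_function[OF U' y(2) F inj])
  have "diffeo W Z F G"
    unfolding diffeo_def
  proof (intro conjI ballI)
    show "smooth_on W F" by (rule smooth_onI[OF U' W(2) F])
    show "smooth_on Z G" by (rule smooth_onI[OF W(4) order_refl W(6)])
  qed (use W(5) in \<open>auto simp: homeomorphism_def\<close>)
  moreover have "F x = g x" if "x \<in> L" for x
    using \<pi>(3)[OF that] linear_0[OF q(1)] by (simp add: F_def)
  moreover have "W \<inter> L \<subseteq> U" using W(2) \<pi>(3) by (auto simp: U'_def)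
  ultimately show ?thesis using that W by blast
qed

lemma diffeo_compose:
  assumes f: "diffeo A B f h" and g: "diffeo B C g k"
  shows "diffeo A C (\<lambda>x. g (f x)) (\<lambda>x. h (k x))"
proof -
  have s: "smooth_on A f" "smooth_on B g" "smooth_on B h" "smooth_on C k" and im: "f ` A = B" "g ` B = C"
    using f g by (simp_all add: diffeo_def)
  have im': "h ` B = A" "k ` C = B"
    using diffeo_sym[OF f] diffeo_sym[OF g] by (simp_all add: diffeo_def)
  have "(\<lambda>x. g (f x)) ` A = C" using im by (metis image_image)
  moreover have "smooth_on A (\<lambda>x. g (f x))" by (rule smooth_on_compose[OF s(1,2)]) (simp add: im)
  moreover have "smooth_on C (\<lambda>x. h (k x))" by (rule smooth_on_compose[OF s(4,3)]) (simp add: im')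
  ultimately show ?thesis
    unfolding diffeo_def using diffeo_inv[OF f] diffeo_inv[OF g] by simp
qed

lemma diffeo_ball_unit:
  fixes c :: "'a::euclidean_space"
  assumes \<rho>: "\<rho> > 0"
  shows "diffeo (ball c \<rho>) (ball 0 1) (\<lambda>x. (x - c) /\<^sub>R \<rho>) (\<lambda>y. c + \<rho> *\<^sub>R y)"
  unfolding diffeo_def
proof (intro conjI ballI)
  show "smooth_on (ball c \<rho>) (\<lambda>x. (x - c) /\<^sub>R \<rho>)"
    by (rule smooth_onI[OF open_ball order_refl]) (intro Cinf_on_intros open_ball)
  show "smooth_on (ball 0 1) (\<lambda>y. c + \<rho> *\<^sub>R y)"
    by (rule smooth_onI[OF open_ball order_refl]) (intro Cinf_on_intros open_ball)
  show "(\<lambda>x. (x - c) /\<^sub>R \<rho>) ` ball c \<rho> = ball 0 1"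
  proof (rule image_eq_inverse[where g = "\<lambda>y. c + \<rho> *\<^sub>R y"])
    fix x assume "x \<in> ball c \<rho>"
    moreover have "norm ((x - c) /\<^sub>R \<rho>) = dist c x / \<rho>"
      using \<rho> by (simp add: dist_norm norm_minus_commute divide_inverse_commute)
    ultimately show "(x - c) /\<^sub>R \<rho> \<in> ball 0 1" using \<rho> by simp
  qed (use \<rho> in \<open>simp_all add: dist_norm\<close>)
qed (use \<rho> in simp)

text \<open>
  In a straightening chart the set becomes a linear subspace, which is conic at 0.
\<close>

proposition conic_point_regular:
  fixes X :: "'a::euclidean_space set"
  assumes a: "a \<in> X" "a \<notin> singular_points UNIV X"
  shows "conic_point X a"
proof -
  obtain N V where N: "submanifold UNIV N" and V: "open V" "a \<in> V" "X \<inter> V = N \<inter> V"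
    using a unfolding singular_points_def by blast
  have "a \<in> N" using a V by blast
  then obtain L w U g y where P: "local_param N L w U g" and y: "y \<in> U \<inter> half_space L w" "g y = a"
    using N unfolding submanifold_def bd_submanifold_def by (metis imageE)
  have "\<not> (w \<noteq> 0 \<and> y \<bullet> w = 0)"
    using N P y unfolding submanifold_def mf_boundary_def by blast
  then have yw: "w = 0 \<or> 0 < y \<bullet> w" using y(1) by (auto simp: half_space_def)
  \<comment> \<open>As \<open>y\<close> is no boundary point, the half-space can be replaced by \<open>L\<close> near \<open>y\<close>.\<close>
  define U1 where "U1 = U \<inter> {z. w = 0 \<or> 0 < z \<bullet> w}"
  have L: "subspace L" and U: "open U" and g: "Cinf_on U g"
    using P by (simp_all add: local_param_def)
  have "open {z. w = 0 \<or> 0 < z \<bullet> w}"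
    by (cases "w = 0") (auto intro!: open_Collect_less continuous_intros)
  then have U1: "open U1" "U1 \<subseteq> U" using U by (auto simp: U1_def)
  have H: "S \<inter> half_space L w = S \<inter> L" if "S \<subseteq> U1" for S
    using that by (auto simp: half_space_def U1_def)
  have y1: "y \<in> U1 \<inter> L" using y yw by (auto simp: U1_def half_space_def)
  have inj: "inj_on (frechet_derivative g (at y)) L"
    using P y(1) by (simp add: local_param_def)
  obtain W Z F G where W: "open W" "open Z" "y \<in> W" "W \<inter> L \<subseteq> U1" and d: "diffeo W Z F G"
    and Fg: "\<And>x. x \<in> L \<Longrightarrow> F x = g x"
    using immersion_straightening[OF L U1(1) y1 Cinf_on_subset[OF g U1(2)] inj] by metis
  have P2: "local_param N L w (U1 \<inter> W) g"
    by (rule local_param_shrink[OF P]) (use U1 W in auto)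
  have im: "g ` (U1 \<inter> W \<inter> half_space L w) = F ` (W \<inter> L)"
    unfolding H[OF Int_lower1] using W(4) Fg by (force simp: image_iff)
  then have "openin (top_of_set N) (F ` (W \<inter> L))" using P2 by (simp add: local_param_def)
  \<comment> \<open>Inside \<open>V2\<close> the only points of \<open>N\<close> are the images of points of \<open>L\<close>, since parametrisations are open.\<close>
  then obtain V2 where V2: "open V2" "F ` (W \<inter> L) = N \<inter> V2" by (auto simp: openin_open)
  have Fc: "continuous_on W F" using diffeo_homeomorphism[OF d] by (simp add: homeomorphism_def)
  have Finj: "inj_on F W" by (rule diffeo_inj_on[OF d])
  have Fy: "F y = a" using Fg y y1 by auto
  have "open (W \<inter> F -` (V \<inter> V2))"
    by (rule continuous_open_preimage[OF Fc W(1)]) (use V V2 in auto)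
  moreover have "y \<in> W \<inter> F -` (V \<inter> V2)" using W(3) V(2) V2(2) Fy y1 by auto
  ultimately obtain \<rho> where \<rho>: "\<rho> > 0" "ball y \<rho> \<subseteq> W \<inter> F -` (V \<inter> V2)" by (rule openE)
  have key: "F x \<in> X \<longleftrightarrow> x \<in> L" if x: "x \<in> ball y \<rho>" for x
  proof -
    have xW: "x \<in> W" "F x \<in> V" "F x \<in> V2" using \<rho>(2) x by auto
    have "F x \<in> X \<longleftrightarrow> F x \<in> N \<inter> V2" using V(3) xW by blast
    also have "\<dots> \<longleftrightarrow> F x \<in> F ` (W \<inter> L)" by (simp only: V2(2))
    also have "\<dots> \<longleftrightarrow> x \<in> L"
      using inj_on_image_mem_iff[OF Finj xW(1), of "W \<inter> L"] xW(1) by blast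
    finally show ?thesis .
  qed
  have dB: "diffeo (ball y \<rho>) (F ` ball y \<rho>) F G"
    by (rule diffeo_restrict[OF d]) (use \<rho>(2) in blast)
  have oB: "open (F ` ball y \<rho>)"
  proof -
    have "openin (top_of_set W) (ball y \<rho>)"
      using \<rho>(2) by (intro open_subset) auto
    then have "openin (top_of_set Z) (F ` ball y \<rho>)"
      by (rule homeomorphism_imp_open_map[OF diffeo_homeomorphism[OF d]])
    then show ?thesis using W(2) openin_open_eq by blast
  qed
  define \<phi> where "\<phi> = (\<lambda>z. (G z - y) /\<^sub>R \<rho>)"
  define \<psi> where "\<psi> = (\<lambda>x. F (y + \<rho> *\<^sub>R x))"
  have GB: "G z \<in> ball y \<rho>" "F (G z) = z" if "z \<in> F ` ball y \<rho>" for z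
    using that diffeo_inv(1)[OF dB] by auto
  have d\<phi>: "diffeo (F ` ball y \<rho>) (ball 0 1) \<phi> \<psi>"
    unfolding \<phi>_def \<psi>_def
    by (rule diffeo_compose[OF diffeo_sym[OF dB] diffeo_ball_unit[OF \<rho>(1)]])
  have \<phi>B: "\<phi> z \<in> ball 0 1" if "z \<in> F ` ball y \<rho>" for z
    by (rule diffeo_inv(2)[OF d\<phi> that])
  have \<psi>B: "\<phi> (\<psi> x) = x" "\<psi> x \<in> F ` ball y \<rho>" if "x \<in> ball 0 1" for x
    by (rule diffeo_inv[OF diffeo_sym[OF d\<phi>] that])+
  have \<phi>L: "\<phi> z \<in> L \<longleftrightarrow> z \<in> X" if z: "z \<in> F ` ball y \<rho>" for z
  proof -
    have "\<phi> z \<in> L \<longleftrightarrow> G z \<in> L"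
    proof
      assume "\<phi> z \<in> L"
      then have "y + \<rho> *\<^sub>R \<phi> z \<in> L" using L y1 by (auto intro: subspace_add subspace_scale)
      then show "G z \<in> L" using \<rho>(1) by (simp add: \<phi>_def)
    qed (use L y1 in \<open>auto simp: \<phi>_def intro: subspace_scale subspace_diff\<close>)
    then show ?thesis using key[OF GB(1)[OF z]] GB(2)[OF z] by simp
  qed
  have "\<phi> ` (X \<inter> F ` ball y \<rho>) = L \<inter> ball 0 1"
  proof (rule image_eq_inverse[where g = \<psi>])
    show "\<phi> z \<in> L \<inter> ball 0 1" if "z \<in> X \<inter> F ` ball y \<rho>" for z
      using that \<phi>L \<phi>B by blast
    show "\<psi> x \<in> X \<inter> F ` ball y \<rho>" "\<phi> (\<psi> x) = x" if "x \<in> L \<inter> ball 0 1" for x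
      using that \<phi>L[of "\<psi> x"] \<psi>B[of x] by auto
  qed
  then have XY: "(L \<inter> ball 0 1) \<inter> ball 0 1 = \<phi> ` (X \<inter> F ` ball y \<rho>)" by blast
  have aB: "a \<in> F ` ball y \<rho>" using Fy \<rho>(1) by force
  have "\<phi> a = 0" using Fy diffeo_inv(1)[OF dB, of y] \<rho>(1) by (auto simp: \<phi>_def)
  then have "conic_point (L \<inter> ball 0 1) (\<phi> a)" using conic_point_subspace[OF L] by simp
  then show ?thesis by (rule conic_point_diffeo[OF d\<phi> oB open_ball aB XY])
qed


section \<open>Charts, singular points and stereographic projection\<close>

lemma smooth_chart_diffeo:
  assumes "smooth_chart M U B \<psi>"
  shows "diffeo U B \<psi> (inv_into U \<psi>)"
  using assms unfolding smooth_chart_def diffeo_def by (auto simp: bij_betw_def)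

lemma smooth_chartI:
  assumes "openin (top_of_set M) U" "open B" and d: "diffeo U B \<psi> \<tau>"
  shows "smooth_chart M U B \<psi>"
proof -
  have inj: "inj_on \<psi> U" by (rule diffeo_inj_on[OF d])
  have im: "\<psi> ` U = B" and s: "smooth_on U \<psi>" "smooth_on B \<tau>" using d by (auto simp: diffeo_def)
  have "\<tau> y = inv_into U \<psi> y" if "y \<in> B" for y
  proof -
    obtain x where x: "x \<in> U" "y = \<psi> x" using im \<open>y \<in> B\<close> by blast
    then show ?thesis using diffeo_inv(1)[OF d x(1)] inv_into_f_f[OF inj x(1)] by simp
  qed
  then have "smooth_on B (inv_into U \<psi>)" using smooth_on_cong[OF _ s(2)] by blast
  then show ?thesis using assms s inj im by (simp add: smooth_chart_def bij_betw_def)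
qed

lemma conic_point_change_chart:
  fixes \<kappa> \<kappa>' :: "'b::euclidean_space \<Rightarrow> 'a::euclidean_space"
  assumes U: "openin (top_of_set M) U" "open B" "diffeo U B \<kappa> \<tau>"
    and U': "openin (top_of_set M) U'" "open B'" "diffeo U' B' \<kappa>' \<tau>'"
    and z: "z \<in> U" "z \<in> U'" and conic: "conic_point (\<kappa>' ` (W \<inter> U')) (\<kappa>' z)"
  shows "conic_point (\<kappa> ` (W \<inter> U)) (\<kappa> z)"
proof -
  define O1 where "O1 = \<kappa> ` (U \<inter> U')"
  define O2 where "O2 = \<kappa>' ` (U \<inter> U')"
  have inj: "inj_on \<kappa> U" "inj_on \<kappa>' U'"
    by (rule diffeo_inj_on[OF U(3)], rule diffeo_inj_on[OF U'(3)])
  have opn: "open (f ` (U \<inter> U'))"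
    if "openin (top_of_set C) (U \<inter> U')" "open D" "diffeo C D f h"
    for C and D :: "'a set" and f :: "'b \<Rightarrow> 'a" and h
    using homeomorphism_imp_open_map[OF diffeo_homeomorphism[OF that(3)] that(1)] that(2)
    by (simp add: openin_open_eq)
  have sub: "U \<subseteq> M" "U' \<subseteq> M" using U(1) U'(1) openin_imp_subset by auto
  have "openin (top_of_set M) (U \<inter> U')" using U(1) U'(1) by (rule openin_Int)
  then have "openin (top_of_set U) (U \<inter> U')" "openin (top_of_set U') (U \<inter> U')"
    using sub by (auto intro: openin_subset_trans)
  then have o: "open O1" "open O2" unfolding O1_def O2_def using opn U U' by blast+
  have d1: "diffeo (U \<inter> U') O1 \<kappa> \<tau>" unfolding O1_def by (rule diffeo_restrict[OF U(3)]) simp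
  have d2: "diffeo (U \<inter> U') O2 \<kappa>' \<tau>'" unfolding O2_def by (rule diffeo_restrict[OF U'(3)]) simp
  have d: "diffeo O1 O2 (\<lambda>x. \<kappa>' (\<tau> x)) (\<lambda>x. \<kappa> (\<tau>' x))"
    by (rule diffeo_compose[OF diffeo_sym[OF d1] d2])
  have a: "\<kappa> z \<in> O1" using z by (simp add: O1_def)
  have 1: "\<kappa>' ` (W \<inter> U') \<inter> O2 = \<kappa>' ` (W \<inter> U \<inter> U')"
    unfolding O2_def using inj_on_image_Int[OF inj(2), of "W \<inter> U'" "U \<inter> U'"]
    by (simp add: Int_ac)
  have 2: "\<kappa> ` (W \<inter> U) \<inter> O1 = \<kappa> ` (W \<inter> U \<inter> U')"
    unfolding O1_def using inj_on_image_Int[OF inj(1), of "W \<inter> U" "U \<inter> U'"]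
    by (simp add: Int_ac)
  have "\<kappa>' ` (W \<inter> U') \<inter> O2 = (\<lambda>x. \<kappa>' (\<tau> x)) ` (\<kappa> ` (W \<inter> U) \<inter> O1)"
    unfolding 1 2 image_image by (rule image_cong) (simp_all add: diffeo_inv(1)[OF U(3)])
  moreover have "conic_point (\<kappa>' ` (W \<inter> U')) (\<kappa>' (\<tau> (\<kappa> z)))"
    using conic diffeo_inv(1)[OF U(3) z(1)] by simp
  ultimately show ?thesis by (rule conic_point_diffeo[OF d o a])
qed

text \<open>
  Two charts differ by a diffeomorphism of open sets, so any chart may be used in place of those in the definition of
  \<open>conic_at\<close>, also one that is not centred or not onto the unit ball.
\<close>

proposition conic_at_iff_conic_point:
  fixes \<kappa> :: "'a::euclidean_space \<times> real \<Rightarrow> 'a"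
  assumes U: "openin (top_of_set M) U" "open B" "diffeo U B \<kappa> \<tau>" and z: "z \<in> U" "z \<in> W"
  shows "conic_at M W z \<longleftrightarrow> conic_point (\<kappa> ` (W \<inter> U)) (\<kappa> z)"
proof
  assume "conic_at M W z"
  then obtain U' and \<psi> :: "'a \<times> real \<Rightarrow> 'a" where c: "smooth_chart M U' (ball 0 1) \<psi>" "z \<in> U'"
    "conic_point (\<psi> ` (W \<inter> U')) (\<psi> z)"
    unfolding conic_at_def by blast
  have "openin (top_of_set M) U'" using c(1) by (simp add: smooth_chart_def)
  then show "conic_point (\<kappa> ` (W \<inter> U)) (\<kappa> z)"
    by (rule conic_point_change_chart[OF U _ open_ball smooth_chart_diffeo[OF c(1)] z(1) c(2,3)])
next
  assume conic: "conic_point (\<kappa> ` (W \<inter> U)) (\<kappa> z)"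
  have "\<kappa> z \<in> B" by (rule diffeo_inv(2)[OF U(3) z(1)])
  then obtain \<rho> where \<rho>: "\<rho> > 0" "ball (\<kappa> z) \<rho> \<subseteq> B" using U(2) openE by blast
  define U' where "U' = \<tau> ` ball (\<kappa> z) \<rho>"
  have dU': "diffeo U' (ball (\<kappa> z) \<rho>) \<kappa> \<tau>"
    unfolding U'_def by (rule diffeo_sym[OF diffeo_restrict[OF diffeo_sym[OF U(3)] \<rho>(2)]])
  define \<psi> where "\<psi> = (\<lambda>x. (\<kappa> x - \<kappa> z) /\<^sub>R \<rho>)"
  have d: "diffeo U' (ball 0 1) \<psi> (\<lambda>y. \<tau> (\<kappa> z + \<rho> *\<^sub>R y))"
    unfolding \<psi>_def by (rule diffeo_compose[OF dU' diffeo_ball_unit[OF \<rho>(1)]])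
  have "openin (top_of_set B) (ball (\<kappa> z) \<rho>)" using \<rho>(2) by (intro open_subset) auto
  then have "openin (top_of_set U) U'"
    unfolding U'_def by (rule homeomorphism_imp_open_map[OF diffeo_homeomorphism[OF diffeo_sym[OF U(3)]]])
  then have o: "openin (top_of_set M) U'" using U(1) openin_trans by blast
  have zU': "z \<in> U'"
    unfolding U'_def using diffeo_inv(1)[OF U(3) z(1)] \<rho>(1) by (metis centre_in_ball imageI)
  have "conic_point (\<psi> ` (W \<inter> U')) (\<psi> z)"
    by (rule conic_point_change_chart[OF o open_ball d U zU' z(1) conic])
  then show "conic_at M W z"
    unfolding conic_at_def using z(2) zU' smooth_chartI[OF o open_ball d]
    by (intro conjI exI[of _ U'] exI[of _ \<psi>]) (auto simp: \<psi>_def)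
qed

text \<open>
  For \<open>S \<subseteq> M\<close> this is the negation of being singular. It mentions neither \<open>M\<close> nor an auxiliary sub-manifold, which makes
  it easy to move from one space to another.
\<close>

definition regular_at :: "'a::euclidean_space set \<Rightarrow> 'a \<Rightarrow> bool" where
  "regular_at S p \<longleftrightarrow>
     (\<exists>V. open V \<and> p \<in> V \<and> bd_submanifold (S \<inter> V) \<and> mf_boundary (S \<inter> V) = {})"

lemma singular_points_iff_regular_at:
  assumes "S \<subseteq> M"
  shows "p \<in> singular_points M S \<longleftrightarrow> p \<in> S \<and> \<not> regular_at S p"
proof -
  have "(\<exists>N V. submanifold M N \<and> open V \<and> p \<in> V \<and> S \<inter> V = N \<inter> V) \<longleftrightarrow> regular_at S p"
  proof
    assume "\<exists>N V. submanifold M N \<and> open V \<and> p \<in> V \<and> S \<inter> V = N \<inter> V"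
    then obtain N V where N: "submanifold M N" and V: "open V" "p \<in> V" "S \<inter> V = N \<inter> V" by blast
    then show "regular_at S p"
      unfolding regular_at_def submanifold_def
      by (intro exI[of _ V]) (simp add: bd_submanifold_local mf_boundary_local)
  next
    assume "regular_at S p"
    then obtain V where "open V" "p \<in> V" "bd_submanifold (S \<inter> V)" "mf_boundary (S \<inter> V) = {}"
      unfolding regular_at_def by blast
    then show "\<exists>N V. submanifold M N \<and> open V \<and> p \<in> V \<and> S \<inter> V = N \<inter> V"
      using assms by (intro exI[of _ "S \<inter> V"] exI[of _ V]) (auto simp: submanifold_def)
  qed
  then show ?thesis unfolding singular_points_def by blast
qed

lemma regular_at_local:
  assumes V: "open V" "p \<in> V"
  shows "regular_at (S \<inter> V) p \<longleftrightarrow> regular_at S p"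
proof
  assume "regular_at (S \<inter> V) p"
  then obtain V' where "open V'" "p \<in> V'" "bd_submanifold (S \<inter> V \<inter> V')" "mf_boundary (S \<inter> V \<inter> V') = {}"
    unfolding regular_at_def by blast
  then show "regular_at S p"
    unfolding regular_at_def using V by (intro exI[of _ "V \<inter> V'"]) (auto simp: Int_assoc)
next
  assume "regular_at S p"
  then obtain V' where V': "open V'" "p \<in> V'" "bd_submanifold (S \<inter> V')" "mf_boundary (S \<inter> V') = {}"
    unfolding regular_at_def by blast
  have "S \<inter> V \<inter> V' = S \<inter> V' \<inter> V" by blast
  then show "regular_at (S \<inter> V) p"
    unfolding regular_at_def using V V'
    by (intro exI[of _ V']) (simp add: bd_submanifold_local mf_boundary_local)
qed

lemma regular_at_diffeo_image:
  assumes d: "diffeo A B f h" and S: "S \<subseteq> A" and p: "p \<in> S" and r: "regular_at S p"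
  shows "regular_at (f ` S) (f p)"
proof -
  obtain V where V: "open V" "p \<in> V" "bd_submanifold (S \<inter> V)" "mf_boundary (S \<inter> V) = {}"
    using r unfolding regular_at_def by blast
  have SV: "S \<inter> V \<subseteq> A" using S by blast
  have "openin (top_of_set S) (S \<inter> V)" using V(1) by blast
  then have "openin (top_of_set (f ` S)) (f ` (S \<inter> V))"
    by (rule homeomorphism_imp_open_map[OF diffeo_homeomorphism[OF diffeo_restrict[OF d S]]])
  then obtain V' where V': "open V'" "f ` (S \<inter> V) = f ` S \<inter> V'" by (auto simp: openin_open)
  have "bd_submanifold (f ` (S \<inter> V))" "mf_boundary (f ` (S \<inter> V)) = {}"
    using bd_submanifold_transfer[OF d SV V(3)] mf_boundary_transfer[OF d SV] V(4) by auto
  moreover have "f p \<in> V'" using V'(2) p V(2) by blast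
  ultimately show ?thesis unfolding regular_at_def using V' by (intro exI[of _ V']) simp
qed

lemma regular_at_diffeo:
  assumes d: "diffeo A B f h" and S: "S \<subseteq> A" and p: "p \<in> S"
  shows "regular_at (f ` S) (f p) \<longleftrightarrow> regular_at S p"
proof
  assume "regular_at (f ` S) (f p)"
  moreover have "f ` S \<subseteq> B" "f p \<in> f ` S" using d S p by (auto simp: diffeo_def)
  ultimately have "regular_at (h ` f ` S) (h (f p))"
    using regular_at_diffeo_image[OF diffeo_sym[OF d]] by blast
  then show "regular_at S p"
    using diffeo_image_inverse[OF d S] diffeo_inv(1)[OF d, of p] S p by auto
qed (rule regular_at_diffeo_image[OF assms])

lemma singular_points_chart:
  assumes U: "openin (top_of_set M) U" "diffeo U B \<kappa> \<tau>" and W: "W \<subseteq> M" and z: "z \<in> U" "z \<in> W"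
  shows "z \<in> singular_points M W \<longleftrightarrow> \<kappa> z \<in> singular_points UNIV (\<kappa> ` (W \<inter> U))"
proof -
  obtain V where V: "open V" "U = M \<inter> V" using U(1) by (auto simp: openin_open)
  have WV: "W \<inter> V = W \<inter> U" using V W by blast
  have "z \<in> singular_points M W \<longleftrightarrow> \<not> regular_at W z"
    using z by (simp add: singular_points_iff_regular_at[OF W])
  also have "\<dots> \<longleftrightarrow> \<not> regular_at (W \<inter> U) z"
    using regular_at_local[OF V(1), of z W] z V(2) WV by simp
  also have "\<dots> \<longleftrightarrow> \<not> regular_at (\<kappa> ` (W \<inter> U)) (\<kappa> z)"
    using regular_at_diffeo[OF U(2), of "W \<inter> U" z] z by simp
  also have "\<dots> \<longleftrightarrow> \<kappa> z \<in> singular_points UNIV (\<kappa> ` (W \<inter> U))"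
    using z by (simp add: singular_points_iff_regular_at)
  finally show ?thesis .
qed

definition stereographic :: "'a::euclidean_space \<times> real \<Rightarrow> 'a" where
  "stereographic p = fst p /\<^sub>R (1 - snd p)"

definition reflection :: "'a::euclidean_space \<times> real \<Rightarrow> 'a \<times> real" where
  "reflection p = (fst p, - snd p)"

lemma mem_unit_sphere_prod: "(x, t :: real) \<in> sphere 0 1 \<longleftrightarrow> (norm x)\<^sup>2 + t\<^sup>2 = 1"
  by (simp add: norm_Pair real_sqrt_eq_1_iff)

lemma inv_stereographic_mem: "inv_stereographic x \<in> sphere 0 1 - {(0, 1)}"
proof -
  define q where "q = (norm x)\<^sup>2"
  have "0 \<le> q" by (simp add: q_def)
  then have q: "q + 1 \<noteq> 0" "0 \<le> q" by linarith+
  have n: "(norm ((2 / (q + 1)) *\<^sub>R x))\<^sup>2 = 4 * q / (q + 1)\<^sup>2"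
    by (simp add: power_mult_distrib power_divide q_def)
  have "4 * q / (q + 1)\<^sup>2 + ((q - 1) / (q + 1))\<^sup>2 = (q + 1)\<^sup>2 / (q + 1)\<^sup>2"
    unfolding power_divide add_divide_distrib[symmetric] by (simp add: power2_eq_square algebra_simps)
  also have "\<dots> = 1" using q by simp
  finally have "inv_stereographic x \<in> sphere 0 1"
    unfolding inv_stereographic_def mem_unit_sphere_prod q_def[symmetric] n .
  moreover have "(q - 1) / (q + 1) \<noteq> 1" using q by (simp add: divide_eq_eq)
  ultimately show ?thesis unfolding inv_stereographic_def by (auto simp: q_def)
qed

lemma stereographic_inv: "stereographic (inv_stereographic x) = x"
proof -
  define q where "q = (norm x)\<^sup>2"
  have "0 \<le> q" by (simp add: q_def)
  then have q: "q + 1 \<noteq> 0" by linarith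
  then have d: "1 - (q - 1) / (q + 1) = 2 / (q + 1)" by (simp add: field_simps)
  have c: "2 / (q + 1) \<noteq> 0" using q by simp
  show ?thesis
    unfolding stereographic_def inv_stereographic_def q_def[symmetric] fst_conv snd_conv d
      scaleR_scaleR left_inverse[OF c] by simp
qed

lemma inv_stereographic_inv:
  assumes p: "p \<in> sphere 0 1 - {(0, 1)}"
  shows "snd p \<noteq> 1" "inv_stereographic (stereographic p) = p"
proof -
  obtain x t where pt: "p = (x, t)" by (cases p)
  have s: "(norm x)\<^sup>2 + t\<^sup>2 = 1" using p unfolding pt by (simp add: mem_unit_sphere_prod[symmetric])
  have t: "t \<noteq> 1"
  proof
    assume "t = 1"
    then show False using s p by (simp add: pt)
  qed
  then show "snd p \<noteq> 1" by (simp add: pt)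
  have x: "(norm x)\<^sup>2 = (1 - t) * (1 + t)" using s by (simp add: power2_eq_square algebra_simps)
  have n: "(norm (x /\<^sub>R (1 - t)))\<^sup>2 = (1 + t) / (1 - t)"
  proof -
    have "(norm (x /\<^sub>R (1 - t)))\<^sup>2 = (norm x)\<^sup>2 / (1 - t)\<^sup>2"
      by (simp add: power_mult_distrib power_inverse divide_inverse mult.commute)
    also have "\<dots> = (1 - t) * (1 + t) / ((1 - t) * (1 - t))" unfolding x by (simp only: power2_eq_square)
    also have "\<dots> = (1 + t) / (1 - t)" using t by simp
    finally show ?thesis .
  qed
  have d: "(1 + t) / (1 - t) + 1 = 2 / (1 - t)" "(1 + t) / (1 - t) - 1 = 2 * t / (1 - t)"
    using t by (simp_all add: field_simps)
  have e: "2 / (2 / (1 - t)) * inverse (1 - t) = 1" "2 * t / (1 - t) / (2 / (1 - t)) = t"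
    using t by (simp_all add: divide_simps)
  show "inv_stereographic (stereographic p) = p"
    unfolding inv_stereographic_def stereographic_def pt fst_conv snd_conv n d scaleR_scaleR e
    by simp
qed

lemma diffeo_inv_stereographic:
  "diffeo UNIV (sphere 0 1 - {(0, 1)}) inv_stereographic (stereographic :: 'a::euclidean_space \<times> real \<Rightarrow> 'a)"
  unfolding diffeo_def
proof (intro conjI ballI)
  have nz: "x \<bullet> x + 1 \<noteq> 0" for x :: 'a using inner_ge_zero[of x] by linarith
  have "Cinf_on UNIV (\<lambda>x :: 'a. ((2 / (x \<bullet> x + 1)) *\<^sub>R x, (x \<bullet> x - 1) / (x \<bullet> x + 1)))"
    by (intro Cinf_on_intros open_UNIV nz)
  moreover have "(\<lambda>x :: 'a. ((2 / (x \<bullet> x + 1)) *\<^sub>R x, (x \<bullet> x - 1) / (x \<bullet> x + 1))) = inv_stereographic"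
    by (rule ext) (simp add: inv_stereographic_def power2_norm_eq_inner)
  ultimately show "smooth_on UNIV (inv_stereographic :: 'a \<Rightarrow> _)"
    by (intro smooth_onI[OF open_UNIV]) auto
  have o: "open {p :: 'a \<times> real. snd p \<noteq> 1}"
    by (intro open_Collect_neq continuous_intros)
  show "smooth_on (sphere 0 1 - {(0, 1)}) (stereographic :: 'a \<times> real \<Rightarrow> 'a)"
  proof (rule smooth_onI[OF o])
    show "sphere 0 1 - {(0, 1)} \<subseteq> {p :: 'a \<times> real. snd p \<noteq> 1}"
      using inv_stereographic_inv(1) by blast
    show "Cinf_on {p :: 'a \<times> real. snd p \<noteq> 1} stereographic"
      unfolding stereographic_def by (intro Cinf_on_intros o) auto
  qed
  show "range (inv_stereographic :: 'a \<Rightarrow> _) = sphere 0 1 - {(0, 1)}"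
    by (rule image_eq_inverse[where g = stereographic])
      (simp_all only: inv_stereographic_mem UNIV_I inv_stereographic_inv(2))
qed (rule stereographic_inv)

lemma diffeo_reflection:
  "diffeo (sphere 0 1 - {(0, - 1)}) (sphere 0 1 - {(0, 1)}) reflection
    (reflection :: 'a::euclidean_space \<times> real \<Rightarrow> 'a \<times> real)"
  unfolding diffeo_def
proof (intro conjI ballI)
  have "Cinf_on UNIV (reflection :: 'a \<times> real \<Rightarrow> 'a \<times> real)"
    unfolding reflection_def by (intro Cinf_on_intros open_UNIV)
  then have "smooth_on S (reflection :: 'a \<times> real \<Rightarrow> 'a \<times> real)" for S
    by (intro smooth_onI[OF open_UNIV]) auto
  then show "smooth_on (sphere 0 1 - {(0, - 1)}) (reflection :: 'a \<times> real \<Rightarrow> 'a \<times> real)"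
    "smooth_on (sphere 0 1 - {(0, 1)}) (reflection :: 'a \<times> real \<Rightarrow> 'a \<times> real)" by blast+
  show "reflection ` (sphere 0 1 - {(0, - 1)}) = sphere 0 1 - {(0, 1) :: 'a \<times> real}"
    by (rule image_eq_inverse[where g = reflection])
      (auto simp: reflection_def norm_Pair prod_eq_iff)
qed (simp add: reflection_def)


section \<open>Sets conic at infinity in polar coordinates\<close>

text \<open>
  The set \<open>X\<close> without 0, in the coordinates \<open>(s,u)\<close> of the collar at infinity, \<open>x = u / s\<close>.
\<close>

definition radial_ends :: "'a::euclidean_space set \<Rightarrow> (real \<times> 'a) set" where
  "radial_ends X = {p \<in> blowup_space. 0 < fst p \<and> snd p /\<^sub>R fst p \<in> X}"

lemma polar_cyl_eq: "polar_cyl r = blowup_space \<inter> ({..<r} \<times> UNIV)"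
  by (auto simp: polar_cyl_def blowup_space_def)

lemma infinity_collar_inj: "inj_on infinity_collar (blowup_space :: (real \<times> 'a::euclidean_space) set)"
proof (rule inj_onI)
  fix p q :: "real \<times> 'a"
  assume p: "p \<in> blowup_space" and q: "q \<in> blowup_space" and eq: "infinity_collar p = infinity_collar q"
  obtain s u t v where pq: "p = (s, u)" "q = (t, v)" by (cases p, cases q)
  have n: "norm u = 1" "norm v = 1" "0 \<le> s" "0 \<le> t" using p q by (auto simp: pq blowup_space_def)
  show "p = q"
  proof (cases "s = 0 \<or> t = 0")
    case True
    then show ?thesis using eq by (auto simp: infinity_collar_def pq split: if_splits)
  next
    case False
    then have uv: "u /\<^sub>R s = v /\<^sub>R t" using eq by (simp add: infinity_collar_def pq)
    then have "norm (u /\<^sub>R s) = norm (v /\<^sub>R t)" by simp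
    then have "s = t" using n False by simp
    then show ?thesis using uv False by (simp add: pq)
  qed
qed

lemma closure_radial_ends_pos:
  assumes X: "closed X" and p: "p \<in> blowup_space" "0 < fst p"
  shows "p \<in> closure (radial_ends X) \<longleftrightarrow> snd p /\<^sub>R fst p \<in> X"
proof
  assume "p \<in> closure (radial_ends X)"
  then obtain P where P: "\<And>n. P n \<in> radial_ends X" "P \<longlonglongrightarrow> p"
    unfolding closure_sequential by blast
  have lim: "(\<lambda>n. snd (P n) /\<^sub>R fst (P n)) \<longlonglongrightarrow> snd p /\<^sub>R fst p"
    by (intro tendsto_intros P(2)) (use p in simp)
  have "snd (P n) /\<^sub>R fst (P n) \<in> X" for n using P(1)[of n] by (simp add: radial_ends_def)
  then show "snd p /\<^sub>R fst p \<in> X" by (rule closed_sequentially[OF X _ lim])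
next
  assume "snd p /\<^sub>R fst p \<in> X"
  then have "p \<in> radial_ends X" using p by (simp add: radial_ends_def)
  then show "p \<in> closure (radial_ends X)" using closure_subset by blast
qed

lemma infinity_collar_carrier: "p \<in> blowup_space \<Longrightarrow> infinity_collar p \<in> compactified_carrier"
  by (auto simp: blowup_space_def infinity_collar_def compactified_carrier_def split: prod.splits)

text \<open>
  The candidate \<open>C\<close> for the closure has closed traces in both pieces of the compactification, so it is closed. It adds to
  \<open>X\<close> only those points at infinity that are limits in the collar.
\<close>

lemma infinity_collar_mem_closure:
  fixes X :: "'a::euclidean_space set"
  assumes X: "closed X" and q: "q \<in> blowup_space"
  shows "infinity_collar q \<in> compactified_top closure_of (Fin ` X) \<longleftrightarrow> q \<in> closure (radial_ends X)"
proof -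
  define C where "C = Fin ` X \<union> Inf ` {u \<in> sphere 0 1. (0, u) \<in> closure (radial_ends X)}"
  have CC: "C \<subseteq> compactified_carrier" by (auto simp: C_def compactified_carrier_def)
  have collar: "infinity_collar p \<in> C \<longleftrightarrow> p \<in> closure (radial_ends X)" if p: "p \<in> blowup_space" for p
  proof (cases "fst p = 0")
    case True
    then show ?thesis using p by (auto simp: C_def infinity_collar_def blowup_space_def)
  next
    case False
    then have "0 < fst p" using p by (auto simp: blowup_space_def)
    then show ?thesis
      unfolding closure_radial_ends_pos[OF X p \<open>0 < fst p\<close>]
      by (auto simp: C_def infinity_collar_def case_prod_beta)
  qed
  have "compactified_open (compactified_carrier - C)"
    unfolding compactified_open_def blowup_space_def[symmetric]
  proof (intro conjI)
    have "{x. Fin x \<in> compactified_carrier - C} = - X"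
      by (auto simp: C_def compactified_carrier_def)
    then show "open {x. Fin x \<in> compactified_carrier - C}" using X by (simp add: open_Compl)
    have "{p \<in> blowup_space. infinity_collar p \<in> compactified_carrier - C} =
        blowup_space \<inter> - closure (radial_ends X)"
      using collar infinity_collar_carrier by blast
    then show "openin (top_of_set blowup_space)
        {p \<in> blowup_space. infinity_collar p \<in> compactified_carrier - C}"
      by (simp add: openin_open_Int open_Compl)
  qed blast
  then have "closedin compactified_top C"
    using CC by (simp add: closedin_def topspace_compactified_top openin_compactified_top)
  then have 1: "compactified_top closure_of (Fin ` X) \<subseteq> C"
    by (intro closure_of_minimal) (auto simp: C_def)
  have 2: "C \<subseteq> compactified_top closure_of (Fin ` X)"
  proof
    fix z assume z: "z \<in> C"
    show "z \<in> compactified_top closure_of (Fin ` X)"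
      unfolding in_closure_of topspace_compactified_top openin_compactified_top
    proof (intro conjI allI impI)
      show "z \<in> compactified_carrier" using z CC by blast
      fix T assume T: "z \<in> T \<and> compactified_open T"
      show "\<exists>y. y \<in> Fin ` X \<and> y \<in> T"
      proof (cases "z \<in> Fin ` X")
        case True
        then show ?thesis using T by blast
      next
        case False
        then obtain u where u: "z = Inf u" "norm u = 1" "(0, u) \<in> closure (radial_ends X)"
          using z by (auto simp: C_def)
        have "openin (top_of_set blowup_space) {p \<in> blowup_space. infinity_collar p \<in> T}"
          using T by (simp add: compactified_open_def blowup_space_def)
        then obtain V where V: "open V" "{p \<in> blowup_space. infinity_collar p \<in> T} = blowup_space \<inter> V"
          by (auto simp: openin_open)
        have "(0, u) \<in> {p \<in> blowup_space. infinity_collar p \<in> T}"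
          using u T by (simp add: blowup_space_def infinity_collar_def)
        then have "(0, u) \<in> V" using V(2) by blast
        then obtain p where p: "p \<in> radial_ends X" "p \<in> V"
          using u(3) V(1) unfolding closure_iff_nhds_not_empty by blast
        then have pb: "p \<in> blowup_space" "0 < fst p" "snd p /\<^sub>R fst p \<in> X"
          by (auto simp: radial_ends_def)
        then have "infinity_collar p = Fin (snd p /\<^sub>R fst p)"
          by (simp add: infinity_collar_def case_prod_beta)
        moreover have "infinity_collar p \<in> T" using V(2) pb(1) p(2) by blast
        ultimately show ?thesis using pb(3) by blast
      qed
    qed
  qed
  have "compactified_top closure_of (Fin ` X) = C" using 1 2 by (rule subset_antisym)
  then show ?thesis using collar[OF q] by simp
qed

text \<open>
  The directions of an unbounded sequence of points accumulate on the compact sphere.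
\<close>

lemma unbounded_closure_radial_ends:
  fixes X :: "'a::euclidean_space set"
  assumes "\<not> bounded X"
  shows "\<exists>u. norm u = 1 \<and> (0, u) \<in> closure (radial_ends X)"
proof -
  have "\<exists>x\<in>X. real (Suc n) < norm x" for n
    using assms by (auto simp: bounded_iff not_le)
  then obtain x where x: "\<And>n. x n \<in> X" "\<And>n. real (Suc n) < norm (x n)" by metis
  define P where "P = (\<lambda>n. (inverse (norm (x n)), x n /\<^sub>R norm (x n)))"
  have pos: "0 < norm (x n)" "1 < norm (x n)" for n using x(2)[of n] by linarith+
  have P: "P n \<in> radial_ends X" for n
    using pos[of n] x(1)[of n] by (auto simp: P_def radial_ends_def blowup_space_def)
  have "compact ({0..1 :: real} \<times> (sphere 0 1 :: 'a set))" by (intro compact_Times compact_sphere) simp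
  moreover have "P n \<in> {0..1} \<times> sphere 0 1" for n
    using pos[of n] by (auto simp: P_def inverse_le_1_iff)
  ultimately obtain l k where l: "l \<in> {0..1} \<times> sphere 0 1" "strict_mono (k :: nat \<Rightarrow> nat)" "(P \<circ> k) \<longlonglongrightarrow> l"
    unfolding compact_def by metis
  have lc: "l \<in> closure (radial_ends X)"
    unfolding closure_sequential using P l(3) by (intro exI[of _ "P \<circ> k"]) simp
  have "(\<lambda>n. inverse (norm (x n))) \<longlonglongrightarrow> 0"
  proof (rule tendsto_sandwich[OF _ _ tendsto_const LIMSEQ_inverse_real_of_nat])
    show "\<forall>\<^sub>F n in sequentially. inverse (norm (x n)) \<le> inverse (real (Suc n))"
      by (intro always_eventually allI le_imp_inverse_le) (use x(2) less_imp_le in auto)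
  qed simp
  then have "(\<lambda>n. fst (P (k n))) \<longlonglongrightarrow> 0"
    using LIMSEQ_subseq_LIMSEQ[OF _ l(2)] by (fastforce simp: P_def o_def)
  moreover have "(\<lambda>n. fst (P (k n))) \<longlonglongrightarrow> fst l" using tendsto_fst[OF l(3)] by (simp add: o_def)
  ultimately have "fst l = 0" using LIMSEQ_unique by blast
  then have "l = (0, snd l)" by (simp add: prod_eq_iff)
  then have "(0, snd l) \<in> closure (radial_ends X)" using lc by simp
  then show ?thesis using l(1) by (intro exI[of _ "snd l"]) (auto simp: mem_Times_iff)
qed

text \<open>
  The part of the closure outside \<open>V\<close> with \<open>s \<le> 1\<close> is compact and misses the end \<open>s = 0\<close>, so \<open>s\<close> has a positive minimum
  on it.
\<close>

lemma radial_ends_near_boundary: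
  fixes X :: "'a::euclidean_space set"
  assumes V: "open V" and b: "\<And>u. norm u = 1 \<Longrightarrow> (0, u) \<in> closure (radial_ends X) \<Longrightarrow> (0, u) \<in> V"
  obtains r where "r > 0" "polar_cyl r \<inter> closure (radial_ends X) \<subseteq> V"
proof -
  define K where "K = ({0..1} \<times> sphere 0 1) \<inter> closure (radial_ends X) \<inter> - V"
  have K: "compact K"
    unfolding K_def
    by (intro compact_Int_closed compact_Times compact_sphere) (use V in \<open>auto simp: closed_Compl\<close>)
  show ?thesis
  proof (cases "K = {}")
    case True
    have "polar_cyl 1 \<inter> closure (radial_ends X) \<subseteq> V"
    proof -
      have "polar_cyl 1 \<subseteq> {0..1 :: real} \<times> (sphere 0 1 :: 'a set)" by (auto simp: polar_cyl_def)
      then show ?thesis using True unfolding K_def by blast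
    qed
    then show ?thesis using that[of 1] by simp
  next
    case False
    have "continuous_on K fst" by (intro continuous_intros)
    then obtain q where q: "q \<in> K" "\<And>p. p \<in> K \<Longrightarrow> fst q \<le> fst p"
      using continuous_attains_inf[OF K False] by metis
    have "fst q \<noteq> 0"
    proof
      assume "fst q = 0"
      then have "q = (0, snd q)" by (simp add: prod_eq_iff)
      then show False using q(1) b[of "snd q"] by (auto simp: K_def)
    qed
    then have q0: "0 < fst q" "fst q \<le> 1" using q(1) by (auto simp: K_def)
    have "polar_cyl (fst q) \<inter> closure (radial_ends X) \<subseteq> V"
    proof
      fix p assume p: "p \<in> polar_cyl (fst q) \<inter> closure (radial_ends X)"
      then have "p \<notin> K" using q(2)[of p] by (auto simp: polar_cyl_def)
      then show "p \<in> V" using p q0 by (auto simp: K_def polar_cyl_def)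
    qed
    then show ?thesis using that q0(1) by blast
  qed
qed

text \<open>
  The gluing map of the compactification over the interior of the collar of width \<open>r\<close>.
\<close>

lemma diffeo_collar:
  fixes r :: real
  assumes r: "r > 0"
  shows "diffeo (polar_cyl r \<inter> ({0<..} \<times> UNIV)) {x :: 'a::euclidean_space. 1 / r < norm x}
    (\<lambda>p. snd p /\<^sub>R fst p) (\<lambda>x. (inverse (norm x), x /\<^sub>R norm x))"
  unfolding diffeo_def
proof (intro conjI ballI)
  have o: "open ({0 :: real <..} \<times> (UNIV :: 'a set))" by (simp add: open_Times)
  show "smooth_on (polar_cyl r \<inter> ({0<..} \<times> UNIV)) (\<lambda>p :: real \<times> 'a. snd p /\<^sub>R fst p)"
    by (rule smooth_onI[OF o Int_lower2]) (intro Cinf_on_intros o, auto)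
  have o': "open (- {0 :: 'a})" by (simp add: open_Compl)
  have nz: "x \<noteq> 0" if "1 / r < norm x" for x :: 'a
    using that r by (metis norm_zero not_less_iff_gr_or_eq order_less_trans zero_less_divide_1_iff)
  show "smooth_on {x :: 'a. 1 / r < norm x} (\<lambda>x. (inverse (norm x), x /\<^sub>R norm x))"
  proof (rule smooth_onI[OF o'])
    show "{x :: 'a. 1 / r < norm x} \<subseteq> - {0}" using nz by blast
    show "Cinf_on (- {0 :: 'a}) (\<lambda>x. (inverse (norm x), x /\<^sub>R norm x))"
      by (intro Cinf_on_intros o') auto
  qed
  show "(\<lambda>p. snd p /\<^sub>R fst p) ` (polar_cyl r \<inter> ({0<..} \<times> UNIV)) = {x :: 'a. 1 / r < norm x}"
  proof (rule image_eq_inverse[where g = "\<lambda>x. (inverse (norm x), x /\<^sub>R norm x)"])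
    fix p :: "real \<times> 'a" assume "p \<in> polar_cyl r \<inter> ({0<..} \<times> UNIV)"
    then have "0 < fst p" "fst p < r" "norm (snd p) = 1" by (auto simp: polar_cyl_def)
    then show "snd p /\<^sub>R fst p \<in> {x. 1 / r < norm x}" by (simp add: field_simps)
  next
    fix x :: 'a assume x: "x \<in> {x. 1 / r < norm x}"
    then have "0 < norm x" using nz by auto
    then show "(inverse (norm x), x /\<^sub>R norm x) \<in> polar_cyl r \<inter> ({0<..} \<times> UNIV)"
      using x r by (auto simp: polar_cyl_def field_simps)
    show "snd (inverse (norm x), x /\<^sub>R norm x) /\<^sub>R fst (inverse (norm x), x /\<^sub>R norm x) = x"
      using \<open>0 < norm x\<close> by simp
  qed
  fix p :: "real \<times> 'a" assume "p \<in> polar_cyl r \<inter> ({0<..} \<times> UNIV)"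
  then have "0 < fst p" "norm (snd p) = 1" by (auto simp: polar_cyl_def)
  then show "(inverse (norm (snd p /\<^sub>R fst p)), (snd p /\<^sub>R fst p) /\<^sub>R norm (snd p /\<^sub>R fst p)) = p"
    by (simp add: prod_eq_iff)
qed

text \<open>
  The germ along the points at infinity is represented by a whole collar of width \<open>r\<close>. Conversely a p-sub-manifold of the
  collar is one of the compactification, since over the interior the collar is diffeomorphic to \<open>{x. 1 / r < |x|}\<close>.
\<close>

proposition conic_at_infinity_iff:
  fixes X :: "'a::euclidean_space set"
  assumes X: "closed X" and unb: "\<not> bounded X"
  shows "conic_at_infinity X \<longleftrightarrow>
    (\<exists>r>0. p_submanifold (polar_cyl r) (polar_cyl r \<inter> closure (radial_ends X)))"
proof
  define Xbar where "Xbar = compactified_top closure_of (Fin ` X)"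
  note mem = infinity_collar_mem_closure[OF X, folded Xbar_def]
  {
    assume "conic_at_infinity X"
    then obtain N V where N: "compactified_p_submanifold N" and V: "compactified_open V"
      and b: "Xbar \<inter> Inf ` sphere 0 1 \<subseteq> V" and eq: "Xbar \<inter> V = N \<inter> V"
      using unb unfolding conic_at_infinity_def Let_def Xbar_def openin_compactified_top by blast
    define Nc where "Nc = {p \<in> blowup_space. infinity_collar p \<in> N}"
    have Nc: "p_submanifold blowup_space Nc"
      using N by (simp add: compactified_p_submanifold_def Nc_def blowup_space_def)
    obtain V' where V': "open V'" "{p \<in> blowup_space. infinity_collar p \<in> V} = blowup_space \<inter> V'"
      using V by (auto simp: compactified_open_def openin_open blowup_space_def)
    have "(0, u) \<in> V'" if "norm u = 1" "(0, u) \<in> closure (radial_ends X)" for u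
    proof -
      have bu: "(0, u) \<in> blowup_space" using that by (simp add: blowup_space_def)
      have "infinity_collar (0, u) \<in> Xbar" using mem[OF bu] that by simp
      then have "infinity_collar (0, u) \<in> V"
        using b that by (auto simp: infinity_collar_def)
      then show ?thesis using V'(2) bu by blast
    qed
    then obtain r where r: "r > 0" "polar_cyl r \<inter> closure (radial_ends X) \<subseteq> V'"
      using radial_ends_near_boundary[OF V'(1)] by metis
    define O' where "O' = V' \<inter> ({..<r} \<times> (UNIV :: 'a set))"
    have O': "open O'" "open ({..<r} \<times> (UNIV :: 'a set))"
      using V'(1) by (auto simp: O'_def open_Times)
    \<comment> \<open>Within the collar of width \<open>r\<close> all of \<open>X\<close> lies in \<open>V\<close>, where it agrees with \<open>N\<close>.\<close>
    have "p \<in> Nc \<inter> O' \<longleftrightarrow> p \<in> polar_cyl r \<inter> closure (radial_ends X)" for p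
    proof -
      have "p \<in> closure (radial_ends X) \<longleftrightarrow> p \<in> Nc" if p: "p \<in> blowup_space" "p \<in> V'"
      proof -
        have "infinity_collar p \<in> V" using p V'(2) by blast
        then show ?thesis using mem[OF p(1)] eq p(1) by (auto simp: Nc_def)
      qed
      then show ?thesis
        using r(2) by (auto simp: Nc_def O'_def polar_cyl_eq)
    qed
    then have T: "Nc \<inter> O' = polar_cyl r \<inter> closure (radial_ends X)" by blast
    have "p_submanifold (blowup_space \<inter> O') (Nc \<inter> O')"
      by (rule p_submanifold_restrict[OF O'(1) Nc])
    then have "p_submanifold blowup_space (Nc \<inter> O')"
      using p_submanifold_open_ambient[OF O'(1) Int_lower2] by blast
    moreover have "Nc \<inter> O' \<subseteq> {..<r} \<times> UNIV" by (auto simp: O'_def)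
    ultimately have "p_submanifold (polar_cyl r) (polar_cyl r \<inter> closure (radial_ends X))"
      using p_submanifold_open_ambient[OF O'(2)] unfolding T polar_cyl_eq by blast
    then show "\<exists>r>0. p_submanifold (polar_cyl r) (polar_cyl r \<inter> closure (radial_ends X))"
      using r(1) by blast
  next
    assume "\<exists>r>0. p_submanifold (polar_cyl r) (polar_cyl r \<inter> closure (radial_ends X))"
    then obtain r where r: "r > 0" "p_submanifold (polar_cyl r) (polar_cyl r \<inter> closure (radial_ends X))"
      by blast
    define T where "T = polar_cyl r \<inter> closure (radial_ends X)"
    define N where "N = infinity_collar ` T"
    define V where "V = infinity_collar ` (polar_cyl r :: (real \<times> 'a) set)"
    have sub: "T \<subseteq> polar_cyl r" "polar_cyl r \<subseteq> (blowup_space :: (real \<times> 'a) set)"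
      by (auto simp: T_def polar_cyl_eq)
    have inj: "infinity_collar p \<in> infinity_collar ` S \<longleftrightarrow> p \<in> S"
      if "p \<in> blowup_space" "S \<subseteq> blowup_space" for p :: "real \<times> 'a" and S
      by (rule inj_on_image_mem_iff[OF infinity_collar_inj that])
    have Fin_collar: "Fin x \<in> infinity_collar ` S \<longleftrightarrow> x \<in> (\<lambda>p. snd p /\<^sub>R fst p) ` (S \<inter> ({0<..} \<times> UNIV))"
      if S: "S \<subseteq> blowup_space" for S and x :: 'a
    proof -
      have "Fin x = infinity_collar p \<longleftrightarrow> 0 < fst p \<and> x = snd p /\<^sub>R fst p" if "p \<in> S" for p
        using that S by (auto simp: infinity_collar_def case_prod_beta blowup_space_def)
      then have "(\<exists>p\<in>S. Fin x = infinity_collar p) \<longleftrightarrow> (\<exists>p\<in>S. 0 < fst p \<and> x = snd p /\<^sub>R fst p)"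
        by blast
      then show ?thesis unfolding image_iff Bex_def by (simp add: mem_Times_iff conj_assoc)
    qed
    note dc = diffeo_collar[OF r(1), where 'a = 'a]
    have on: "open {x :: 'a. 1 / r < norm x}" by (intro open_Collect_less continuous_intros)
    have Vo: "compactified_open V"
      unfolding compactified_open_def blowup_space_def[symmetric]
    proof (intro conjI)
      show "V \<subseteq> compactified_carrier"
        unfolding V_def using infinity_collar_carrier sub(2) by blast
      have "{x. Fin x \<in> V} = {x. 1 / r < norm x}"
        unfolding V_def Fin_collar[OF sub(2)] using dc by (simp add: diffeo_def)
      then show "open {x. Fin x \<in> V}" using on by simp
      have "{p \<in> blowup_space. infinity_collar p \<in> V} = blowup_space \<inter> ({..<r} \<times> UNIV)"
        unfolding V_def using inj[OF _ sub(2)] sub(2) polar_cyl_eq[of r] by blast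
      then show "openin (top_of_set blowup_space) {p \<in> blowup_space. infinity_collar p \<in> V}"
        by (simp add: openin_open_Int open_Times)
    qed
    have b: "Xbar \<inter> Inf ` sphere 0 1 \<subseteq> V"
    proof
      fix z assume "z \<in> Xbar \<inter> Inf ` sphere 0 1"
      then obtain u where "norm u = 1" "z = Inf u" by auto
      then have "z = infinity_collar (0, u)" "(0, u) \<in> polar_cyl r"
        using r(1) by (auto simp: infinity_collar_def polar_cyl_def)
      then show "z \<in> V" unfolding V_def by blast
    qed
    have eq: "Xbar \<inter> V = N \<inter> V"
    proof -
      have "infinity_collar p \<in> Xbar \<longleftrightarrow> infinity_collar p \<in> N" if p: "p \<in> polar_cyl r" for p
      proof -
        have pb: "p \<in> blowup_space" using p sub(2) by blast
        have "T \<subseteq> blowup_space" using sub by blast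
        then have "infinity_collar p \<in> N \<longleftrightarrow> p \<in> T" unfolding N_def by (rule inj[OF pb])
        then show ?thesis using mem[OF pb] p by (simp add: T_def)
      qed
      then show ?thesis by (auto simp: V_def)
    qed
    have ne: "Xbar \<inter> Inf ` sphere 0 1 \<noteq> {}"
    proof -
      obtain u where u: "norm u = 1" "(0, u) \<in> closure (radial_ends X)"
        using unbounded_closure_radial_ends[OF unb] by blast
      then have "infinity_collar (0, u) \<in> Xbar" using mem[of "(0, u)"] by (simp add: blowup_space_def)
      then have "Inf u \<in> Xbar \<inter> Inf ` sphere 0 1" using u by (simp add: infinity_collar_def)
      then show ?thesis by blast
    qed
    have "compactified_p_submanifold N"
      unfolding compactified_p_submanifold_def blowup_space_def[symmetric]
    proof (intro conjI)
      have Tb: "T \<subseteq> blowup_space" using sub by blast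
      show "N \<subseteq> compactified_carrier"
        unfolding N_def using infinity_collar_carrier Tb by blast
      have o: "open ({..<r} \<times> (UNIV :: 'a set))" "open ({0 :: real <..} \<times> (UNIV :: 'a set))"
        by (simp_all add: open_Times)
      have "T \<subseteq> {..<r} \<times> UNIV" by (auto simp: T_def polar_cyl_def)
      then have "p_submanifold blowup_space T"
        using r(2) p_submanifold_open_ambient[OF o(1), of T blowup_space]
        unfolding T_def[symmetric] polar_cyl_eq[symmetric] by blast
      moreover have "{p \<in> blowup_space. infinity_collar p \<in> N} = T"
        unfolding N_def using inj[OF _ Tb] Tb by blast
      ultimately show "p_submanifold blowup_space {p \<in> blowup_space. infinity_collar p \<in> N}" by simp
      have "p_submanifold (polar_cyl r \<inter> ({0<..} \<times> UNIV)) (T \<inter> ({0<..} \<times> UNIV))"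
        by (rule p_submanifold_restrict[OF o(2) r(2)[folded T_def]])
      from p_submanifold_transfer[OF dc this]
      have "p_submanifold {x. 1 / r < norm x} {x. Fin x \<in> N}"
        unfolding N_def Fin_collar[OF Tb] by simp
      moreover from this have "{x. Fin x \<in> N} \<subseteq> {x. 1 / r < norm x}" by (simp add: p_submanifold_def)
      ultimately show "p_submanifold UNIV {x. Fin x \<in> N}"
        using p_submanifold_open_ambient[OF on, of "{x. Fin x \<in> N}" UNIV] by simp
    qed
    then show "conic_at_infinity X"
      unfolding conic_at_infinity_def Let_def Xbar_def[symmetric] openin_compactified_top
      using ne Vo b eq by blast
  }
qed


section \<open>The correspondence between the Euclidean space and the sphere\<close>

lemma diffeo_south_chart:
  "diffeo (sphere 0 1 - {(0, - 1)}) UNIV (\<lambda>p. stereographic (reflection p))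
    (\<lambda>x :: 'a::euclidean_space. reflection (inv_stereographic x))"
  by (rule diffeo_compose[OF diffeo_reflection diffeo_sym[OF diffeo_inv_stereographic]])

text \<open>
  The change from the chart at the south pole to the chart at the north pole is the inversion in the unit sphere,
  which turns the collar at infinity into polar coordinates at 0.
\<close>

lemma stereographic_south_inversion:
  "stereographic (reflection (inv_stereographic x)) = x /\<^sub>R (norm x)\<^sup>2"
proof -
  define q where "q = (norm x)\<^sup>2"
  have "0 \<le> q" by (simp add: q_def)
  then have q: "q + 1 \<noteq> 0" by linarith
  then have d: "1 - - ((q - 1) / (q + 1)) = 2 * q / (q + 1)" by (simp add: field_simps)
  have "inverse (2 * q / (q + 1)) * (2 / (q + 1)) = inverse q"
    using q by (cases "q = 0") (simp_all add: divide_simps)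
  then show ?thesis
    unfolding stereographic_def reflection_def inv_stereographic_def q_def[symmetric] fst_conv snd_conv
      d scaleR_scaleR by simp
qed

theorem proposition4p12:
  fixes X :: "'a::euclidean_space set"
  assumes "closed X"
  shows "conic_singular_submanifold X \<longleftrightarrow>
         conic_singular_submanifold_of (sphere 0 1)
           (top_of_set (sphere 0 1) closure_of (inv_stereographic ` X))"
proof -
  define S where "S = (sphere 0 1 :: ('a \<times> real) set)"
  define Sn where "Sn = S - {(0, 1)}"
  define Ss where "Ss = S - {(0, - 1)}"
  define \<kappa> where "\<kappa> = (\<lambda>p :: 'a \<times> real. stereographic (reflection p))"
  define W where "W = top_of_set S closure_of (inv_stereographic ` X)"
  define Y where "Y = \<kappa> ` (W \<inter> Ss)"
  have dN: "diffeo Sn (UNIV :: 'a set) stereographic inv_stereographic"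
    unfolding Sn_def S_def by (rule diffeo_sym[OF diffeo_inv_stereographic])
  have dS: "diffeo Ss UNIV \<kappa> (\<lambda>x. reflection (inv_stereographic x))"
    unfolding Ss_def S_def \<kappa>_def by (rule diffeo_south_chart)
  have oN: "openin (top_of_set S) Sn" and oS: "openin (top_of_set S) Ss"
    unfolding Sn_def Ss_def by (auto intro: openin_delete)
  have WS: "W \<subseteq> S" unfolding W_def by (metis closure_of_subset_topspace topspace_euclidean_subtopology)
  have Wc: "closedin (top_of_set S) W" by (simp add: W_def)
  have Wcl: "closed W" using closedin_closed_trans[OF Wc] by (simp add: S_def)
  have \<sigma>X: "inv_stereographic ` X \<subseteq> Sn" using diffeo_sym[OF dN] by (auto simp: diffeo_def)
  \<comment> \<open>As \<open>X\<close> is closed, taking the closure adds at most the north pole.\<close>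
  have WX: "W \<inter> Sn = inv_stereographic ` X"
  proof -
    have "inv_stereographic ` X = Sn \<inter> closure (inv_stereographic ` X)"
      using homeomorphism_closure_image[OF diffeo_homeomorphism[OF diffeo_sym[OF dN]], of X]
        closure_closed[OF assms] by simp
    moreover have "W = S \<inter> closure (inv_stereographic ` X)"
    proof -
      have "S \<inter> inv_stereographic ` X = inv_stereographic ` X" using \<sigma>X by (auto simp: Sn_def)
      then show ?thesis
        unfolding W_def closure_of_subtopology by (simp add: euclidean_closure_of)
    qed
    ultimately show ?thesis by (auto simp: Sn_def)
  qed
  have X: "stereographic ` (W \<inter> Sn) = X"
    unfolding WX by (rule image_inverse) (simp add: stereographic_inv)
  have bounded_iff: "bounded X \<longleftrightarrow> (0, 1) \<notin> W"
  proof
    assume "bounded X"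
    then have "compact X" using assms by (simp add: compact_eq_bounded_closed)
    moreover have "continuous_on X inv_stereographic"
      using diffeo_homeomorphism[OF diffeo_sym[OF dN]] continuous_on_subset
      by (auto simp: homeomorphism_def)
    ultimately have "closed (inv_stereographic ` X)"
      using compact_continuous_image compact_imp_closed by blast
    then have "W = inv_stereographic ` X"
      unfolding W_def using \<sigma>X
      by (intro closure_of_closedin closed_subset) (auto simp: Sn_def)
    then show "(0, 1) \<notin> W" using \<sigma>X by (auto simp: Sn_def)
  next
    assume "(0, 1) \<notin> W"
    then have W: "W \<inter> Sn = W" using WS by (auto simp: Sn_def)
    have "compact W"
      using closedin_compact[OF compact_sphere] Wc unfolding S_def by blast
    moreover have "continuous_on W stereographic"
      using diffeo_homeomorphism[OF dN] W by (metis Int_lower2 continuous_on_subset homeomorphism_def)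
    ultimately have "compact (stereographic ` W)" by (rule compact_continuous_image[rotated])
    then show "bounded X" using X W compact_imp_bounded by auto
  qed
  have points: "conic_at S W (inv_stereographic a) \<longleftrightarrow> conic_point X a"
    "inv_stereographic a \<in> singular_points S W \<longleftrightarrow> a \<in> singular_points UNIV X" if a: "a \<in> X" for a
  proof -
    have z: "inv_stereographic a \<in> Sn" "inv_stereographic a \<in> W" using a WX by auto
    show "conic_at S W (inv_stereographic a) \<longleftrightarrow> conic_point X a"
      using conic_at_iff_conic_point[OF oN open_UNIV dN z] by (simp add: X stereographic_inv)
    show "inv_stereographic a \<in> singular_points S W \<longleftrightarrow> a \<in> singular_points UNIV X"
      using singular_points_chart[OF oN dN WS z] by (simp add: X stereographic_inv)
  qed
  have \<kappa>0: "\<kappa> (0, 1) = 0" "(0, 1) \<in> Ss"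
    by (simp_all add: \<kappa>_def reflection_def stereographic_def Ss_def S_def norm_Pair)
  have pole: "conic_at S W (0, 1) \<longleftrightarrow> conic_at_infinity X" if p: "(0, 1) \<in> W"
  proof -
    have "0 \<in> Y" unfolding Y_def using p \<kappa>0 by (metis IntI imageI)
    moreover have "closed Y"
    proof -
      have "closedin (top_of_set Ss) (W \<inter> Ss)" using Wcl by (simp add: Int_commute closedin_closed_Int)
      then have "closedin (top_of_set (UNIV :: 'a set)) Y"
        unfolding Y_def by (rule homeomorphism_imp_closed_map[OF diffeo_homeomorphism[OF dS]])
      then show ?thesis by simp
    qed
    moreover have "polar_cyl r \<inter> closure (polar_trace 0 Y r) = polar_cyl r \<inter> closure (radial_ends X)" for r
    proof -
      have "bl 0 q \<in> Y \<longleftrightarrow> snd q /\<^sub>R fst q \<in> X" if q: "q \<in> polar_cyl r" "0 < fst q" for q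
      proof -
        define y where "y = fst q *\<^sub>R snd q"
        have n: "norm (snd q) = 1" using q(1) by (auto simp: polar_cyl_def)
        let ?z = "reflection (inv_stereographic y)"
        have z: "?z \<in> Ss" "\<kappa> ?z = y" using diffeo_inv[OF diffeo_sym[OF dS] UNIV_I, of y] by blast+
        have inj: "inj_on \<kappa> Ss" by (rule diffeo_inj_on[OF dS])
        have st: "stereographic ?z = snd q /\<^sub>R fst q"
          unfolding stereographic_south_inversion using q(2) n by (simp add: y_def power2_eq_square divide_simps)
        have "y \<noteq> 0" using q(2) n by (auto simp: y_def)
        then have "?z \<noteq> (0, 1)" using \<kappa>0(1) z(2) by metis
        then have zN: "?z \<in> Sn" using z(1) by (simp add: Ss_def Sn_def)
        have "y \<in> Y \<longleftrightarrow> ?z \<in> W"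
          unfolding Y_def using inj_on_image_mem_iff[OF inj z(1), of "W \<inter> Ss"] z by simp
        also have "\<dots> \<longleftrightarrow> stereographic ?z \<in> X"
        proof -
          have "inj_on stereographic Sn" by (rule diffeo_inj_on[OF dN])
          from inj_on_image_mem_iff[OF this zN, of "W \<inter> Sn"] show ?thesis unfolding X using zN by simp
        qed
        finally have "y \<in> Y \<longleftrightarrow> snd q /\<^sub>R fst q \<in> X" unfolding st .
        then show ?thesis by (simp add: y_def bl_def case_prod_beta)
      qed
      then have tr: "polar_trace 0 Y r = radial_ends X \<inter> ({..<r} \<times> UNIV)"
        by (auto simp: polar_trace_def radial_ends_def polar_cyl_eq)
      have "open ({..<r} \<times> (UNIV :: 'a set))" by (simp add: open_Times)
      then show ?thesis
        unfolding tr using mem_closure_Int_open[of "{..<r} \<times> UNIV" _ "radial_ends X"]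
        by (auto simp: polar_cyl_eq)
    qed
    moreover have "locally_closed_at Y 0"
      unfolding locally_closed_at_def using \<open>closed Y\<close> by (intro exI[of _ UNIV]) simp
    ultimately have "conic_point Y 0 \<longleftrightarrow>
        (\<exists>r>0. p_submanifold (polar_cyl r) (polar_cyl r \<inter> closure (radial_ends X)))"
      using closure_subset[of Y] by (auto simp: conic_point_iff)
    then have "conic_point Y 0 \<longleftrightarrow> conic_at_infinity X"
      using conic_at_infinity_iff[OF assms] bounded_iff p by blast
    then show ?thesis
      using conic_at_iff_conic_point[OF oS open_UNIV dS \<kappa>0(2) p] by (simp add: Y_def \<kappa>0)
  qed
  have Wsplit: "W = inv_stereographic ` X \<union> (W \<inter> {(0, 1)})"
    using WX WS by (auto simp: Sn_def)
  have inj: "inj_on inv_stereographic X"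
    using diffeo_inj_on[OF diffeo_sym[OF dN]] by (rule inj_on_subset) simp
  have sing: "finite (singular_points S W) \<longleftrightarrow> finite (singular_points UNIV X)"
  proof -
    have sub: "singular_points UNIV X \<subseteq> X" "singular_points S W \<subseteq> W"
      by (auto simp: singular_points_def)
    have 1: "inv_stereographic ` singular_points UNIV X \<subseteq> singular_points S W"
    proof
      fix z assume "z \<in> inv_stereographic ` singular_points UNIV X"
      then obtain a where a: "a \<in> singular_points UNIV X" "z = inv_stereographic a" by (rule imageE)
      then have "a \<in> X" using sub(1) by blast
      from points(2)[OF this] show "z \<in> singular_points S W" using a by simp
    qed
    have 2: "singular_points S W \<subseteq> inv_stereographic ` singular_points UNIV X \<union> {(0, 1)}"
    proof
      fix z assume z: "z \<in> singular_points S W"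
      then have "z \<in> inv_stereographic ` X \<union> {(0, 1)}" using sub(2) Wsplit by blast
      then show "z \<in> inv_stereographic ` singular_points UNIV X \<union> {(0, 1)}"
      proof
        assume "z \<in> inv_stereographic ` X"
        then obtain a where "z = inv_stereographic a" "a \<in> X" by (rule imageE)
        then show ?thesis using points(2)[of a] z by simp
      qed simp
    qed
    show ?thesis
    proof
      assume "finite (singular_points S W)"
      then have "finite (inv_stereographic ` singular_points UNIV X)" by (rule finite_subset[OF 1])
      then show "finite (singular_points UNIV X)" by (rule finite_imageD[OF _ inj_on_subset[OF inj sub(1)]])
    next
      assume "finite (singular_points UNIV X)"
      then have "finite (inv_stereographic ` singular_points UNIV X \<union> {(0, 1)})" by simp
      then show "finite (singular_points S W)" by (rule finite_subset[OF 2])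
    qed
  qed
  have inf: "conic_at_infinity X \<longleftrightarrow> ((0, 1) \<in> W \<longrightarrow> conic_at S W (0, 1))"
    using pole bounded_iff by (auto simp: conic_at_infinity_def)
  have "(\<forall>z\<in>W. conic_at S W z) \<longleftrightarrow> (\<forall>z\<in>inv_stereographic ` X \<union> (W \<inter> {(0, 1)}). conic_at S W z)"
    by (rule ball_cong[OF Wsplit refl])
  also have "\<dots> \<longleftrightarrow>
      (\<forall>a\<in>X. conic_at S W (inv_stereographic a)) \<and> ((0, 1) \<in> W \<longrightarrow> conic_at S W (0, 1))"
    by auto
  also have "\<dots> \<longleftrightarrow> (\<forall>a\<in>X. conic_point X a) \<and> conic_at_infinity X"
    using points(1) inf by simp
  also have "(\<forall>a\<in>X. conic_point X a) \<longleftrightarrow> (\<forall>a\<in>singular_points UNIV X. conic_point X a)"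
    using conic_point_regular[of _ X] by (metis (no_types, lifting) mem_Collect_eq singular_points_def)
  finally have "(\<forall>z\<in>W. conic_at S W z) \<longleftrightarrow>
      (\<forall>a\<in>singular_points UNIV X. conic_point X a) \<and> conic_at_infinity X" .
  then show ?thesis
    unfolding conic_singular_submanifold_def conic_singular_submanifold_of_def
      S_def[symmetric] W_def[symmetric]
    using assms Wc sing by blast
qed

end
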